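(* Consider the maximum social welfare (MSW) problem with negative concave externalities: $n$ agents, $m$ items, weights $a^i_{jj}\ge 0$ for all $i\in[m],\,j\in[n]$ and $a^i_{jk}\le 0$ for all $i\in[m]$ and $j\neq k$ in $[n]$, and nondecreasing concave externality functions $f_{ij}:\mathbb{R}\to\mathbb{R}$ with $f_{ij}(0)=0$. Assume that every feasible allocation $(S_1,\dots,S_m)$ has nonnegative social welfare $\sum_{i=1}^m\sum_{j\in S_i}f_{ij}\big(\sum_{k\in S_i}a^i_{jk}\big)\ge 0$. Then there is a randomized $e$-approximation algorithm for the MSW problem $$\max_{S_1,\dots,S_m}\ \sum_{i=1}^m\sum_{j\in S_i} f_{ij}\Big(\sum_{k\in S_i}a^i_{jk}\Big),$$ where the maximum is over all feasible allocations.
   Context: Write $[n]=\{1,\dots,n\}$ for the set of agents and $[m]=\{1,\dots,m\}$ for the set of items. There are unlimited copies of each item and each agent receives at most one item. A feasible allocation is a tuple $(S_1,\dots,S_m)$ of pairwise disjoint (possibly empty) subsets of $[n]$; $S_i$ is the set of agents receiving item $i$, and agents in no $S_i$ contribute zero. The real number $a^i_{jk}$ is the influence of agent $k$ on agent $j$ when both receive item $i$, and $a^i_{jj}$ is the intrinsic valuation of item $i$ by agent $j$. A randomized $\alpha$-approximation algorithm for the problem is a randomized polynomial-time algorithm that, on every instance, returns a feasible allocation whose expected social welfare is at least $\frac1\alpha$ times the maximum social welfare over all feasible allocations. Here $e$ is the base of the natural logarithm. *)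

theory Defs
  imports "HOL-Probability.Probability" "HOL-Computational_Algebra.Polynomial"
begin

section \<open>Social welfare with externalities\<close>

text \<open>
  Agents are \<open>1, \<dots>, n\<close> and items \<open>1, \<dots>, m\<close>. The influence \<open>a\<^sup>i\<^sub>j\<^sub>k\<close> of agent \<open>k\<close>
  on agent \<open>j\<close> for item \<open>i\<close> is \<open>weight I i j k\<close>, and \<open>f\<^sub>i\<^sub>j\<close> is \<open>extern I i j\<close>; values at
  indices out of range are irrelevant.
\<close>

record msw =
  agents :: nat
  items :: nat
  weight :: "nat \<Rightarrow> nat \<Rightarrow> nat \<Rightarrow> real"
  extern :: "nat \<Rightarrow> nat \<Rightarrow> real \<Rightarrow> real"

text \<open>An allocation is an \<open>m\<close>-tuple of sets, i.e. an extensional function on \<open>{1..m}\<close>.\<close>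

definition feasible :: "msw \<Rightarrow> (nat \<Rightarrow> nat set) set" where
  "feasible I = {S \<in> {1..items I} \<rightarrow>\<^sub>E Pow {1..agents I}. disjoint_family_on S {1..items I}}"

definition welfare :: "msw \<Rightarrow> (nat \<Rightarrow> nat set) \<Rightarrow> real" where
  "welfare I S = (\<Sum>i\<in>{1..items I}. \<Sum>j\<in>S i. extern I i j (\<Sum>k\<in>S i. weight I i j k))"

definition max_welfare :: "msw \<Rightarrow> real" where
  "max_welfare I = Max (welfare I ` feasible I)"

definition negative_concave :: "msw \<Rightarrow> bool" where
  "negative_concave I \<longleftrightarrow>
     (\<forall>i\<in>{1..items I}. \<forall>j\<in>{1..agents I}. weight I i j j \<ge> 0) \<and>
     (\<forall>i\<in>{1..items I}. \<forall>j\<in>{1..agents I}. \<forall>k\<in>{1..agents I}. j \<noteq> k \<longrightarrow> weight I i j k \<le> 0) \<and>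
     (\<forall>i\<in>{1..items I}. \<forall>j\<in>{1..agents I}.
        mono (extern I i j) \<and> concave_on UNIV (extern I i j) \<and> extern I i j 0 = 0)"

section \<open>Randomized algorithms over the reals\<close>

text \<open>
  Programs run on a randomized unit-cost real-number machine. Besides natural-number memory for
  counters and addresses there is real memory with exact field operations and comparisons.
  The instance is accessed through the numbers \<open>n\<close> and \<open>m\<close>, the weights, and a value oracle for
  the functions \<open>f\<^sub>i\<^sub>j\<close>; randomness comes from fair coins. In order not to exceed the usual
  notion of polynomial time, there is no multiplication on natural numbers (so their bit length
  grows by at most a constant per step), no rounding of reals to natural numbers, and the only
  constants are natural numbers. Memory is organized in named arrays of any dimension;
  a scalar is an array indexed by the empty list.
\<close>

datatype nexp =
    NConst nat
  | NVar string "nexp list"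
  | NAgents
  | NItems
  | NAdd nexp nexp
  | NSub nexp nexp

datatype rexp =
    RNat nexp
  | RVar string "nexp list"
  | RWeight nexp nexp nexp
  | ROracle nexp nexp rexp
  | RAdd rexp rexp
  | RSub rexp rexp
  | RMul rexp rexp
  | RDiv rexp rexp

datatype bexp =
    NLess nexp nexp
  | RLess rexp rexp
  | BNot bexp
  | BAnd bexp bexp

datatype com =
    NAssign string "nexp list" nexp
  | RAssign string "nexp list" rexp
  | Coin string "nexp list"
  | Cond bexp "com list" "com list"
  | While bexp "com list"

record store =
  nmem :: "string \<Rightarrow> nat list \<Rightarrow> nat"
  rmem :: "string \<Rightarrow> nat list \<Rightarrow> real"

primrec nval :: "msw \<Rightarrow> store \<Rightarrow> nexp \<Rightarrow> nat" where
  "nval I s (NConst k) = k"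
| "nval I s (NVar x es) = nmem s x (map (nval I s) es)"
| "nval I s NAgents = agents I"
| "nval I s NItems = items I"
| "nval I s (NAdd a b) = nval I s a + nval I s b"
| "nval I s (NSub a b) = nval I s a - nval I s b"

primrec rval :: "msw \<Rightarrow> store \<Rightarrow> rexp \<Rightarrow> real" where
  "rval I s (RNat a) = real (nval I s a)"
| "rval I s (RVar x es) = rmem s x (map (nval I s) es)"
| "rval I s (RWeight i j k) = weight I (nval I s i) (nval I s j) (nval I s k)"
| "rval I s (ROracle i j e) = extern I (nval I s i) (nval I s j) (rval I s e)"
| "rval I s (RAdd a b) = rval I s a + rval I s b"
| "rval I s (RSub a b) = rval I s a - rval I s b"
| "rval I s (RMul a b) = rval I s a * rval I s b"
| "rval I s (RDiv a b) = rval I s a / rval I s b"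

primrec bval :: "msw \<Rightarrow> store \<Rightarrow> bexp \<Rightarrow> bool" where
  "bval I s (NLess a b) \<longleftrightarrow> nval I s a < nval I s b"
| "bval I s (RLess a b) \<longleftrightarrow> rval I s a < rval I s b"
| "bval I s (BNot b) \<longleftrightarrow> \<not> bval I s b"
| "bval I s (BAnd b c) \<longleftrightarrow> bval I s b \<and> bval I s c"

definition nwrite :: "string \<Rightarrow> nat list \<Rightarrow> nat \<Rightarrow> store \<Rightarrow> store" where
  "nwrite x is v s = s\<lparr>nmem := (nmem s)(x := (nmem s x)(is := v))\<rparr>"

definition rwrite :: "string \<Rightarrow> nat list \<Rightarrow> real \<Rightarrow> store \<Rightarrow> store" where
  "rwrite x is v s = s\<lparr>rmem := (rmem s)(x := (rmem s x)(is := v))\<rparr>"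

text \<open>
  A configuration consists of the commands still to be executed and the store; it is halted when
  no command is left. One step executes a command or evaluates a guard. As a fixed program contains
  only finitely many expressions, charging one step per command is unit cost per elementary
  operation and per oracle call, up to a constant factor.
\<close>

fun step :: "msw \<Rightarrow> com list \<times> store \<Rightarrow> (com list \<times> store) pmf" where
  "step I ([], s) = return_pmf ([], s)"
| "step I (NAssign x es e # cs, s) =
     return_pmf (cs, nwrite x (map (nval I s) es) (nval I s e) s)"
| "step I (RAssign x es e # cs, s) =
     return_pmf (cs, rwrite x (map (nval I s) es) (rval I s e) s)"
| "step I (Coin x es # cs, s) =
     map_pmf (\<lambda>b. (cs, nwrite x (map (nval I s) es) (of_bool b) s)) (bernoulli_pmf (1 / 2))"
| "step I (Cond b cs1 cs2 # cs, s) =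
     return_pmf ((if bval I s b then cs1 else cs2) @ cs, s)"
| "step I (While b cs1 # cs, s) =
     return_pmf (if bval I s b then cs1 @ While b cs1 # cs else cs, s)"

primrec steps :: "msw \<Rightarrow> nat \<Rightarrow> com list \<times> store \<Rightarrow> (com list \<times> store) pmf" where
  "steps I 0 c = return_pmf c"
| "steps I (Suc t) c = bind_pmf (step I c) (steps I t)"

definition run :: "com list \<Rightarrow> msw \<Rightarrow> nat \<Rightarrow> (com list \<times> store) pmf" where
  "run P I t = steps I t (P, \<lparr>nmem = (\<lambda>x is. 0), rmem = (\<lambda>x is. 0)\<rparr>)"

text \<open>The output is the incidence matrix of items and agents stored in the array \<open>S\<close>.\<close>

definition allocation :: "msw \<Rightarrow> com list \<times> store \<Rightarrow> nat \<Rightarrow> nat set" where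
  "allocation I c = (\<lambda>i\<in>{1..items I}. {j \<in> {1..agents I}. nmem (snd c) ''S'' [i, j] \<noteq> 0})"

text \<open>
  The polynomial bounds the worst-case number of steps over all coin tosses. Halted configurations
  do not change any more, so \<open>run P I (poly p (n + m))\<close> is the distribution of final configurations.
\<close>

definition randomized_approximation :: "msw set \<Rightarrow> real \<Rightarrow> com list \<Rightarrow> bool" where
  "randomized_approximation Is \<alpha> P \<longleftrightarrow>
     (\<exists>p :: nat poly. \<forall>I\<in>Is.
        let D = run P I (poly p (agents I + items I)) in
          (\<forall>c\<in>set_pmf D. fst c = [] \<and> allocation I c \<in> feasible I) \<and>
          measure_pmf.expectation D (\<lambda>c. welfare I (allocation I c)) \<ge> 1 / \<alpha> * max_welfare I)"

end

theory Submission
  imports Defs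
begin

text \<open>
  Write \<open>W X\<close> for the welfare of a set \<open>X\<close> of (item, agent) pairs. Concavity makes \<open>W\<close> submodular,
  and \<open>W\<close> is nonnegative because every single-item allocation is feasible, so the problem is to
  maximize a nonnegative submodular function over assignments. The ratio of measured continuous greedy
  is \<open>1/e\<close> only up to a discretization error; to reach \<open>1/e\<close> exactly, we use the aided variant of
  Buchbinder and Feldman, whose ratio exceeds \<open>1/e\<close> by a constant. With an approximate local optimum
  \<open>Z\<close> and an optimum \<open>O\<close>, either \<open>W Z \<ge> W O / e\<close> or \<open>W (Z \<union> O) + W (Z \<inter> O)\<close> is at
  most about \<open>2 W O / e\<close>; in the second case a greedy process that avoids \<open>Z\<close> during the first quarter of
  the time beats \<open>W O / e\<close>.

  The algorithm is deterministic. The fractional solution is a random set: the union of blocks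
  \<open>B\<^sub>k\<close>, each included independently with probability \<open>d\<close>. The number of blocks is a constant, so
  expectations are computed exactly by enumerating all index sets. In each round the agents choose, one
  after the other, an item and one of \<open>l\<close> new blocks. Spreading the agents over \<open>l\<close> blocks reduces
  the loss from simultaneous inclusion to a factor \<open>1 - 1/l\<close>, so neither the step size nor the
  number of blocks depends on the instance. Finally the agents are rounded one by one: fixing an agent to
  its best item in all outcomes at once loses nothing, since its presence is positively and its marginal
  value negatively correlated with the included blocks.
\<close>

section \<open>Nonnegative submodular functions\<close>

text \<open>Why avoiding \<open>Z\<close> helps: for \<open>P\<close> between \<open>O - Z\<close>
  and \<open>O\<close> and a set \<open>R\<close> disjoint from \<open>Z\<close>,
  \<open>(P \<union> R) \<inter> (Z \<union> O) = P\<close>, so submodularity gives \<open>W (P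
  \<union> R) \<ge> W P - W (Z \<union> O) + W (Z \<union> O \<union> R)\<close>. In expectation the
  last term decays only like \<open>(1 - d) ^ t\<close>, so the loss after a quarter of the time is
  \<open>(1 - x) * W (Z \<union> O)\<close> with \<open>x\<close> close to e^(-1/4), instead of
  \<open>(1 - x) * W O\<close>. In the limit the guarantee is x^3 (7/4 - x - 2 (1 - x) / e), about
  0.382 against 1/e, about 0.368; this gap pays for the finite \<open>l\<close> and for the
  tolerance \<open>1/p\<close> of the local search. The weights are arbitrary reals, so the running
  time must not depend on their magnitudes. The local search therefore uses the relative threshold
  \<open>W Z / (p * n)\<close>: its first move reaches the best single pair, and after that linear
  growth bounds the number of moves. The machine cannot multiply natural numbers. Loop counts that
  are products become nested or unrolled loops, and probabilities become natural constants after
  clearing denominators, which leaves every comparison unchanged.\<close>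

locale submodular_function =
  fixes W :: "'e set \<Rightarrow> real"
  assumes submodular: "W (A \<union> B) + W (A \<inter> B) \<le> W A + W B"
    and nonneg: "0 \<le> W A"
    and empty: "W {} = 0"
begin

lemma marginal_antimono:
  assumes "A \<subseteq> A'" "e \<notin> A'"
  shows "W (insert e A') - W A' \<le> W (insert e A) - W A"
proof -
  have "insert e A \<union> A' = insert e A'" "insert e A \<inter> A' = A" using assms by auto
  then show ?thesis using submodular[of "insert e A" A'] by simp
qed

lemma union_le_sum_marginals:
  assumes "finite O'"
  shows "W (A \<union> O') - W A \<le> (\<Sum>e\<in>O'. W (insert e A) - W A)"
  using assms
proof (induction O' rule: finite_induct)
  case (insert e F)
  have "W (A \<union> insert e F) - W (A \<union> F) \<le> W (insert e A) - W A"
  proof (cases "e \<in> A \<union> F")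
    case True
    then have "A \<union> insert e F = A \<union> F" by auto
    moreover have "0 \<le> W (insert e A) - W A" if "e \<in> A" using that by (simp add: insert_absorb)
    ultimately show ?thesis using True insert.hyps by auto
  next
    case False
    then show ?thesis using marginal_antimono[of A "A \<union> F" e] by simp
  qed
  then show ?case using insert by simp
qed simp

text \<open>Telescoping: removing a pair from the whole of \<open>Z\<close> loses the least, because
  its marginal value is smallest at the largest set.\<close>

lemma sum_removals_le:
  assumes "finite Z'" "Z' \<subseteq> Z"
  shows "(\<Sum>z\<in>Z'. W Z - W (Z - {z})) \<le> W Z - W (Z - Z')"
  using assms
proof (induction Z' rule: finite_induct)
  case (insert e F)
  have "insert e (Z - insert e F) = Z - F" "insert e (Z - {e}) = Z" using insert by auto
  then have "W Z - W (Z - {e}) \<le> W (Z - F) - W (Z - insert e F)"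
    using marginal_antimono[of "Z - insert e F" "Z - {e}" e] by auto
  then show ?case using insert by simp
qed simp

text \<open>Each agent is charged separately. The marginal of its pair in \<open>Ot\<close> minus
  the removal cost of its pair in \<open>Z\<close> is at most the gain of the corresponding swap or
  drop, hence at most \<open>\<eta>\<close>. Summed over agents, the marginals dominate
  \<open>W (Z \<union> Ot) - W Z\<close> and the removal costs are at most
  \<open>W Z - W (Z \<inter> Ot)\<close>.\<close>

lemma local_optimum:
  fixes agent :: "'e \<Rightarrow> 'q" and \<eta> :: real
  assumes fin: "finite Q" "finite Ot" "finite Z" and sub: "agent ` Ot \<subseteq> Q" "agent ` Z \<subseteq> Q"
    and inj: "inj_on agent Ot" "inj_on agent Z"
    and swap: "\<And>e. e \<in> Ot \<Longrightarrow> W (insert e {z\<in>Z. agent z \<noteq> agent e}) \<le> W Z + \<eta>"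
    and drop: "\<And>q. q \<in> Q \<Longrightarrow> W {z\<in>Z. agent z \<noteq> q} \<le> W Z + \<eta>"
    and eta: "0 \<le> \<eta>"
  shows "W (Z \<union> Ot) + W (Z \<inter> Ot) \<le> 2 * W Z + card Q * \<eta>"
proof -
  let ?O = "\<lambda>q. {e \<in> Ot - Z. agent e = q}" and ?Z = "\<lambda>q. {e \<in> Z - Ot. agent e = q}"
  have one: "(\<Sum>e\<in>?O q. W (insert e Z) - W Z) \<le> (\<Sum>z\<in>?Z q. W Z - W (Z - {z})) + \<eta>" if q: "q \<in> Q" for q
  proof -
    have sing: "\<exists>x. ?O q = {} \<or> ?O q = {x}" using inj(1) by (auto simp: inj_on_def) blast
    have singZ: "\<exists>x. ?Z q = {} \<or> ?Z q = {x}" using inj(2) by (auto simp: inj_on_def) blast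
    show ?thesis
    proof (cases "?O q = {}")
      case True
      have "0 \<le> (\<Sum>z\<in>?Z q. W Z - W (Z - {z})) + \<eta>"
      proof (cases "?Z q = {}")
        case False
        then obtain z where z: "?Z q = {z}" using singZ by blast
        then have "z \<in> Z" "agent z = q" by auto
        then have "{x\<in>Z. agent x \<noteq> q} = Z - {z}" using inj(2) by (auto simp: inj_on_def)
        then show ?thesis using drop[OF q] z by simp
      next
        case True
        then show ?thesis using eta by (simp only: sum.empty)
      qed
      then show ?thesis using True by (simp only: sum.empty)
    next
      case False
      then obtain e where e: "?O q = {e}" using sing by blast
      then have eO: "e \<in> Ot" "e \<notin> Z" "agent e = q" by auto
      show ?thesis
      proof (cases "\<exists>z\<in>Z. agent z = q")
        case True
        then obtain z where z: "z \<in> Z" "agent z = q" by blast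
        then have zO: "z \<notin> Ot" using inj(1) eO by (metis inj_on_def)
        have Zq: "?Z q = {z}" using z zO inj(2) by (auto simp: inj_on_def)
        have "{x\<in>Z. agent x \<noteq> q} = Z - {z}" using z inj(2) by (auto simp: inj_on_def)
        then have "W (insert e (Z - {z})) \<le> W Z + \<eta>" using swap[OF eO(1)] eO by simp
        \<comment> \<open>The marginal of \<open>e\<close> at \<open>Z\<close> is at most its
          marginal at \<open>Z - {z}\<close>, and inserting \<open>e\<close> there produces exactly
          the swapped set.\<close>
        then have "W (insert e Z) - W Z \<le> W Z + \<eta> - W (Z - {z})"
          using marginal_antimono[of "Z - {z}" Z e] eO by auto
        then show ?thesis using e Zq by simp
      next
        case none: False
        then have Zq: "{x\<in>Z. agent x \<noteq> agent e} = Z" "?Z q = {}" using eO by auto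
        have "(\<Sum>z\<in>?Z q. W Z - W (Z - {z})) = 0" unfolding Zq(2) by (rule sum.empty)
        moreover have "(\<Sum>e\<in>?O q. W (insert e Z) - W Z) = W (insert e Z) - W Z" unfolding e by simp
        moreover have "W (insert e Z) \<le> W Z + \<eta>" using swap[OF eO(1)] unfolding Zq(1) .
        ultimately show ?thesis by linarith
      qed
    qed
  qed
  have "W (Z \<union> (Ot - Z)) - W Z \<le> (\<Sum>e\<in>Ot - Z. W (insert e Z) - W Z)"
    using fin by (intro union_le_sum_marginals) auto
  also have "\<dots> = (\<Sum>q\<in>Q. \<Sum>e\<in>?O q. W (insert e Z) - W Z)"
    using fin sub by (intro sum.group[symmetric]) auto
  also have "\<dots> \<le> (\<Sum>q\<in>Q. (\<Sum>z\<in>?Z q. W Z - W (Z - {z})) + \<eta>)" using one by (intro sum_mono)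
  also have "\<dots> = (\<Sum>q\<in>Q. \<Sum>z\<in>?Z q. W Z - W (Z - {z})) + card Q * \<eta>" by (simp add: sum.distrib)
  also have "(\<Sum>q\<in>Q. \<Sum>z\<in>?Z q. W Z - W (Z - {z})) = (\<Sum>z\<in>Z - Ot. W Z - W (Z - {z}))"
    using fin sub by (intro sum.group) auto
  also have "\<dots> \<le> W Z - W (Z - (Z - Ot))" using fin by (intro sum_removals_le) auto
  finally show ?thesis by (simp add: Int_absorb1 Diff_Diff_Int)
qed

end

section \<open>Random index sets\<close>

text \<open>The expectation of \<open>g\<close> at a random subset of \<open>{..<K}\<close> that
  contains each index independently with probability \<open>d\<close>. Recursion on the last index
  makes conditioning on it the induction step; \<open>avg_eq_sum\<close> gives the explicit
  form.\<close>

primrec avg :: "real \<Rightarrow> nat \<Rightarrow> (nat set \<Rightarrow> real) \<Rightarrow> real" where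
  "avg d 0 g = g {}"
| "avg d (Suc K) g = d * avg d K (\<lambda>J. g (insert K J)) + (1 - d) * avg d K g"

lemma avg_add: "avg d K (\<lambda>J. f J + g J) = avg d K f + avg d K g"
  by (induction K arbitrary: f g) (simp_all add: algebra_simps)

lemma avg_diff: "avg d K (\<lambda>J. f J - g J) = avg d K f - avg d K g"
  by (induction K arbitrary: f g) (simp_all add: right_diff_distrib)

lemma avg_cmult: "avg d K (\<lambda>J. c * f J) = c * avg d K f"
  by (induction K arbitrary: f) (simp_all add: algebra_simps)

lemma avg_const [simp]: "avg d K (\<lambda>J. c) = c"
  by (induction K) (simp_all add: algebra_simps)

lemma avg_sum: "avg d K (\<lambda>J. \<Sum>x\<in>A. f x J) = (\<Sum>x\<in>A. avg d K (f x))"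
  by (induction A rule: infinite_finite_induct) (simp_all add: avg_add)

lemma avg_cong:
  "(\<And>J. J \<subseteq> {..<K} \<Longrightarrow> f J = g J) \<Longrightarrow> avg d K f = avg d K g"
proof (induction K arbitrary: f g)
  case (Suc K)
  have "avg d K (\<lambda>J. f (insert K J)) = avg d K (\<lambda>J. g (insert K J))" "avg d K f = avg d K g"
    by (rule Suc.IH; rule Suc.prems; auto simp: lessThan_Suc)+
  then show ?case by simp
qed simp

lemma avg_mono:
  "0 \<le> d \<Longrightarrow> d \<le> 1 \<Longrightarrow> (\<And>J. J \<subseteq> {..<K} \<Longrightarrow> f J \<le> g J) \<Longrightarrow> avg d K f \<le> avg d K g"
proof (induction K arbitrary: f g)
  case (Suc K)
  have "avg d K (\<lambda>J. f (insert K J)) \<le> avg d K (\<lambda>J. g (insert K J))" "avg d K f \<le> avg d K g"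
    by (rule Suc.IH; (rule Suc.prems)?; auto simp: lessThan_Suc)+
  then show ?case using Suc.prems by (auto intro!: add_mono mult_left_mono)
qed simp

lemma avg_nonneg:
  "0 \<le> d \<Longrightarrow> d \<le> 1 \<Longrightarrow> (\<And>J. 0 \<le> g J) \<Longrightarrow> 0 \<le> avg d K g"
  using avg_mono[of d K "\<lambda>_. 0" g] by simp

lemma avg_eq_sum:
  "avg d K g = (\<Sum>J\<in>Pow {..<K}. d ^ card J * (1 - d) ^ (K - card J) * g J)"
proof (induction K arbitrary: g)
  case (Suc K)
  have c: "card J \<le> K" "finite J" "K \<notin> J" if "J \<in> Pow {..<K}" for J
    using that card_mono[of "{..<K}" J] finite_subset[of J "{..<K}"] by auto
  have inj: "inj_on (insert K) (Pow {..<K})" by (auto simp: inj_on_def)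
  let ?h = "\<lambda>J. d ^ card J * (1 - d) ^ (Suc K - card J) * g J"
  have "(\<Sum>J\<in>Pow {..<Suc K}. ?h J) = (\<Sum>J\<in>Pow {..<K} \<union> insert K ` Pow {..<K}. ?h J)"
    by (simp add: lessThan_Suc Pow_insert)
  also have "\<dots> = (\<Sum>J\<in>Pow {..<K}. ?h J) + (\<Sum>J\<in>insert K ` Pow {..<K}. ?h J)"
    by (rule sum.union_disjoint) auto
  also have "(\<Sum>J\<in>insert K ` Pow {..<K}. ?h J) = (\<Sum>J\<in>Pow {..<K}. ?h (insert K J))"
    using inj by (simp add: sum.reindex)
  also have "\<dots> = (\<Sum>J\<in>Pow {..<K}. d * (d ^ card J * (1 - d) ^ (K - card J) * g (insert K J)))"
    by (intro sum.cong) (use c in \<open>auto simp: card_insert_if\<close>)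
  also have "(\<Sum>J\<in>Pow {..<K}. ?h J) = (\<Sum>J\<in>Pow {..<K}. (1 - d) * (d ^ card J * (1 - d) ^ (K - card J) * g J))"
    by (intro sum.cong) (use c in \<open>auto simp: Suc_diff_le\<close>)
  finally show ?case by (simp add: Suc.IH sum_distrib_left)
qed simp

text \<open>Conditioning on the last index, the induction hypothesis handles both halves. What
  remains is the covariance of two two-point variables,
  \<open>d * (1 - d) * (f1 - f0) * (g0 - g1)\<close> up to sign, and monotonicity fixes the
  sign.\<close>

lemma Harris_inequality:
  assumes "0 \<le> d" "d \<le> 1" "mono f" "antimono g"
  shows "avg d K (\<lambda>J. f J * g J) \<le> avg d K f * avg d K g"
  using assms(3,4)
proof (induction K arbitrary: f g)
  case (Suc K)
  let ?f = "\<lambda>J. f (insert K J)" and ?g = "\<lambda>J. g (insert K J)"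
  have m: "mono ?f" "antimono ?g"
    using Suc.prems by (auto intro!: monoI antimonoI elim: monoD antimonoD)
  define f1 f0 g1 g0 where "f1 = avg d K ?f" and "f0 = avg d K f" and "g1 = avg d K ?g" and "g0 = avg d K g"
  have "f0 \<le> f1" unfolding f1_def f0_def using Suc.prems assms
    by (intro avg_mono) (auto intro: monoD)
  moreover have "g1 \<le> g0" unfolding g1_def g0_def using Suc.prems assms
    by (intro avg_mono) (auto intro: antimonoD)
  ultimately have "0 \<le> d * (1 - d) * ((f1 - f0) * (g0 - g1))" using assms by (intro mult_nonneg_nonneg) auto
  moreover have "d * (1 - d) * ((f1 - f0) * (g0 - g1)) =
      (d * f1 + (1 - d) * f0) * (d * g1 + (1 - d) * g0) - (d * (f1 * g1) + (1 - d) * (f0 * g0))"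
    by (simp add: algebra_simps power2_eq_square)
  moreover have "d * avg d K (\<lambda>J. ?f J * ?g J) \<le> d * (f1 * g1)"
    "(1 - d) * avg d K (\<lambda>J. f J * g J) \<le> (1 - d) * (f0 * g0)"
    unfolding f1_def f0_def g1_def g0_def
    using Suc.IH[OF m] Suc.IH[OF Suc.prems] assms by (auto intro: mult_left_mono)
  ultimately show ?case by (simp add: f1_def f0_def g1_def g0_def)
qed simp

text \<open>A union bound over the blocks that contain \<open>e\<close>.\<close>

lemma avg_of_bool_le:
  assumes "0 \<le> d" "d \<le> 1"
  shows "avg d K (\<lambda>J. of_bool (e \<in> (\<Union>k\<in>J. B k))) \<le> d * (\<Sum>k<K. of_bool (e \<in> B k))"
proof (induction K)
  case (Suc K)
  have "avg d K (\<lambda>J. of_bool (e \<in> (\<Union>k\<in>insert K J. B k)))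
      \<le> avg d K (\<lambda>J. of_bool (e \<in> B K) + of_bool (e \<notin> B K) * of_bool (e \<in> (\<Union>k\<in>J. B k)))"
    using assms by (intro avg_mono) auto
  also have "\<dots> = of_bool (e \<in> B K) + of_bool (e \<notin> B K) * avg d K (\<lambda>J. of_bool (e \<in> (\<Union>k\<in>J. B k)))"
    by (simp add: avg_add avg_cmult del: UN_iff of_bool_not_iff)
  finally have "d * avg d K (\<lambda>J. of_bool (e \<in> (\<Union>k\<in>insert K J. B k))) + (1 - d) * avg d K (\<lambda>J. of_bool (e \<in> (\<Union>k\<in>J. B k)))
     \<le> d * (of_bool (e \<in> B K) + of_bool (e \<notin> B K) * avg d K (\<lambda>J. of_bool (e \<in> (\<Union>k\<in>J. B k)))) + (1 - d) * avg d K (\<lambda>J. of_bool (e \<in> (\<Union>k\<in>J. B k)))"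
    using assms by (intro add_right_mono mult_left_mono)
  also have "\<dots> \<le> d * of_bool (e \<in> B K) + avg d K (\<lambda>J. of_bool (e \<in> (\<Union>k\<in>J. B k)))"
    using assms avg_nonneg[of d "\<lambda>J. of_bool (e \<in> (\<Union>k\<in>J. B k))" K]
    by (auto simp: algebra_simps of_bool_def)
  finally show ?case using Suc by (simp add: algebra_simps)
qed simp

text \<open>Only the outcomes with none or exactly one of the \<open>r\<close> new indices are
  counted; the others contribute something nonnegative.\<close>

lemma avg_split_ge:
  assumes d: "0 \<le> d" "d \<le> 1" and g: "\<And>J. 0 \<le> g J"
  shows "avg d (K + r) g \<ge> (1 - d) ^ r * avg d K g
           + d * (1 - d) ^ (r - 1) * (\<Sum>k<r. avg d K (\<lambda>J. g (insert (K + k) J)))"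
  using g
proof (induction r arbitrary: g)
  case (Suc r)
  define S where "S = (\<Sum>k<r. avg d K (\<lambda>J. g (insert (K + k) J)))"
  have nn: "0 \<le> d * (1 - d) ^ (r - 1) * (\<Sum>k<r. avg d K (\<lambda>J. g (insert (K + r) (insert (K + k) J))))"
    using d Suc.prems by (intro mult_nonneg_nonneg sum_nonneg avg_nonneg) auto
  have "avg d (K + r) (\<lambda>J. g (insert (K + r) J)) \<ge> (1 - d) ^ r * avg d K (\<lambda>J. g (insert (K + r) J))"
    using Suc.IH[of "\<lambda>J. g (insert (K + r) J)", OF Suc.prems] nn by linarith
  then have 1: "d * avg d (K + r) (\<lambda>J. g (insert (K + r) J)) \<ge> d * ((1 - d) ^ r * avg d K (\<lambda>J. g (insert (K + r) J)))"
    using d by (intro mult_left_mono)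
  have 2: "(1 - d) * avg d (K + r) g \<ge> (1 - d) * ((1 - d) ^ r * avg d K g + d * (1 - d) ^ (r - 1) * S)"
    unfolding S_def using d Suc by (intro mult_left_mono) auto
  have 3: "(1 - d) * (d * (1 - d) ^ (r - 1) * S) = d * (1 - d) ^ r * S"
    by (cases r) (simp_all add: S_def)
  have "avg d (K + Suc r) g = d * avg d (K + r) (\<lambda>J. g (insert (K + r) J)) + (1 - d) * avg d (K + r) g" by simp
  also have "\<dots> \<ge> (1 - d) ^ Suc r * avg d K g + d * (1 - d) ^ r * S + d * (1 - d) ^ r * avg d K (\<lambda>J. g (insert (K + r) J))"
    using 1 2 3 by (simp add: algebra_simps)
  finally show ?case by (simp add: S_def algebra_simps)
qed simp

section \<open>Continuous greedy with finitely many blocks\<close>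

text \<open>The mathematical image of a loop: \<open>n\<close> steps of a relation that may depend
  on the step number. Relations rather than functions leave open how ties between equally good
  choices are broken.\<close>

primrec chain :: "(nat \<Rightarrow> 'a \<Rightarrow> 'a \<Rightarrow> bool) \<Rightarrow> nat \<Rightarrow> 'a \<Rightarrow> 'a \<Rightarrow> bool" where
  "chain st 0 x y \<longleftrightarrow> x = y"
| "chain st (Suc n) x z \<longleftrightarrow> (\<exists>y. chain st n x y \<and> st n y z)"

locale assignment_function = submodular_function W for W :: "(nat \<times> nat) set \<Rightarrow> real"
begin

text \<open>Expected values after forcing in exactly one of the \<open>l\<close> new blocks
  \<open>K, ..., K + l - 1\<close>, added over these blocks. By \<open>avg_split_ge\<close> this is
  the first-order part of the value after the round, and it serves as the objective of the greedy
  choices.\<close>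

definition Psi :: "real \<Rightarrow> nat \<Rightarrow> nat \<Rightarrow> (nat \<Rightarrow> (nat \<times> nat) set) \<Rightarrow> real" where
  "Psi d K l B = (\<Sum>r<l. avg d K (\<lambda>J. W ((\<Union>k\<in>J. B k) \<union> B (K + r))))"

text \<open>The agent in turn is \<open>Suc q\<close>, since \<open>chain\<close> counts from 0.
  \<open>F\<close> collects forbidden pairs. Choosing nothing is an option, so \<open>Psi\<close>
  never decreases.\<close>

definition greedy_step where
  "greedy_step d K l m F q B B' \<longleftrightarrow>
     (B' = B \<or> (\<exists>r<l. \<exists>c\<in>{1..m}. (c, Suc q) \<notin> F \<and> B' = B(K + r := insert (c, Suc q) (B (K + r))))) \<and>
     Psi d K l B \<le> Psi d K l B' \<and>
     (\<forall>r<l. \<forall>c\<in>{1..m}. (c, Suc q) \<notin> F \<longrightarrow>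
        Psi d K l (B(K + r := insert (c, Suc q) (B (K + r)))) \<le> Psi d K l B')"

lemma greedy_chain_basic:
  assumes "chain (greedy_step d K l m F) n B0 B" "\<And>r. r < l \<Longrightarrow> B0 (K + r) = {}"
  shows "k \<notin> {K..<K + l} \<Longrightarrow> B k = B0 k"
    and "r < l \<Longrightarrow> B (K + r) \<subseteq> {1..m} \<times> {1..n} - F"
    and "r < l \<Longrightarrow> r' < l \<Longrightarrow> e \<in> B (K + r) \<Longrightarrow> e' \<in> B (K + r') \<Longrightarrow> snd e = snd e' \<Longrightarrow> r = r' \<and> e = e'"
proof -
  have "(\<forall>k. k \<notin> {K..<K + l} \<longrightarrow> B k = B0 k) \<and> (\<forall>r<l. B (K + r) \<subseteq> {1..m} \<times> {1..n} - F) \<and>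
    (\<forall>r r' e e'. r < l \<longrightarrow> r' < l \<longrightarrow> e \<in> B (K + r) \<longrightarrow> e' \<in> B (K + r') \<longrightarrow> snd e = snd e' \<longrightarrow> r = r' \<and> e = e')"
    using assms(1)
  proof (induction n arbitrary: B)
    case 0
    then show ?case using assms(2) by auto
  next
    case (Suc n)
    then obtain C where C: "chain (greedy_step d K l m F) n B0 C" and st: "greedy_step d K l m F n C B" by auto
    note IH = Suc.IH[OF C]
    have IH1: "C (K + r) \<subseteq> {1..m} \<times> {1..n} - F" if "r < l" for r using IH that by blast
    from st consider "B = C" | r c where "r < l" "c \<in> {1..m}" "(c, Suc n) \<notin> F" "B = C(K + r := insert (c, Suc n) (C (K + r)))"
      unfolding greedy_step_def by blast
    then show ?case
    proof cases
      case 1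
      have "C (K + r) \<subseteq> {1..m} \<times> {1..Suc n} - F" if "r < l" for r using IH1[OF that] by auto
      then show ?thesis using IH 1 by simp
    next
      case 2
      have "C (K + r) \<subseteq> {1..m} \<times> {1..Suc n} - F" if "r < l" for r using IH1[OF that] by auto
      then have a: "\<forall>r<l. B (K + r) \<subseteq> {1..m} \<times> {1..Suc n} - F" unfolding 2(4) using 2(2,3) by simp
      have b: "\<forall>k. k \<notin> {K..<K + l} \<longrightarrow> B k = B0 k" unfolding 2(4) using IH 2(1) by simp
      have new: "e = (c, Suc n) \<and> r' = r" if "r' < l" "e \<in> B (K + r')" "snd e = Suc n" for e r'
        using that(2,3) IH1[OF that(1)] unfolding 2(4) by (auto simp: fun_upd_apply split: if_splits)
      have old: "e \<in> C (K + r')" if "r' < l" "e \<in> B (K + r')" "snd e \<noteq> Suc n" for e r'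
        using that(2,3) unfolding 2(4) by (auto simp: fun_upd_apply split: if_splits)
      have "r1 = r2 \<and> e = e'" if "r1 < l" "r2 < l" "e \<in> B (K + r1)" "e' \<in> B (K + r2)" "snd e = snd e'" for r1 r2 e e'
      proof (cases "snd e = Suc n")
        case True
        then show ?thesis using new[OF that(1,3)] new[OF that(2,4)] that(5) by metis
      next
        case False
        then have "e \<in> C (K + r1)" "e' \<in> C (K + r2)" using old[OF that(1,3)] old[OF that(2,4)] that(5) by auto
        then show ?thesis using IH that(1,2,5) by blast
      qed
      then show ?thesis using a b by (intro conjI) blast+
    qed
  qed
  note * = this[THEN conjunct1] this[THEN conjunct2, THEN conjunct1] this[THEN conjunct2, THEN conjunct2]
  show "k \<notin> {K..<K + l} \<Longrightarrow> B k = B0 k" using *(1) by simp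
  show "r < l \<Longrightarrow> B (K + r) \<subseteq> {1..m} \<times> {1..n} - F" using *(2) by simp
  show "r < l \<Longrightarrow> r' < l \<Longrightarrow> e \<in> B (K + r) \<Longrightarrow> e' \<in> B (K + r') \<Longrightarrow> snd e = snd e' \<Longrightarrow> r = r' \<and> e = e'"
    using *(3) by blast
qed

text \<open>
  The superset \<open>T\<close> of the current blocks stands for the blocks at the end of the round, at
  which the marginals of the comparison set are evaluated.
\<close>

lemma greedy_chain_gain:
  assumes d: "0 \<le> d" "d \<le> 1" and Ot: "finite Ot" "Ot \<subseteq> {1..m} \<times> UNIV - F" "inj_on snd Ot"
  shows "chain (greedy_step d K l m F) n B0 B \<Longrightarrow> (\<And>k. k < K \<Longrightarrow> B0 k = T k) \<Longrightarrow>
    (\<And>k. B k \<subseteq> T k) \<Longrightarrow>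
    (\<Sum>r<l. avg d K (\<lambda>J. \<Sum>e\<in>{e\<in>Ot. snd e \<in> {1..n}}.
        W (insert e ((\<Union>k\<in>J. T k) \<union> T (K + r))) - W ((\<Union>k\<in>J. T k) \<union> T (K + r))))
      \<le> l * (Psi d K l B - Psi d K l B0) \<and> (\<forall>k<K. B k = B0 k)"
proof (induction n arbitrary: B)
  case 0
  then show ?case by auto
next
  case (Suc n)
  let ?X = "\<lambda>J r. (\<Union>k\<in>J. T k) \<union> T (K + r)"
  let ?m = "\<lambda>e J r. W (insert e (?X J r)) - W (?X J r)"
  from Suc.prems obtain C where C: "chain (greedy_step d K l m F) n B0 C" and st: "greedy_step d K l m F n C B" by auto
  have CB: "C k \<subseteq> B k" for k using st unfolding greedy_step_def by auto
  have "\<And>k. C k \<subseteq> T k" using CB Suc.prems(3) by blast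
  note IH = Suc.IH[OF C Suc.prems(2) this]
  have BK: "\<forall>k<K. B k = B0 k" using IH st unfolding greedy_step_def by auto
  have CT: "C k = T k" if "k < K" for k using IH Suc.prems(2) that by simp
  have CU: "(\<Union>k\<in>J. C k) = (\<Union>k\<in>J. T k)" if "J \<subseteq> {..<K}" for J using CT that by auto
  have \<gamma>: "Psi d K l C \<le> Psi d K l B" using st unfolding greedy_step_def by simp
  \<comment> \<open>The agent compared \<open>e\<close> in every new block, so its actual gain
    dominates the marginal for each \<open>r\<close> separately. Summing over \<open>r\<close>
    produces the factor \<open>l\<close> in the claim.\<close>
  have one: "avg d K (\<lambda>J. ?m e J r) \<le> Psi d K l B - Psi d K l C"
    if e: "e \<in> Ot" "snd e = Suc n" and r: "r < l" for e r
  proof (cases "e \<in> T (K + r)")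
    case True
    then have "insert e (?X J r) = ?X J r" for J by auto
    then show ?thesis using \<gamma> by simp
  next
    case False
    obtain c where c: "e = (c, Suc n)" "c \<in> {1..m}" "(c, Suc n) \<notin> F" using e Ot(2) by (cases e) auto
    let ?C = "C(K + r := insert e (C (K + r)))"
    have "avg d K (\<lambda>J. ?m e J r) \<le> avg d K (\<lambda>J. W (insert e ((\<Union>k\<in>J. C k) \<union> C (K + r))) - W ((\<Union>k\<in>J. C k) \<union> C (K + r)))"
    proof (intro avg_mono d)
      fix J :: "nat set" assume J: "J \<subseteq> {..<K}"
      show "?m e J r \<le> W (insert e ((\<Union>k\<in>J. C k) \<union> C (K + r))) - W ((\<Union>k\<in>J. C k) \<union> C (K + r))"
      proof (cases "e \<in> (\<Union>k\<in>J. T k)")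
        case True
        then have "insert e (?X J r) = ?X J r" "insert e ((\<Union>k\<in>J. C k) \<union> C (K + r)) = (\<Union>k\<in>J. C k) \<union> C (K + r)"
          unfolding CU[OF J] by auto
        then show ?thesis by simp
      next
        case nin: False
        show ?thesis unfolding CU[OF J]
          by (rule marginal_antimono) (use nin False Suc.prems(3) CB in blast)+
      qed
    qed
    also have "\<dots> = avg d K (\<lambda>J. W ((\<Union>k\<in>J. ?C k) \<union> ?C (K + r))) - avg d K (\<lambda>J. W ((\<Union>k\<in>J. C k) \<union> C (K + r)))"
      unfolding avg_diff by (intro arg_cong2[of _ _ _ _ minus] avg_cong arg_cong[of _ _ W]) auto
    also have "\<dots> = (\<Sum>r'<l. avg d K (\<lambda>J. W ((\<Union>k\<in>J. ?C k) \<union> ?C (K + r'))) - avg d K (\<lambda>J. W ((\<Union>k\<in>J. C k) \<union> C (K + r'))))"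
    proof -
      have "avg d K (\<lambda>J. W ((\<Union>k\<in>J. ?C k) \<union> ?C (K + r'))) - avg d K (\<lambda>J. W ((\<Union>k\<in>J. C k) \<union> C (K + r'))) = 0" if "r' \<noteq> r" for r'
      proof -
        have "avg d K (\<lambda>J. W ((\<Union>k\<in>J. ?C k) \<union> ?C (K + r'))) = avg d K (\<lambda>J. W ((\<Union>k\<in>J. C k) \<union> C (K + r')))"
          using that by (intro avg_cong arg_cong[of _ _ W]) auto
        then show ?thesis by simp
      qed
      then show ?thesis using r by (subst sum.remove[of _ r]) auto
    qed
    also have "\<dots> = Psi d K l ?C - Psi d K l C" by (simp add: Psi_def sum_subtractf)
    also have "\<dots> \<le> Psi d K l B - Psi d K l C" using st c r unfolding greedy_step_def by auto
    finally show ?thesis .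
  qed
  let ?N = "{e\<in>Ot. snd e = Suc n}"
  have "y = x" if "x \<in> ?N" "y \<in> ?N" for x y using that by (intro inj_onD[OF Ot(3)]) auto
  then have "?N = {x}" if "x \<in> ?N" for x using that by blast
  then consider "?N = {}" | x where "?N = {x}" by blast
  then have new: "(\<Sum>r<l. avg d K (\<lambda>J. \<Sum>e\<in>?N. ?m e J r)) \<le> l * (Psi d K l B - Psi d K l C)"
  proof cases
    case 1
    then show ?thesis using \<gamma> by (simp only: sum.empty avg_const) simp
  next
    case 2
    then have "(\<Sum>r<l. avg d K (\<lambda>J. \<Sum>e\<in>?N. ?m e J r)) \<le> (\<Sum>r<l. Psi d K l B - Psi d K l C)"
      using one[of x] by (intro sum_mono) auto
    then show ?thesis by simp
  qed
  have split: "{e\<in>Ot. snd e \<in> {1..Suc n}} = {e\<in>Ot. snd e \<in> {1..n}} \<union> ?N" by auto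
  have "(\<Sum>e\<in>{e\<in>Ot. snd e \<in> {1..Suc n}}. ?m e J r) = (\<Sum>e\<in>{e\<in>Ot. snd e \<in> {1..n}}. ?m e J r) + (\<Sum>e\<in>?N. ?m e J r)" for J r
    unfolding split using Ot(1) by (intro sum.union_disjoint) auto
  then have "(\<Sum>r<l. avg d K (\<lambda>J. \<Sum>e\<in>{e\<in>Ot. snd e \<in> {1..Suc n}}. ?m e J r))
     \<le> l * (Psi d K l C - Psi d K l B0) + l * (Psi d K l B - Psi d K l C)"
    using IH new by (simp add: avg_add sum.distrib)
  then show ?case using BK by (simp add: algebra_simps)
qed

text \<open>Disjoint pieces over a common base \<open>A\<close> pairwise intersect in
  \<open>A\<close>, so submodularity can be applied one piece after the other. With nonnegativity it
  yields that adding one of \<open>l\<close> pieces costs on average at most the fraction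
  \<open>1/l\<close> of \<open>W A\<close>: this is the benefit of spreading agents over
  \<open>l\<close> blocks.\<close>

lemma union_pieces:
  fixes T :: "nat \<Rightarrow> (nat \<times> nat) set"
  assumes "disjoint_family_on T {..<l}"
  shows "W (A \<union> (\<Union>r<l. T r)) + l * W A \<le> (\<Sum>r<l. W (A \<union> T r)) + W A"
  using assms
proof (induction l)
  case (Suc l)
  let ?U = "\<Union>r<l. T r"
  have "T l \<inter> T r = {}" if "r < l" for r using Suc.prems that by (intro disjoint_family_onD[OF Suc.prems]) auto
  then have "(A \<union> T l) \<inter> (A \<union> ?U) = A" by blast
  moreover have "(A \<union> T l) \<union> (A \<union> ?U) = A \<union> (\<Union>r<Suc l. T r)" by (auto simp: lessThan_Suc)
  ultimately have "W (A \<union> (\<Union>r<Suc l. T r)) + W A \<le> W (A \<union> T l) + W (A \<union> ?U)"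
    using submodular[of "A \<union> T l" "A \<union> ?U"] by simp
  moreover have "disjoint_family_on T {..<l}" using Suc.prems by (rule disjoint_family_on_mono[rotated]) auto
  ultimately show ?case using Suc.IH by (simp add: algebra_simps)
qed simp

text \<open>The lower bound is the Lovasz extension at the point where every new block has weight \<open>d\<close>.\<close>

lemma avg_union_ge_interpolation:
  assumes d: "0 \<le> d" "d \<le> 1" and disj: "disjoint_family_on (\<lambda>r. B (K + r)) {..<l}"
  shows "avg d (K + l) (\<lambda>J. W (P \<union> (\<Union>k\<in>J. B k))) \<ge>
    d * avg d K (\<lambda>J. W (P \<union> (\<Union>k\<in>J. B k) \<union> (\<Union>r<l. B (K + r)))) + (1 - d) * avg d K (\<lambda>J. W (P \<union> (\<Union>k\<in>J. B k)))"
  using disj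
proof (induction l arbitrary: P)
  case (Suc l)
  have dj: "disjoint_family_on (\<lambda>r. B (K + r)) {..<l}" using Suc.prems by (rule disjoint_family_on_mono[rotated]) auto
  have "B (K + l) \<inter> B (K + r) = {}" if "r < l" for r using that by (intro disjoint_family_onD[OF Suc.prems]) auto
  then have ne: "B (K + l) \<inter> (\<Union>r<l. B (K + r)) = {}" by blast
  let ?R = "\<lambda>J. \<Union>k\<in>J. B k" and ?T = "B (K + l)" and ?U = "\<Union>r<l. B (K + r)"
  define a where "a = avg d K (\<lambda>J. W (P \<union> ?R J \<union> (?T \<union> ?U)))"
  define b where "b = avg d K (\<lambda>J. W (P \<union> ?R J \<union> ?T))"
  define c where "c = avg d K (\<lambda>J. W (P \<union> ?R J \<union> ?U))"
  define z where "z = avg d K (\<lambda>J. W (P \<union> ?R J))"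
  have abc: "a + z \<le> b + c" unfolding a_def b_def c_def z_def avg_add[symmetric]
  proof (intro avg_mono d)
    fix J :: "nat set"
    let ?X = "P \<union> ?R J"
    have "(?X \<union> ?T) \<inter> (?X \<union> ?U) = ?X" "(?X \<union> ?T) \<union> (?X \<union> ?U) = ?X \<union> (?T \<union> ?U)" using ne by blast+
    then show "W (?X \<union> (?T \<union> ?U)) + W ?X \<le> W (?X \<union> ?T) + W (?X \<union> ?U)"
      using submodular[of "?X \<union> ?T" "?X \<union> ?U"] by simp
  qed
  have ins: "avg d (K + l) (\<lambda>J. W (P \<union> ?R (insert (K + l) J))) = avg d (K + l) (\<lambda>J. W ((P \<union> ?T) \<union> ?R J))"
    by (intro avg_cong arg_cong[of _ _ W]) auto
  have "avg d (K + l) (\<lambda>J. W ((P \<union> ?T) \<union> ?R J)) \<ge> d * a + (1 - d) * b"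
    using Suc.IH[of "P \<union> ?T", OF dj] unfolding a_def b_def by (simp only: Un_assoc Un_left_commute Un_commute)
  then have 1: "d * avg d (K + l) (\<lambda>J. W ((P \<union> ?T) \<union> ?R J)) \<ge> d * (d * a + (1 - d) * b)" using d by (intro mult_left_mono)
  have "avg d (K + l) (\<lambda>J. W (P \<union> ?R J)) \<ge> d * c + (1 - d) * z" using Suc.IH[of P, OF dj] unfolding c_def z_def .
  then have 2: "(1 - d) * avg d (K + l) (\<lambda>J. W (P \<union> ?R J)) \<ge> (1 - d) * (d * c + (1 - d) * z)" using d by (intro mult_left_mono) auto
  \<comment> \<open>The induction hypothesis, used with and without the last block, treats it as
    independent of the others; including all blocks together is worse by exactly this
    product.\<close>
  have "d * (1 - d) * (b + c - a - z) \<ge> 0" using abc d by (intro mult_nonneg_nonneg) auto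
  then have "d * a + (1 - d) * z \<le> d * (d * a + (1 - d) * b) + (1 - d) * (d * c + (1 - d) * z)" by (simp add: algebra_simps)
  also have "\<dots> \<le> avg d (K + Suc l) (\<lambda>J. W (P \<union> ?R J))" using 1 2 ins by simp
  finally show ?case unfolding a_def z_def by (simp add: lessThan_Suc Un_assoc)
qed (simp add: algebra_simps)

section \<open>Decay and progress of the expected value in one round\<close>

lemma round_decay:
  assumes d: "0 \<le> d" "d \<le> 1" and disj: "disjoint_family_on (\<lambda>r. B (K + r)) {..<l}"
  shows "(1 - d) * avg d K (\<lambda>J. W (P \<union> (\<Union>k\<in>J. B k))) \<le> avg d (K + l) (\<lambda>J. W (P \<union> (\<Union>k\<in>J. B k)))"
proof -
  have "0 \<le> d * avg d K (\<lambda>J. W (P \<union> (\<Union>k\<in>J. B k) \<union> (\<Union>r<l. B (K + r))))"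
    using d nonneg by (intro mult_nonneg_nonneg avg_nonneg) auto
  then show ?thesis using avg_union_ge_interpolation[OF d, of B K l P, OF disj] by linarith
qed

text \<open>One round is an Euler step of length \<open>d\<close> for the equation y' = H - y, with
  \<open>H\<close> damped by \<open>(1 - 1/l)\<^sup>2\<close>. One factor \<open>1 - 1/l\<close>
  comes from \<open>union_pieces\<close>, the other absorbs that the blocks \<open>B (K + r)\<close>
  are already present when marginals are measured and that two new blocks may be included at once.
  The choice \<open>d = 1 / l ^ 3\<close> makes the probability of any new block at most
  \<open>1 / l\<^sup>2\<close>, so the second-order loss is small compared with \<open>d\<close>
  itself.\<close>

lemma round_progress:
  assumes l: "l \<ge> 1" and d: "d = 1 / real l ^ 3"
    and disj: "disjoint_family_on (\<lambda>r. B (K + r)) {..<l}"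
    and gain: "(\<Sum>r<l. avg d K (\<lambda>J. W ((\<Union>k\<in>J. B k) \<union> B (K + r) \<union> Ot) - W ((\<Union>k\<in>J. B k) \<union> B (K + r))))
       \<le> l * (Psi d K l B - l * avg d K (\<lambda>J. W (\<Union>k\<in>J. B k)))"
    and pos: "l * avg d K (\<lambda>J. W (\<Union>k\<in>J. B k)) \<le> Psi d K l B"
  shows "avg d (K + l) (\<lambda>J. W (\<Union>k\<in>J. B k)) \<ge> (1 - d) * avg d K (\<lambda>J. W (\<Union>k\<in>J. B k))
           + d * (1 - 1 / l)\<^sup>2 * avg d K (\<lambda>J. W (Ot \<union> (\<Union>k\<in>J. B k)))"
proof -
  let ?R = "\<lambda>J. \<Union>k\<in>J. B k" and ?T = "\<lambda>r. B (K + r)"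
  define g where "g = avg d K (\<lambda>J. W (?R J))"
  define H where "H = avg d K (\<lambda>J. W (Ot \<union> ?R J))"
  define D where "D = Psi d K l B - l * g"
  define \<epsilon> where "\<epsilon> = 1 / real l"
  have \<epsilon>: "0 < \<epsilon>" "\<epsilon> \<le> 1" "l * \<epsilon> = 1" and d\<epsilon>: "d = \<epsilon> ^ 3" using l d by (auto simp: \<epsilon>_def power_one_over)
  have d01: "0 \<le> d" "d \<le> 1" unfolding d\<epsilon> using \<epsilon> by (auto intro: power_le_one)
  have g0: "0 \<le> g" and H0: "0 \<le> H" unfolding g_def H_def using d01 nonneg by (auto intro!: avg_nonneg)
  have D0: "0 \<le> D" using pos by (simp add: D_def g_def)
  have "avg d K (\<lambda>J. (real l - 1) * W (Ot \<union> ?R J)) \<le> avg d K (\<lambda>J. \<Sum>r<l. W (?R J \<union> ?T r \<union> Ot))"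
  proof (intro avg_mono d01)
    fix J :: "nat set"
    have "(\<Sum>r<l. W (?R J \<union> ?T r \<union> Ot)) = (\<Sum>r<l. W ((Ot \<union> ?R J) \<union> ?T r))"
      by (intro sum.cong refl arg_cong[of _ _ W]) auto
    then show "(real l - 1) * W (Ot \<union> ?R J) \<le> (\<Sum>r<l. W (?R J \<union> ?T r \<union> Ot))"
      using union_pieces[of "\<lambda>r. B (K + r)", OF disj, of "Ot \<union> ?R J"] nonneg[of "Ot \<union> ?R J \<union> (\<Union>r<l. ?T r)"]
      by (simp add: algebra_simps)
  qed
  then have "(real l - 1) * H \<le> (\<Sum>r<l. avg d K (\<lambda>J. W (?R J \<union> ?T r \<union> Ot)))" by (simp add: H_def avg_cmult avg_sum)
  moreover have "(\<Sum>r<l. avg d K (\<lambda>J. W (?R J \<union> ?T r \<union> Ot))) - Psi d K l B \<le> l * D"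
    using gain by (simp add: Psi_def avg_diff sum_subtractf D_def g_def)
  \<comment> \<open>\<open>Psi\<close> equals \<open>l * g + D\<close>; moving its \<open>D\<close>
    to the right turns \<open>l * D\<close> into \<open>(l + 1) * D\<close>.\<close>
  ultimately have "(real l - 1) * H - l * g \<le> (real l + 1) * D" by (simp add: D_def algebra_simps)
  then have "\<epsilon> * ((real l - 1) * H - l * g) \<le> \<epsilon> * ((real l + 1) * D)" using \<epsilon> by (intro mult_left_mono) auto
  moreover have "\<epsilon> * ((real l - 1) * H - l * g) = (l * \<epsilon> - \<epsilon>) * H - (l * \<epsilon>) * g"
    "\<epsilon> * ((real l + 1) * D) = (l * \<epsilon> + \<epsilon>) * D" by (simp_all add: algebra_simps)
  ultimately have DH: "(1 - \<epsilon>) * H - g \<le> (1 + \<epsilon>) * D" using \<epsilon>(3) by simp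
  define u where "u = (1 - d) ^ (l - 1)"
  have ld: "l * d = \<epsilon>\<^sup>2" using \<epsilon>(3) by (simp add: d\<epsilon> power3_eq_cube power2_eq_square flip: mult.assoc)
  have rl: "real (l - 1) = real l - 1" using l by simp
  have "1 + real (l - 1) * (- d) \<le> (1 + (- d)) ^ (l - 1)" using d01 by (intro Bernoulli_inequality) auto
  then have u: "1 - (real l - 1) * d \<le> u" unfolding rl u_def by simp
  then have u1: "1 - \<epsilon>\<^sup>2 \<le> u" using ld d01 by (simp add: algebra_simps)
  have ul: "(1 - d) ^ l = (1 - d) * u" using l by (cases l) (auto simp: u_def)
  have "avg d (K + l) (\<lambda>J. W (?R J)) \<ge> (1 - d) ^ l * g + d * u * (\<Sum>k<l. avg d K (\<lambda>J. W (?R (insert (K + k) J))))"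
    unfolding u_def g_def using d01 nonneg by (intro avg_split_ge) auto
  also have "(\<Sum>k<l. avg d K (\<lambda>J. W (?R (insert (K + k) J)))) = Psi d K l B"
    unfolding Psi_def by (intro sum.cong refl avg_cong arg_cong[of _ _ W]) auto
  also have "(1 - d) ^ l * g + d * u * Psi d K l B = u * (1 + (real l - 1) * d) * g + d * u * D"
    by (simp add: ul D_def algebra_simps)
  finally have main: "u * (1 + (real l - 1) * d) * g + d * u * D \<le> avg d (K + l) (\<lambda>J. W (?R J))" .
  have "(1 - (real l - 1) * d) * (1 + (real l - 1) * d) \<le> u * (1 + (real l - 1) * d)"
    using u d01 l by (intro mult_right_mono) auto
  moreover have "1 - d * \<epsilon> \<le> (1 - (real l - 1) * d) * (1 + (real l - 1) * d)"
  proof -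
    have "((real l - 1) * d)\<^sup>2 \<le> (l * d)\<^sup>2" using l d01 by (intro power_mono mult_right_mono) auto
    also have "\<dots> = d * \<epsilon>" by (simp only: ld) (simp add: d\<epsilon> power2_eq_square power3_eq_cube)
    finally show ?thesis by (simp add: algebra_simps power2_eq_square)
  qed
  ultimately have "(1 - d * \<epsilon>) * g \<le> u * (1 + (real l - 1) * d) * g" using g0 by (intro mult_right_mono) auto
  moreover have "d * ((1 - \<epsilon>) * ((1 - \<epsilon>) * H - g)) \<le> d * (u * D)"
  proof (intro mult_left_mono d01)
    \<comment> \<open>The factor \<open>1 - \<epsilon>\<close> is chosen so that
      \<open>(1 - \<epsilon>) * (1 + \<epsilon>) = 1 - \<epsilon>\<^sup>2\<close> can be absorbed by
      \<open>u\<close>.\<close>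
    have "(1 - \<epsilon>) * ((1 - \<epsilon>) * H - g) \<le> (1 - \<epsilon>) * ((1 + \<epsilon>) * D)" using DH \<epsilon> by (intro mult_left_mono) auto
    also have "\<dots> = (1 - \<epsilon>\<^sup>2) * D" by (simp add: algebra_simps power2_eq_square)
    also have "\<dots> \<le> u * D" using u1 D0 by (intro mult_right_mono)
    finally show "(1 - \<epsilon>) * ((1 - \<epsilon>) * H - g) \<le> u * D" .
  qed
  ultimately have "(1 - d * \<epsilon>) * g + d * ((1 - \<epsilon>) * ((1 - \<epsilon>) * H - g)) \<le> avg d (K + l) (\<lambda>J. W (?R J))"
    using main by (simp add: mult.assoc)
  \<comment> \<open>The loss \<open>d * \<epsilon> * g\<close> of the first summand cancels exactly
    against the damping of \<open>- d * g\<close> in the second.\<close>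
  moreover have "(1 - d * \<epsilon>) * g + d * ((1 - \<epsilon>) * ((1 - \<epsilon>) * H - g)) = (1 - d) * g + d * (1 - \<epsilon>)\<^sup>2 * H"
    by (simp add: algebra_simps power2_eq_square)
  ultimately show ?thesis by (simp add: g_def H_def \<epsilon>_def)
qed

text \<open>The interface between program and analysis: what a greedy round guarantees about its
  blocks \<open>t * l, ..., t * l + l - 1\<close>, expressed through the final blocks. The conjuncts
  are avoidance of \<open>F\<close>, at most one pair per agent in the round, the gain against any
  comparison assignment outside \<open>F\<close>, and growth of \<open>Psi\<close>.\<close>

definition good_round where
  "good_round d l E F t B \<longleftrightarrow>
     (\<forall>r<l. B (t * l + r) \<subseteq> E - F) \<and>
     (\<forall>r<l. \<forall>r'<l. \<forall>e\<in>B (t * l + r). \<forall>e'\<in>B (t * l + r'). snd e = snd e' \<longrightarrow> r = r' \<and> e = e') \<and>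
     (\<forall>Ot. finite Ot \<longrightarrow> Ot \<subseteq> E - F \<longrightarrow> inj_on snd Ot \<longrightarrow>
        (\<Sum>r<l. avg d (t * l) (\<lambda>J. W ((\<Union>k\<in>J. B k) \<union> B (t * l + r) \<union> Ot) - W ((\<Union>k\<in>J. B k) \<union> B (t * l + r))))
          \<le> l * (Psi d (t * l) l B - l * avg d (t * l) (\<lambda>J. W (\<Union>k\<in>J. B k)))) \<and>
     l * avg d (t * l) (\<lambda>J. W (\<Union>k\<in>J. B k)) \<le> Psi d (t * l) l B"

lemma good_roundD:
  assumes "good_round d l E F t B"
  shows "\<And>r. r < l \<Longrightarrow> B (t * l + r) \<subseteq> E - F"
    and "\<And>r r' e e'. r < l \<Longrightarrow> r' < l \<Longrightarrow> e \<in> B (t * l + r) \<Longrightarrow> e' \<in> B (t * l + r') \<Longrightarrow> snd e = snd e' \<Longrightarrow> r = r' \<and> e = e'"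
    and "\<And>Ot. finite Ot \<Longrightarrow> Ot \<subseteq> E - F \<Longrightarrow> inj_on snd Ot \<Longrightarrow>
        (\<Sum>r<l. avg d (t * l) (\<lambda>J. W ((\<Union>k\<in>J. B k) \<union> B (t * l + r) \<union> Ot) - W ((\<Union>k\<in>J. B k) \<union> B (t * l + r))))
          \<le> l * (Psi d (t * l) l B - l * avg d (t * l) (\<lambda>J. W (\<Union>k\<in>J. B k)))"
    and "l * avg d (t * l) (\<lambda>J. W (\<Union>k\<in>J. B k)) \<le> Psi d (t * l) l B"
  using assms unfolding good_round_def by simp_all

lemma good_round_disjoint:
  assumes "good_round d l E F t B"
  shows "disjoint_family_on (\<lambda>r. B (t * l + r)) {..<l}"
  unfolding disjoint_family_on_def
proof (intro ballI impI equals0I)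
  fix r r' e assume "r \<in> {..<l}" "r' \<in> {..<l}" "r \<noteq> r'" "e \<in> B (t * l + r) \<inter> B (t * l + r')"
  then show False using good_roundD(2)[OF assms, of r r' e e] by simp
qed

text \<open>The property looks only at the blocks up to the end of round \<open>t\<close>, so it
  survives when later rounds fill further blocks.\<close>

lemma good_round_cong:
  assumes eq: "\<And>k. k < Suc t * l \<Longrightarrow> B k = B' k"
  shows "good_round d l E F t B = good_round d l E F t B'"
proof -
  have 1: "B (t * l + r) = B' (t * l + r)" if "r < l" for r using that by (intro eq) simp
  have "(\<Union>k\<in>J. B k) = (\<Union>k\<in>J. B' k)" if "J \<subseteq> {..<t * l}" for J
    using that by (intro SUP_cong refl eq) auto
  then have 2: "avg d (t * l) (\<lambda>J. f (\<Union>k\<in>J. B k)) = avg d (t * l) (\<lambda>J. f (\<Union>k\<in>J. B' k))" for f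
    by (intro avg_cong) simp
  have 3: "Psi d (t * l) l B = Psi d (t * l) l B'"
    unfolding Psi_def by (intro sum.cong refl) (simp add: 1 2[of "\<lambda>A. W (A \<union> _)"])
  have 4: "(\<Sum>r<l. avg d (t * l) (\<lambda>J. W ((\<Union>k\<in>J. B k) \<union> B (t * l + r) \<union> Ot) - W ((\<Union>k\<in>J. B k) \<union> B (t * l + r))))
    = (\<Sum>r<l. avg d (t * l) (\<lambda>J. W ((\<Union>k\<in>J. B' k) \<union> B' (t * l + r) \<union> Ot) - W ((\<Union>k\<in>J. B' k) \<union> B' (t * l + r))))" for Ot
    by (intro sum.cong refl) (simp add: 1 2[of "\<lambda>A. W (A \<union> _ \<union> Ot) - W (A \<union> _)"])
  show ?thesis unfolding good_round_def 3 4 2[of W] using 1 by simp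
qed

lemma greedy_chain_good_round:
  assumes ch: "chain (greedy_step d (t * l) l m F) n B0 B" and emp: "\<And>r. r < l \<Longrightarrow> B0 (t * l + r) = {}"
    and d: "0 \<le> d" "d \<le> 1" and l: "l \<ge> 1"
  shows "good_round d l ({1..m} \<times> {1..n}) F t B"
proof -
  note basic = greedy_chain_basic[OF ch emp]
  have B0: "B0 k = B k" if "k < t * l" for k using basic(1)[of k] that by simp
  have "(\<Union>k\<in>J. B0 k) = (\<Union>k\<in>J. B k)" if "J \<subseteq> {..<t * l}" for J using B0 that by auto
  then have "Psi d (t * l) l B0 = (\<Sum>r<l. avg d (t * l) (\<lambda>J. W (\<Union>k\<in>J. B k)))"
    unfolding Psi_def using emp by (intro sum.cong refl avg_cong) simp
  then have Psi0: "Psi d (t * l) l B0 = l * avg d (t * l) (\<lambda>J. W (\<Union>k\<in>J. B k))" by simp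
  have gain: "(\<Sum>r<l. avg d (t * l) (\<lambda>J. W ((\<Union>k\<in>J. B k) \<union> B (t * l + r) \<union> Ot) - W ((\<Union>k\<in>J. B k) \<union> B (t * l + r))))
          \<le> l * (Psi d (t * l) l B - l * avg d (t * l) (\<lambda>J. W (\<Union>k\<in>J. B k)))"
    if Ot: "finite Ot" "Ot \<subseteq> {1..m} \<times> {1..n} - F" "inj_on snd Ot" for Ot
  proof -
    have eq: "{e\<in>Ot. snd e \<in> {1..n}} = Ot" using Ot by auto
    have "(\<Sum>r<l. avg d (t * l) (\<lambda>J. W ((\<Union>k\<in>J. B k) \<union> B (t * l + r) \<union> Ot) - W ((\<Union>k\<in>J. B k) \<union> B (t * l + r))))
      \<le> (\<Sum>r<l. avg d (t * l) (\<lambda>J. \<Sum>e\<in>{e\<in>Ot. snd e \<in> {1..n}}.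
        W (insert e ((\<Union>k\<in>J. B k) \<union> B (t * l + r))) - W ((\<Union>k\<in>J. B k) \<union> B (t * l + r))))"
      unfolding eq using d union_le_sum_marginals[OF Ot(1)] by (intro sum_mono avg_mono) auto
    also have "\<dots> \<le> l * (Psi d (t * l) l B - Psi d (t * l) l B0)"
      using Ot by (intro greedy_chain_gain[OF d _ _ _ ch, THEN conjunct1] B0) auto
    finally show ?thesis by (simp add: Psi0)
  qed
  \<comment> \<open>With an empty comparison set, the gain inequality says that \<open>Psi\<close>
    did not decrease from its initial value.\<close>
  have "l * avg d (t * l) (\<lambda>J. W (\<Union>k\<in>J. B k)) \<le> Psi d (t * l) l B"
    using gain[of "{}"] l by (simp add: zero_le_mult_iff)
  then show ?thesis unfolding good_round_def using gain basic(2,3) by simp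
qed

lemma rounds_decay:
  assumes d: "0 \<le> d" "d \<le> 1" and disj: "\<And>t. t < u \<Longrightarrow> t0 \<le> t \<Longrightarrow> disjoint_family_on (\<lambda>r. B (t * l + r)) {..<l}"
    and "t0 \<le> u"
  shows "(1 - d) ^ (u - t0) * avg d (t0 * l) (\<lambda>J. W (P \<union> (\<Union>k\<in>J. B k))) \<le> avg d (u * l) (\<lambda>J. W (P \<union> (\<Union>k\<in>J. B k)))"
  using assms(4,3)
proof (induction u rule: dec_induct)
  case (step u)
  let ?a = "\<lambda>u. avg d (u * l) (\<lambda>J. W (P \<union> (\<Union>k\<in>J. B k)))"
  have "(1 - d) * ((1 - d) ^ (u - t0) * ?a t0) \<le> (1 - d) * ?a u"
    using step d by (intro mult_left_mono step.IH) auto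
  also have "\<dots> \<le> avg d (u * l + l) (\<lambda>J. W (P \<union> (\<Union>k\<in>J. B k)))"
    using step by (intro round_decay d) auto
  finally show ?case using step.hyps by (simp add: Suc_diff_le add.commute mult.assoc)
qed simp

lemma good_round_progress:
  assumes "good_round d l E F t B" "l \<ge> 1" "d = 1 / real l ^ 3" "finite Ot" "Ot \<subseteq> E - F" "inj_on snd Ot"
  shows "avg d (Suc t * l) (\<lambda>J. W (\<Union>k\<in>J. B k)) \<ge> (1 - d) * avg d (t * l) (\<lambda>J. W (\<Union>k\<in>J. B k))
           + d * (1 - 1 / l)\<^sup>2 * avg d (t * l) (\<lambda>J. W (Ot \<union> (\<Union>k\<in>J. B k)))"
  using round_progress[of l d B "t * l", OF assms(2,3) good_round_disjoint[OF assms(1)]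
      good_roundD(3)[OF assms(1,4-6)] good_roundD(4)[OF assms(1)]]
  by (simp add: add.commute)

text \<open>The recursion of \<open>round_progress\<close> is solved in two stages. During the first
  \<open>N\<close> rounds the comparison set is \<open>Ot - Z\<close>, later it is
  \<open>Ot\<close>. The value \<open>x\<close> is the decay over one quarter of the time, hence the
  remaining three quarters contribute \<open>x ^ 3\<close>.\<close>

theorem continuous_greedy:
  assumes l: "l \<ge> 1" and d: "d = 1 / real l ^ 3" and N: "4 * N = l ^ 3"
    and r1: "\<And>t. t < N \<Longrightarrow> good_round d l E Z t B"
    and r2: "\<And>t. N \<le> t \<Longrightarrow> t < 4 * N \<Longrightarrow> good_round d l E {} t B"
    and Ot: "finite Ot" "Ot \<subseteq> E" "inj_on snd Ot"
    and x: "x = (1 - d) ^ N" and Q: "0 \<le> W Ot - (1 - x) * W (Z \<union> Ot)"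
  shows "avg d (4 * N * l) (\<lambda>J. W (\<Union>k\<in>J. B k)) \<ge> (1 - 1 / l)\<^sup>2 * x ^ 3 *
    ((1 - x) * (W Ot - W (Z \<inter> Ot) - W (Z \<union> Ot)) + x * W (Z \<union> Ot) / 4 + 3 / 4 * (W Ot - (1 - x) * W (Z \<union> Ot)))"
proof -
  define g where "g t = avg d (t * l) (\<lambda>J. W (\<Union>k\<in>J. B k))" for t
  define c where "c = (1 - 1 / real l)\<^sup>2"
  define a where "a = W (Z \<union> Ot)"
  define \<kappa> where "\<kappa> = W Ot - W (Z \<inter> Ot) - a"
  have d01: "0 \<le> d" "d \<le> 1" using l by (auto simp: d)
  have a0: "0 \<le> a" by (simp add: a_def nonneg)
  have c0: "0 \<le> c" by (simp add: c_def)
  have decay: "(1 - d) ^ t * W P \<le> avg d (t * l) (\<lambda>J. W (P \<union> (\<Union>k\<in>J. B k)))" if "t \<le> N" for t P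
    using rounds_decay[OF d01, of t 0 B l P] good_round_disjoint[OF r1] that by simp
  \<comment> \<open>Block \<open>k\<close> belongs to round \<open>k div l\<close>, which avoids
    \<open>Z\<close> as long as it is among the first \<open>N\<close>.\<close>
  have RZ: "(\<Union>k\<in>J. B k) \<inter> Z = {}" if "J \<subseteq> {..<t * l}" "t \<le> N" for J t
  proof -
    have "B k \<inter> Z = {}" if "k \<in> J" for k
    proof -
      have k: "k < t * l" using that \<open>J \<subseteq> {..<t * l}\<close> by auto
      then have "k div l < t" "k mod l < l" using l by (auto simp: less_mult_imp_div_less)
      then have "B (k div l * l + k mod l) \<subseteq> E - Z"
        using \<open>t \<le> N\<close> by (intro good_roundD(1)[OF r1]) auto
      then show ?thesis by auto
    qed
    then show ?thesis by blast
  qed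
  \<comment> \<open>Here avoiding \<open>Z\<close> pays off: \<open>P\<close> plus the random set
    meets \<open>Z \<union> Ot\<close> exactly in \<open>P\<close>. It is used with
    \<open>P = Ot - Z\<close> in the first stage and with \<open>P = Ot\<close> at its end.\<close>
  have lower: "W P - a + (1 - d) ^ t * a \<le> avg d (t * l) (\<lambda>J. W (P \<union> (\<Union>k\<in>J. B k)))"
    if "t \<le> N" "Ot - Z \<subseteq> P" "P \<subseteq> Ot" for t P
  proof -
    have "avg d (t * l) (\<lambda>J. W ((Z \<union> Ot) \<union> (\<Union>k\<in>J. B k)) + (W P - a)) \<le> avg d (t * l) (\<lambda>J. W (P \<union> (\<Union>k\<in>J. B k)))"
    proof (intro avg_mono d01)
      fix J assume "J \<subseteq> {..<t * l}"
      then have "(P \<union> (\<Union>k\<in>J. B k)) \<inter> (Z \<union> Ot) = P" "(P \<union> (\<Union>k\<in>J. B k)) \<union> (Z \<union> Ot) = (Z \<union> Ot) \<union> (\<Union>k\<in>J. B k)"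
        using RZ[of J t] that by blast+
      then show "W ((Z \<union> Ot) \<union> (\<Union>k\<in>J. B k)) + (W P - a) \<le> W (P \<union> (\<Union>k\<in>J. B k))"
        using submodular[of "P \<union> (\<Union>k\<in>J. B k)" "Z \<union> Ot"] by (simp add: a_def)
    qed
    then show ?thesis using decay[OF that(1), of "Z \<union> Ot"] by (simp add: avg_add a_def)
  qed
  have oZ: "W Ot - W (Z \<inter> Ot) \<le> W (Ot - Z)"
  proof -
    have "(Ot - Z) \<union> (Z \<inter> Ot) = Ot" "(Ot - Z) \<inter> (Z \<inter> Ot) = {}" by blast+
    then show ?thesis using submodular[of "Ot - Z" "Z \<inter> Ot"] empty by simp
  qed
  \<comment> \<open>The discrete form of (1 - e^(-s)) \<kappa> + s e^(-s) a with s = t d, which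
    solves y' = \<kappa> + e^(-s) a - y with y(0) = 0.\<close>
  have s1: "c * ((1 - (1 - d) ^ t) * \<kappa> + t * d * (1 - d) ^ t * a) \<le> g t" if "t \<le> N" for t
    using that
  proof (induction t)
    case 0
    then show ?case using nonneg by (simp add: g_def)
  next
    case (Suc t)
    let ?y = "(1 - d) ^ t"
    have "inj_on snd (Ot - Z)" using Ot(3) by (rule inj_on_subset) auto
    then have "(1 - d) * g t + d * c * avg d (t * l) (\<lambda>J. W ((Ot - Z) \<union> (\<Union>k\<in>J. B k))) \<le> g (Suc t)"
      unfolding g_def c_def using Suc.prems Ot by (intro good_round_progress[OF r1 l d]) auto
    moreover have "\<kappa> + ?y * a \<le> avg d (t * l) (\<lambda>J. W ((Ot - Z) \<union> (\<Union>k\<in>J. B k)))"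
      using lower[of t "Ot - Z"] Suc.prems oZ by (simp add: \<kappa>_def)
    then have "d * c * (\<kappa> + ?y * a) \<le> d * c * avg d (t * l) (\<lambda>J. W ((Ot - Z) \<union> (\<Union>k\<in>J. B k)))"
      using d01 c0 by (intro mult_left_mono) auto
    moreover have "(1 - d) * (c * ((1 - ?y) * \<kappa> + t * d * ?y * a)) \<le> (1 - d) * g t"
      using Suc d01 by (intro mult_left_mono) auto
    \<comment> \<open>Precisely the slack between the Euler step and the claimed closed
      form.\<close>
    moreover have "0 \<le> c * d * d * ?y * a" using c0 d01 a0 by simp
    ultimately show ?case by (simp add: algebra_simps)
  qed
  define Q where "Q = W Ot - (1 - x) * a"
  \<comment> \<open>In the second stage the value of \<open>Ot\<close> plus the random set starts
    from at least \<open>Q\<close> and decays freely, since \<open>Z\<close> is no longer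
    avoided.\<close>
  have s2: "(1 - d) ^ s * g N + c * (s * d * (1 - d) ^ s * Q) \<le> g (N + s)" if "s \<le> 3 * N" for s
    using that
  proof (induction s)
    case (Suc s)
    let ?y = "(1 - d) ^ s"
    have "(1 - d) * g (N + s) + d * c * avg d ((N + s) * l) (\<lambda>J. W (Ot \<union> (\<Union>k\<in>J. B k))) \<le> g (Suc (N + s))"
      unfolding g_def c_def using Suc.prems Ot by (intro good_round_progress[OF r2 l d]) auto
    moreover have "?y * Q \<le> avg d ((N + s) * l) (\<lambda>J. W (Ot \<union> (\<Union>k\<in>J. B k)))"
    proof -
      have "?y * Q \<le> ?y * avg d (N * l) (\<lambda>J. W (Ot \<union> (\<Union>k\<in>J. B k)))"
        using lower[of N Ot] d01 by (intro mult_left_mono) (auto simp: Q_def x algebra_simps)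
      also have "\<dots> \<le> avg d ((N + s) * l) (\<lambda>J. W (Ot \<union> (\<Union>k\<in>J. B k)))"
        using rounds_decay[OF d01, of "N + s" N B l Ot] good_round_disjoint[OF r2] Suc.prems by simp
      finally show ?thesis .
    qed
    then have "d * c * (?y * Q) \<le> d * c * avg d ((N + s) * l) (\<lambda>J. W (Ot \<union> (\<Union>k\<in>J. B k)))"
      using d01 c0 by (intro mult_left_mono) auto
    moreover have "(1 - d) * (?y * g N + c * (s * d * ?y * Q)) \<le> (1 - d) * g (N + s)"
      using Suc d01 by (intro mult_left_mono) auto
    moreover have "0 \<le> c * d * d * ?y * Q" using c0 d01 Q by (simp add: Q_def a_def)
    ultimately show ?case by (simp add: algebra_simps)
  qed simp
  \<comment> \<open>All \<open>4 * N\<close> rounds of length \<open>d\<close> last one unit of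
    time, so the first stage ends at time 1/4.\<close>
  have "real (4 * N) = real (l ^ 3)" using N by simp
  then have Nd: "N * d = 1 / 4" using l by (simp add: d field_simps)
  have x3: "(1 - d) ^ (3 * N) = x ^ 3" by (simp add: x mult.commute flip: power_mult)
  have x0: "0 \<le> x" using d01 by (simp add: x)
  have "c * ((1 - x) * \<kappa> + x * a / 4) \<le> g N" using s1[of N] Nd by (simp add: x)
  then have "x ^ 3 * (c * ((1 - x) * \<kappa> + x * a / 4)) \<le> x ^ 3 * g N" using x0 by (intro mult_left_mono) auto
  moreover have "x ^ 3 * g N + c * (3 / 4 * x ^ 3 * Q) \<le> g (4 * N)"
  proof -
    have "real (3 * N) * d = 3 * (N * d)" by simp
    then have *: "real (3 * N) * d = 3 / 4" unfolding Nd by simp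
    have "N + 3 * N = 4 * N" by simp
    then show ?thesis using s2[of "3 * N", OF order_refl] unfolding x3 * by simp
  qed
  moreover have "c * x ^ 3 * (u + 3 / 4 * v) = x ^ 3 * (c * u) + c * (3 / 4 * x ^ 3 * v)" for u v :: real
    by (simp add: algebra_simps)
  ultimately have "c * x ^ 3 * ((1 - x) * \<kappa> + x * a / 4 + 3 / 4 * Q) \<le> g (4 * N)" by simp
  then show ?thesis unfolding g_def c_def \<kappa>_def Q_def a_def .
qed

section \<open>Rounding\<close>

text \<open>\<open>A\<close> maps every outcome to its set of pairs. Agent \<open>Suc q\<close>
  loses all its pairs and receives one item, or none, that is the same in every outcome.\<close>

definition rounding_step where
  "rounding_step d K m q A A' \<longleftrightarrow> (let C = (\<lambda>J. {e \<in> A J. snd e \<noteq> Suc q}) in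
     (A' = C \<or> (\<exists>c\<in>{1..m}. A' = (\<lambda>J. insert (c, Suc q) (C J)))) \<and>
     avg d K (\<lambda>J. W (C J)) \<le> avg d K (\<lambda>J. W (A' J)) \<and>
     (\<forall>c\<in>{1..m}. avg d K (\<lambda>J. W (insert (c, Suc q) (C J))) \<le> avg d K (\<lambda>J. W (A' J))))"

text \<open>Restoring the agent's own pairs gains at most the sum of their marginals. By Harris the
  expectation of presence times marginal is at most the product of expectations, and each expected
  marginal is at most the gain \<open>M\<close> of the best uniform choice.\<close>

lemma rounding_step_value:
  assumes st: "rounding_step d K m q A A'" and d: "0 \<le> d" "d \<le> 1" and mono: "mono A"
    and sub: "\<And>J. A J \<subseteq> {1..m} \<times> UNIV"
    and one: "(\<Sum>c=1..m. avg d K (\<lambda>J. of_bool ((c, Suc q) \<in> A J))) \<le> 1"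
  shows "avg d K (\<lambda>J. W (A J)) \<le> avg d K (\<lambda>J. W (A' J))"
proof -
  define C where "C J = {e \<in> A J. snd e \<noteq> Suc q}" for J
  let ?m = "\<lambda>c J. W (insert (c, Suc q) (C J)) - W (C J)"
  let ?b = "\<lambda>c J. of_bool ((c, Suc q) \<in> A J) :: real"
  have C: "avg d K (\<lambda>J. W (C J)) \<le> avg d K (\<lambda>J. W (A' J))"
    "\<And>c. c \<in> {1..m} \<Longrightarrow> avg d K (\<lambda>J. W (insert (c, Suc q) (C J))) \<le> avg d K (\<lambda>J. W (A' J))"
    using st unfolding rounding_step_def Let_def C_def by auto
  define M where "M = avg d K (\<lambda>J. W (A' J)) - avg d K (\<lambda>J. W (C J))"
  have M0: "0 \<le> M" using C by (simp add: M_def)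
  have pw: "W (A J) \<le> W (C J) + (\<Sum>c=1..m. ?b c J * ?m c J)" for J
  proof -
    let ?S = "{c\<in>{1..m}. (c, Suc q) \<in> A J}"
    have "A J = C J \<union> (\<lambda>c. (c, Suc q)) ` ?S" using sub[of J] by (auto simp: C_def)
    then have "W (A J) - W (C J) \<le> (\<Sum>e\<in>(\<lambda>c. (c, Suc q)) ` ?S. W (insert e (C J)) - W (C J))"
      using union_le_sum_marginals[of "(\<lambda>c. (c, Suc q)) ` ?S" "C J"] by simp
    also have "\<dots> = (\<Sum>c\<in>?S. ?m c J)" by (subst sum.reindex) (auto simp: inj_on_def)
    also have "\<dots> = (\<Sum>c=1..m. ?b c J * ?m c J)"
      by (rule sum.mono_neutral_cong_left) (auto simp: of_bool_def)
    finally show ?thesis by simp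
  qed
  have "avg d K (\<lambda>J. W (A J)) \<le> avg d K (\<lambda>J. W (C J)) + (\<Sum>c=1..m. avg d K (\<lambda>J. ?b c J * ?m c J))"
    using avg_mono[OF d pw] unfolding avg_add avg_sum .
  also have "(\<Sum>c=1..m. avg d K (\<lambda>J. ?b c J * ?m c J)) \<le> (\<Sum>c=1..m. avg d K (?b c) * M)"
  proof (intro sum_mono)
    fix c assume c: "c \<in> {1..m}"
    have "mono (?b c)"
    proof (intro monoI)
      fix J J' :: "nat set" assume "J \<subseteq> J'"
      then have "A J \<subseteq> A J'" using mono by (auto dest: monoD)
      then show "?b c J \<le> ?b c J'" by auto
    qed
    moreover have "antimono (?m c)"
    proof (intro antimonoI marginal_antimono)
      fix J J' :: "nat set" assume "J \<subseteq> J'"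
      then have "A J \<subseteq> A J'" using mono by (auto dest: monoD)
      then show "C J \<subseteq> C J'" by (auto simp: C_def)
    qed (simp add: C_def)
    ultimately have "avg d K (\<lambda>J. ?b c J * ?m c J) \<le> avg d K (?b c) * avg d K (?m c)"
      by (intro Harris_inequality d)
    also have "\<dots> \<le> avg d K (?b c) * M"
      using C(2)[OF c] d by (intro mult_left_mono avg_nonneg) (auto simp: M_def avg_diff)
    finally show "avg d K (\<lambda>J. ?b c J * ?m c J) \<le> avg d K (?b c) * M" .
  qed
  \<comment> \<open>The expected number of items the agent holds is at most 1, and \<open>M\<close>
    is nonnegative because giving nothing is among the choices.\<close>
  also have "\<dots> \<le> 1 * M" unfolding sum_distrib_right[symmetric] using one M0 by (intro mult_right_mono)
  finally show ?thesis by (simp add: M_def)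
qed

text \<open>When all agents are fixed, the set is the same in every outcome, so the expectation is
  the value at any single \<open>J\<close>.\<close>

theorem rounding:
  assumes ch: "chain (rounding_step d K m) n A0 A" and d: "0 \<le> d" "d \<le> 1" and mono: "mono A0"
    and sub: "\<And>J. A0 J \<subseteq> {1..m} \<times> {1..n}"
    and one: "\<And>q. q \<in> {1..n} \<Longrightarrow> (\<Sum>c=1..m. avg d K (\<lambda>J. of_bool ((c, q) \<in> A0 J))) \<le> 1"
  shows "avg d K (\<lambda>J. W (A0 J)) \<le> W (A J)" "inj_on snd (A J)" "A J \<subseteq> {1..m} \<times> {1..n}"
proof -
  \<comment> \<open>Invariant after \<open>v\<close> agents: agents above \<open>v\<close> are still
    as in \<open>A0\<close>, agents up to \<open>v\<close> hold at most one item, identical in all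
    outcomes. Monotonicity in the outcome is kept because Harris needs it for the next
    agent.\<close>
  have *: "avg d K (\<lambda>J. W (A0 J)) \<le> avg d K (\<lambda>J. W (A J)) \<and> mono A \<and> (\<forall>J. A J \<subseteq> {1..m} \<times> {1..n}) \<and>
     (\<forall>J. \<forall>e. snd e > v \<longrightarrow> (e \<in> A J \<longleftrightarrow> e \<in> A0 J)) \<and>
     (\<forall>J J' e e'. snd e \<le> v \<longrightarrow> e \<in> A J \<longrightarrow> e' \<in> A J' \<longrightarrow> snd e = snd e' \<longrightarrow> e = e') \<and>
     (\<forall>J e. snd e \<le> v \<longrightarrow> e \<in> A J \<longrightarrow> (\<forall>J'. e \<in> A J'))"
    if "v \<le> n" "chain (rounding_step d K m) v A0 A" for v
    using that
  proof (induction v arbitrary: A)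
    case 0
    have A: "A = A0" using 0 by simp
    have nz: P if "snd e \<le> 0" "e \<in> A0 J" for e J P using sub[of J] that by auto
    show ?case unfolding A by (intro conjI allI impI order_refl refl mono sub) (erule (1) nz)+
  next
    case (Suc v)
    then obtain D where D: "chain (rounding_step d K m) v A0 D" and st: "rounding_step d K m v D A" by auto
    note IH' = Suc.IH[OF Suc_leD[OF Suc.prems(1)] D]
    note IH = IH'[THEN conjunct1] IH'[THEN conjunct2, THEN conjunct1]
      IH'[THEN conjunct2, THEN conjunct2, THEN conjunct1, rule_format]
    have IH4: "e \<in> D J \<longleftrightarrow> e \<in> A0 J" if "snd e > v" for J e
      using IH'[THEN conjunct2, THEN conjunct2, THEN conjunct2, THEN conjunct1] that by blast
    have IH5: "e = e'" if "snd e \<le> v" "e \<in> D J" "e' \<in> D J'" "snd e = snd e'" for J J' e e'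
      using IH'[THEN conjunct2, THEN conjunct2, THEN conjunct2, THEN conjunct2, THEN conjunct1] that by blast
    have IH6: "e \<in> D J'" if "snd e \<le> v" "e \<in> D J" for J J' e
      using IH'[THEN conjunct2, THEN conjunct2, THEN conjunct2, THEN conjunct2, THEN conjunct2] that by blast
    have "(\<Sum>c=1..m. avg d K (\<lambda>J. of_bool ((c, Suc v) \<in> D J))) \<le> 1"
      using one[of "Suc v"] Suc.prems(1) IH4 by simp
    moreover have "D J \<subseteq> {1..m} \<times> UNIV" for J using IH(3)[of J] by blast
    ultimately have val: "avg d K (\<lambda>J. W (D J)) \<le> avg d K (\<lambda>J. W (A J))"
      using rounding_step_value[OF st d IH(2)] by blast
    obtain S where S: "S = {} \<or> (\<exists>c\<in>{1..m}. S = {(c, Suc v)})" and A: "\<And>J. A J = {e \<in> D J. snd e \<noteq> Suc v} \<union> S"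
    proof -
      from st consider "A = (\<lambda>J. {e \<in> D J. snd e \<noteq> Suc v})"
        | c where "c \<in> {1..m}" "A = (\<lambda>J. insert (c, Suc v) {e \<in> D J. snd e \<noteq> Suc v})"
        unfolding rounding_step_def Let_def by blast
      then show thesis
      proof cases
        case 1
        then show ?thesis using that[of "{}"] by simp
      next
        case 2
        then show ?thesis using that[of "{(c, Suc v)}"] by auto
      qed
    qed
    have m: "mono A"
    proof (intro monoI)
      fix J J' :: "nat set" assume "J \<subseteq> J'"
      then have "D J \<subseteq> D J'" using IH(2) by (auto dest: monoD)
      then show "A J \<subseteq> A J'" unfolding A by blast
    qed
    have s: "A J \<subseteq> {1..m} \<times> {1..n}" for J unfolding A using IH(3)[of J] S Suc.prems(1) by auto
    have new: "e \<in> A J \<longleftrightarrow> e \<in> A0 J" if "snd e > Suc v" for e J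
      unfolding A using S IH4[of e J] that by auto
    have A1: "e \<in> A J \<longleftrightarrow> e \<in> S" if "snd e = Suc v" for e J unfolding A using that by auto
    have A2: "e \<in> A J \<longleftrightarrow> e \<in> D J" if "snd e \<le> v" for e J unfolding A using that S by auto
    have u: "e = e'" if "snd e \<le> Suc v" "e \<in> A J" "e' \<in> A J'" "snd e = snd e'" for J J' e e'
    proof (cases "snd e = Suc v")
      case True
      then show ?thesis using that A1 S by auto
    next
      case False
      then have v: "snd e \<le> v" "snd e' \<le> v" using that by auto
      show ?thesis using IH5[OF v(1), of J e' J'] that(2-4) unfolding A2[OF v(1)] A2[OF v(2)] by blast
    qed
    have w: "e \<in> A J'" if "snd e \<le> Suc v" "e \<in> A J" for J J' e
    proof (cases "snd e = Suc v")
      case True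
      then show ?thesis using that(2) A1 by simp
    next
      case False
      then have v: "snd e \<le> v" using that by auto
      show ?thesis using IH6[OF v, of J J'] that(2) unfolding A2[OF v] by blast
    qed
    show ?case using order_trans[OF IH(1) val] m s new u w by (intro conjI allI impI)
  qed
  note fin = *[OF order_refl ch]
  note fin5 = fin[THEN conjunct2, THEN conjunct2, THEN conjunct2, THEN conjunct2]
  show sub': "A J \<subseteq> {1..m} \<times> {1..n}" for J using fin by simp
  have le: "snd e \<le> n" if "e \<in> A J" for e J using sub'[of J] that by auto
  show "inj_on snd (A J)"
    using fin5[THEN conjunct1, rule_format, OF le] by (intro inj_onI)
  have eq: "A J' = A J" for J' using fin5[THEN conjunct2, rule_format, OF le] by (intro equalityI subsetI)
  have "avg d K (\<lambda>J. W (A J)) = avg d K (\<lambda>_. W (A J))" by (intro avg_cong arg_cong[OF eq])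
  then show "avg d K (\<lambda>J. W (A0 J)) \<le> W (A J)" using fin by simp
qed

text \<open>In each round an agent has at most one pair, lying in one block, and that block is
  included with probability \<open>d\<close>. Over \<open>L\<close> rounds this adds up to at most
  \<open>d * L \<le> 1\<close>.\<close>

lemma good_rounds_total:
  assumes good: "\<And>t. t < L \<Longrightarrow> \<exists>F. good_round d l ({1..m} \<times> {1..n}) F t B" and d: "0 \<le> d" "d \<le> 1" "d * L \<le> 1"
  shows "(\<Sum>c=1..m. avg d (L * l) (\<lambda>J. of_bool ((c, q) \<in> (\<Union>k\<in>J. B k)))) \<le> 1"
proof -
  have one: "(\<Sum>k=t*l..<t*l+l. \<Sum>c=1..m. of_bool ((c, q) \<in> B k)) \<le> (1::real)" if t: "t < L" for t
  proof -
    let ?S = "{(r, c). r < l \<and> c \<in> {1..m} \<and> (c, q) \<in> B (t * l + r)}"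
    have fin: "finite ?S" by (rule finite_subset[of _ "{..<l} \<times> {1..m}"]) auto
    have "(\<Sum>k=t*l..<t*l+l. \<Sum>c=1..m. of_bool ((c, q) \<in> B k)) = (\<Sum>r<l. \<Sum>c=1..m. of_bool ((c, q) \<in> B (t * l + r)) :: real)"
      using sum.shift_bounds_nat_ivl[of _ 0 "t*l" l] by (simp add: add.commute lessThan_atLeast0)
    also have "\<dots> = (\<Sum>(r, c)\<in>{..<l} \<times> {1..m}. of_bool ((c, q) \<in> B (t * l + r)))" by (rule sum.cartesian_product)
    also have "\<dots> = (\<Sum>(r, c)\<in>?S. 1)" by (rule sum.mono_neutral_cong_right) auto
    also have "\<dots> = real (card ?S)" by (simp add: case_prod_unfold)
    also have "card ?S \<le> 1"
    proof -
      obtain F where "good_round d l ({1..m} \<times> {1..n}) F t B" using good[OF t] by blast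
      note inj = good_roundD(2)[OF this]
      have "x = y" if "x \<in> ?S" "y \<in> ?S" for x y
      proof -
        obtain r c r' c' where xy: "x = (r, c)" "y = (r', c')" by (cases x, cases y) auto
        then show ?thesis using that inj[of r r' "(c, q)" "(c', q)"] by auto
      qed
      then show ?thesis using fin by (auto simp: card_le_Suc0_iff_eq)
    qed
    finally show ?thesis by simp
  qed
  have "(\<Sum>c=1..m. avg d (L * l) (\<lambda>J. of_bool ((c, q) \<in> (\<Union>k\<in>J. B k)))) \<le> (\<Sum>c=1..m. d * (\<Sum>k<L*l. of_bool ((c, q) \<in> B k)))"
    using d by (intro sum_mono avg_of_bool_le)
  also have "\<dots> = d * (\<Sum>k<L*l. \<Sum>c=1..m. of_bool ((c, q) \<in> B k))"
    unfolding sum_distrib_left[symmetric] by (subst sum.swap) simp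
  also have "(\<Sum>k<L*l. \<Sum>c=1..m. of_bool ((c, q) \<in> B k)) = (\<Sum>t<L. \<Sum>k=t*l..<t*l+l. \<Sum>c=1..m. of_bool ((c, q) \<in> B k) :: real)"
    by (rule sum.nat_group[symmetric])
  also have "\<dots> \<le> (\<Sum>t<L. 1)" using one by (intro sum_mono) auto
  finally show ?thesis using d by (simp add: mult_left_mono)
qed

end

section \<open>The approximation ratio\<close>

text \<open>The third inequality is the limit of the guarantee for large \<open>l\<close> and
  \<open>p\<close>. As x^4 = 1/e, it amounts to x < 7/4 - x - 2 (1 - x) / e, which already follows
  from x < 0.78 and 1/e \<le> 0.37.\<close>

lemma ratio_constant:
  defines "x \<equiv> exp (- 1 / 4 :: real)"
  shows "3 / 4 < x" "x < 1" "exp (- 1) < x ^ 3 * (7 / 4 - x - (1 - x) * (2 * exp (- 1)))"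
proof -
  have x4: "x ^ 4 = exp (- 1)" unfolding x_def by (simp flip: exp_of_nat_mult)
  have e1: "exp (- 1 :: real) = inverse (exp 1)" by (simp add: exp_minus)
  have "(5 / 2) \<le> exp (1 :: real)" "exp (1 :: real) \<le> 3"
    using exp_lower_Taylor_quadratic[of 1] exp_le by auto
  then have lo: "1 / 3 \<le> exp (- 1 :: real)" unfolding e1 by (simp add: field_simps)
  have hi: "exp (- 1 :: real) \<le> 0.37"
    using e_approx_32 by (simp add: e1 field_simps abs_if split: if_splits)
  show 1: "3 / 4 < x"
  proof (rule ccontr)
    assume "\<not> 3 / 4 < x"
    then have "x ^ 4 \<le> (3 / 4) ^ 4" by (intro power_mono) (auto simp: x_def)
    then show False using lo unfolding x4 by (simp add: power_divide)
  qed
  show "x < 1" by (simp add: x_def)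
  have x78: "x < 0.78"
  proof (rule ccontr)
    assume "\<not> x < 0.78"
    then have "(0.78 :: real) ^ 4 \<le> x ^ 4" by (intro power_mono) auto
    then show False using hi unfolding x4 by (simp add: power_divide)
  qed
  have "(1 - x) * exp (- 1) \<le> (1 - x) * 0.37" using hi \<open>x < 1\<close> by (intro mult_left_mono) auto
  then have "x < 7 / 4 - x - (1 - x) * (2 * exp (- 1))" using x78 by simp
  then have "x ^ 3 * x < x ^ 3 * (7 / 4 - x - (1 - x) * (2 * exp (- 1)))"
    using 1 by (intro mult_strict_left_mono) auto
  then show "exp (- 1) < x ^ 3 * (7 / 4 - x - (1 - x) * (2 * exp (- 1)))"
    using x4 by (simp add: numeral_eq_Suc mult.commute)
qed

text \<open>The strict inequality of the limit persists for some finite \<open>p\<close>, a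
  universal constant. Taking \<open>l = 2 * p\<close> makes \<open>l ^ 3 = 8 * p ^ 3\<close>
  divisible by 4, so a quarter of the rounds is the integer \<open>2 * p ^ 3\<close>.\<close>

lemma ratio_parameters:
  obtains p :: nat where "p \<ge> 2"
    "3 / 4 \<le> (1 - 1 / real (2 * p) ^ 3) ^ (2 * p ^ 3)"
    "let x = (1 - 1 / real (2 * p) ^ 3) ^ (2 * p ^ 3) in
       exp (- 1) \<le> (1 - 1 / real (2 * p))\<^sup>2 * x ^ 3 * (7 / 4 - x - (1 - x) * ((2 + 1 / real p) * exp (- 1)))"
proof -
  define x where "x p = (1 - 1 / real (2 * p) ^ 3) ^ (2 * p ^ 3)" for p
  have "filterlim (\<lambda>p::nat. 2 * p ^ 3) sequentially sequentially"
    by (rule filterlim_at_top_mono[OF filterlim_ident]) (auto intro!: always_eventually simp: numeral_3_eq_3)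
  \<comment> \<open>The base equals \<open>1 - 1 / (2 * p) ^ 3\<close> written with the exponent as
    denominator.\<close>
  then have "((\<lambda>p. (1 + (- 1 / 4) / real (2 * p ^ 3)) ^ (2 * p ^ 3)) \<longlongrightarrow> exp (- 1 / 4)) sequentially"
    by (rule filterlim_compose[OF tendsto_exp_limit_sequentially[of "- 1 / 4"]])
  then have x: "x \<longlonglongrightarrow> exp (- 1 / 4)"
    unfolding x_def by (simp add: power_mult_distrib)
  have i: "(\<lambda>p. 1 / real p) \<longlonglongrightarrow> 0" by (rule lim_1_over_n)
  have i2: "(\<lambda>p. 1 / real (2 * p)) \<longlonglongrightarrow> 0" using tendsto_mult_right_zero[OF i, of "1 / 2"] by simp
  have "(\<lambda>p. (1 - 1 / real (2 * p))\<^sup>2 * x p ^ 3 * (7 / 4 - x p - (1 - x p) * ((2 + 1 / real p) * exp (- 1))))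
     \<longlonglongrightarrow> (1 - 0)\<^sup>2 * exp (- 1 / 4) ^ 3 * (7 / 4 - exp (- 1 / 4) - (1 - exp (- 1 / 4)) * ((2 + 0) * exp (- 1)))"
    by (intro tendsto_intros x i i2)
  then have "\<forall>\<^sub>F p in sequentially. exp (- 1) < (1 - 1 / real (2 * p))\<^sup>2 * x p ^ 3 * (7 / 4 - x p - (1 - x p) * ((2 + 1 / real p) * exp (- 1)))"
    by (rule order_tendstoD) (use ratio_constant(3) in simp)
  moreover have "\<forall>\<^sub>F p in sequentially. 3 / 4 < x p" using x ratio_constant(1) by (rule order_tendstoD)
  ultimately have "\<forall>\<^sub>F p in sequentially. 2 \<le> p \<and> 3 / 4 < x p \<and> exp (- 1) < (1 - 1 / real (2 * p))\<^sup>2 * x p ^ 3 * (7 / 4 - x p - (1 - x p) * ((2 + 1 / real p) * exp (- 1)))"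
    using eventually_ge_at_top[of 2] by eventually_elim auto
  then obtain p where "2 \<le> p \<and> 3 / 4 < x p \<and> exp (- 1) < (1 - 1 / real (2 * p))\<^sup>2 * x p ^ 3 * (7 / 4 - x p - (1 - x p) * ((2 + 1 / real p) * exp (- 1)))"
    unfolding eventually_sequentially by blast
  then show thesis using that[of p] by (simp add: x_def Let_def)
qed

context assignment_function
begin

text \<open>If \<open>W Z\<close> misses the ratio, local optimality bounds
  \<open>W (Z \<union> Ot) + W (Z \<inter> Ot)\<close> by about 2/e of the optimum. The guarantee
  for \<open>V\<close> decreases in this sum with factor \<open>1 - x\<close>, and what is left of
  \<open>W (Z \<union> Ot)\<close> has the coefficient \<open>x - 3 / 4\<close>, which is
  nonnegative.\<close>

lemma approximation_ratio:
  assumes par: "p \<ge> 1" "3 / 4 \<le> x" "x \<le> 1"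
    "exp (- 1) \<le> c * x ^ 3 * (7 / 4 - x - (1 - x) * ((2 + 1 / real p) * exp (- 1)))" and c: "0 \<le> c"
    and loc: "W (Z \<union> Ot) + W (Z \<inter> Ot) \<le> (2 + 1 / real p) * W Z"
    and V: "0 \<le> W Ot - (1 - x) * W (Z \<union> Ot) \<Longrightarrow> V \<ge> c * x ^ 3 *
      ((1 - x) * (W Ot - W (Z \<inter> Ot) - W (Z \<union> Ot)) + x * W (Z \<union> Ot) / 4 + 3 / 4 * (W Ot - (1 - x) * W (Z \<union> Ot)))"
  shows "exp (- 1) * W Ot \<le> max (W Z) V"
proof (cases "exp (- 1) * W Ot \<le> W Z")
  case False
  define a b ot where "a = W (Z \<union> Ot)" and "b = W (Z \<inter> Ot)" and "ot = W Ot"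
  have nn: "0 \<le> a" "0 \<le> b" "0 \<le> ot" by (simp_all add: a_def b_def ot_def nonneg)
  have "exp (- 1 :: real) \<le> 1" by simp
  then have "exp (- 1) * ot \<le> 1 * ot" using nn by (intro mult_right_mono)
  then have "W Z \<le> ot" using False by (simp add: ot_def)
  moreover have "a \<le> W Z + ot" using submodular[of Z Ot] nonneg[of "Z \<inter> Ot"] by (simp add: a_def ot_def)
  \<comment> \<open>A crude bound, but since \<open>1 - x \<le> 1 / 4\<close> it suffices to
    discharge the premise of the bound on \<open>V\<close>.\<close>
  ultimately have "a \<le> 2 * ot" by simp
  then have "(1 - x) * a \<le> (1 / 4) * (2 * ot)" using par nn by (intro mult_mono) auto
  then have Q: "0 \<le> ot - (1 - x) * a" using nn by simp
  have ab: "a + b \<le> (2 + 1 / real p) * (exp (- 1) * ot)"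
  proof -
    have "a + b \<le> (2 + 1 / real p) * W Z" using loc by (simp add: a_def b_def)
    also have "\<dots> \<le> (2 + 1 / real p) * (exp (- 1) * ot)" using False by (intro mult_left_mono) (auto simp: ot_def)
    finally show ?thesis .
  qed
  have "exp (- 1) * ot \<le> c * x ^ 3 * (7 / 4 - x - (1 - x) * ((2 + 1 / real p) * exp (- 1))) * ot"
    using par nn by (intro mult_right_mono)
  also have "\<dots> = c * x ^ 3 * ((7 / 4 - x) * ot - (1 - x) * ((2 + 1 / real p) * (exp (- 1) * ot)))"
    by (simp add: algebra_simps)
  also have "\<dots> \<le> c * x ^ 3 * ((7 / 4 - x) * ot - (1 - x) * (a + b))"
    using par ab c by (intro mult_left_mono diff_left_mono) auto
  also have "\<dots> \<le> c * x ^ 3 * ((1 - x) * (ot - b - a) + x * a / 4 + 3 / 4 * (ot - (1 - x) * a))"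
  proof (intro mult_left_mono)
    have "3 / 4 * a \<le> x * a" using par nn by (intro mult_right_mono)
    moreover have "(1 - x) * (ot - b - a) + x * a / 4 + 3 / 4 * (ot - (1 - x) * a)
      = (7 / 4 - x) * ot - (1 - x) * (a + b) + (x * a - 3 / 4 * a)" by (simp add: field_simps)
    ultimately show "(7 / 4 - x) * ot - (1 - x) * (a + b) \<le> (1 - x) * (ot - b - a) + x * a / 4 + 3 / 4 * (ot - (1 - x) * a)"
      by linarith
  qed (use par c in auto)
  also have "\<dots> \<le> V" using V Q unfolding a_def b_def ot_def by simp
  finally show ?thesis by (simp add: ot_def)
qed simp

end

section \<open>Reasoning about deterministic programs\<close>

lemma nmem_nwrite [simp]: "nmem (nwrite x is v s) = (nmem s)(x := (nmem s x)(is := v))"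
  and rmem_nwrite [simp]: "rmem (nwrite x is v s) = rmem s"
  and nmem_rwrite [simp]: "nmem (rwrite x is r s) = nmem s"
  and rmem_rwrite [simp]: "rmem (rwrite x is r s) = (rmem s)(x := (rmem s x)(is := r))"
  by (simp_all add: nwrite_def rwrite_def)

text \<open>A frame condition: \<open>N\<close> names the arrays, of either memory, that a fragment
  may change.\<close>

definition keep :: "string set \<Rightarrow> store \<Rightarrow> store \<Rightarrow> bool" where
  "keep N s s' \<longleftrightarrow> (\<forall>x. x \<notin> N \<longrightarrow> nmem s' x = nmem s x \<and> rmem s' x = rmem s x)"

lemma keep_refl [simp]: "keep N s s" by (simp add: keep_def)

lemma keep_trans: "keep N s s1 \<Longrightarrow> keep N' s1 s2 \<Longrightarrow> N \<subseteq> M \<Longrightarrow> N' \<subseteq> M \<Longrightarrow> keep M s s2"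
  unfolding keep_def by (metis subsetD)

lemma keep_nwrite: "keep N s s' \<Longrightarrow> x \<in> N \<Longrightarrow> keep N s (nwrite x is v s')"
  and keep_rwrite: "keep N s s' \<Longrightarrow> x \<in> N \<Longrightarrow> keep N s (rwrite x is r s')"
  by (auto simp: keep_def)

lemma keepN: "keep N s s' \<Longrightarrow> x \<notin> N \<Longrightarrow> nmem s' x = nmem s x"
  and keepR: "keep N s s' \<Longrightarrow> x \<notin> N \<Longrightarrow> rmem s' x = rmem s x"
  by (simp_all add: keep_def)

text \<open>Quantifying over the continuation \<open>cs\<close> makes fragments compose; the point
  distribution expresses that the fragment's execution is deterministic.\<close>

definition reach :: "msw \<Rightarrow> com list \<Rightarrow> nat \<Rightarrow> store \<Rightarrow> store \<Rightarrow> bool" where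
  "reach I P t s s' \<longleftrightarrow> (\<forall>cs. steps I t (P @ cs, s) = return_pmf (cs, s'))"

lemma steps_add: "steps I (t + u) c = bind_pmf (steps I t c) (steps I u)"
proof (induction t arbitrary: c)
  case (Suc t)
  then have "steps I (t + u) = (\<lambda>c. bind_pmf (steps I t c) (steps I u))" by auto
  then show ?case by (simp add: bind_assoc_pmf)
qed (simp add: bind_return_pmf)

lemma reach_append: "reach I P t s s1 \<Longrightarrow> reach I Q u s1 s' \<Longrightarrow> reach I (P @ Q) (t + u) s s'"
  by (simp add: reach_def steps_add bind_return_pmf)

lemma reach_step:
  assumes "\<And>cs. step I (c # cs, s) = return_pmf (P @ cs, s1)" "reach I P t s1 s'"
  shows "reach I [c] (Suc t) s s'"
  using assms by (simp add: reach_def bind_return_pmf)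

lemma steps_halted: "steps I t ([], s) = return_pmf ([], s)"
  by (induction t) (simp_all add: bind_return_pmf)

definition polynomially_bounded :: "(msw \<Rightarrow> nat) \<Rightarrow> bool" where
  "polynomially_bounded T \<longleftrightarrow> (\<exists>p :: nat poly. \<forall>I. T I \<le> poly p (agents I + items I))"

lemma polynomially_bounded_intros:
  "polynomially_bounded (\<lambda>I. k)" "polynomially_bounded agents" "polynomially_bounded items"
  "polynomially_bounded T \<Longrightarrow> polynomially_bounded T' \<Longrightarrow> polynomially_bounded (\<lambda>I. T I + T' I)"
  "polynomially_bounded T \<Longrightarrow> polynomially_bounded T' \<Longrightarrow> polynomially_bounded (\<lambda>I. T I * T' I)"
proof -
  show "polynomially_bounded (\<lambda>I. k)" unfolding polynomially_bounded_def by (rule exI[of _ "[:k:]"]) simp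
  show "polynomially_bounded agents" "polynomially_bounded items"
    unfolding polynomially_bounded_def by (rule exI[of _ "[:0, 1:]"], simp)+
  assume "polynomially_bounded T" "polynomially_bounded T'"
  then obtain p q :: "nat poly" where pq: "\<And>I. T I \<le> poly p (agents I + items I)" "\<And>I. T' I \<le> poly q (agents I + items I)"
    unfolding polynomially_bounded_def by blast
  show "polynomially_bounded (\<lambda>I. T I + T' I)" unfolding polynomially_bounded_def
    by (rule exI[of _ "p + q"]) (simp add: add_mono pq)
  show "polynomially_bounded (\<lambda>I. T I * T' I)" unfolding polynomially_bounded_def
    by (rule exI[of _ "p * q"]) (simp add: mult_mono pq)
qed

text \<open>Total correctness together with polynomial time. The bound depends on the instance only
  and holds from every store, so it survives composition and loops without any invariant.\<close>

definition prog :: "com list \<Rightarrow> (msw \<Rightarrow> store \<Rightarrow> store \<Rightarrow> bool) \<Rightarrow> bool" where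
  "prog P R \<longleftrightarrow> (\<exists>T. polynomially_bounded T \<and> (\<forall>I s. \<exists>t s'. t \<le> T I \<and> reach I P t s s' \<and> R I s s'))"

lemma prog_weaken: "prog P R \<Longrightarrow> (\<And>I s s'. R I s s' \<Longrightarrow> R' I s s') \<Longrightarrow> prog P R'"
  unfolding prog_def by meson

lemma prog_Nil: "prog [] (\<lambda>I s s'. s' = s)"
  unfolding prog_def by (intro exI[of _ "\<lambda>_. 0"] conjI polynomially_bounded_intros allI)
    (auto simp: reach_def)

lemma prog_append:
  assumes "prog P R" "prog Q R'"
  shows "prog (P @ Q) (\<lambda>I s s'. \<exists>s1. R I s s1 \<and> R' I s1 s')"
proof -
  obtain T T' where T: "polynomially_bounded T" "\<And>I s. \<exists>t s'. t \<le> T I \<and> reach I P t s s' \<and> R I s s'"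
    and T': "polynomially_bounded T'" "\<And>I s. \<exists>t s'. t \<le> T' I \<and> reach I Q t s s' \<and> R' I s s'"
    using assms unfolding prog_def by blast
  show ?thesis unfolding prog_def
  proof (intro exI[of _ "\<lambda>I. T I + T' I"] conjI polynomially_bounded_intros allI T T')
    fix I s
    obtain t s1 where 1: "t \<le> T I" "reach I P t s s1" "R I s s1" using T by blast
    obtain u s' where 2: "u \<le> T' I" "reach I Q u s1 s'" "R' I s1 s'" using T' by blast
    show "\<exists>t s'. t \<le> T I + T' I \<and> reach I (P @ Q) t s s' \<and> (\<exists>s1. R I s s1 \<and> R' I s1 s')"
      using 1 2 reach_append[OF 1(2) 2(2)] by (intro exI[of _ "t + u"] exI[of _ s']) auto
  qed
qed

lemma prog_step:
  assumes "\<And>I s cs. step I (c # cs, s) = return_pmf (cs, f I s)"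
  shows "prog [c] (\<lambda>I s s'. s' = f I s)"
  unfolding prog_def
proof (intro exI[of _ "\<lambda>_. 1"] conjI polynomially_bounded_intros allI)
  fix I s
  have "reach I [c] 1 s (f I s)" using assms by (simp add: reach_def bind_return_pmf)
  then show "\<exists>t s'. t \<le> 1 \<and> reach I [c] t s s' \<and> s' = f I s" by auto
qed

lemma prog_NAssign: "prog [NAssign x es e] (\<lambda>I s s'. s' = nwrite x (map (nval I s) es) (nval I s e) s)"
  and prog_RAssign: "prog [RAssign x es r] (\<lambda>I s s'. s' = rwrite x (map (nval I s) es) (rval I s r) s)"
  by (rule prog_step, simp)+

lemma prog_Cond:
  assumes "prog P R" "prog Q R'"
  shows "prog [Cond b P Q] (\<lambda>I s s'. if bval I s b then R I s s' else R' I s s')"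
proof -
  obtain T T' where T: "polynomially_bounded T" "\<And>I s. \<exists>t s'. t \<le> T I \<and> reach I P t s s' \<and> R I s s'"
    and T': "polynomially_bounded T'" "\<And>I s. \<exists>t s'. t \<le> T' I \<and> reach I Q t s s' \<and> R' I s s'"
    using assms unfolding prog_def by blast
  show ?thesis unfolding prog_def
  proof (intro exI[of _ "\<lambda>I. T I + T' I + 1"] conjI polynomially_bounded_intros allI T T')
    fix I s
    obtain t s1 where 1: "t \<le> T I" "reach I P t s s1" "R I s s1" using T by blast
    obtain u s2 where 2: "u \<le> T' I" "reach I Q u s s2" "R' I s s2" using T' by blast
    show "\<exists>t s'. t \<le> T I + T' I + 1 \<and> reach I [Cond b P Q] t s s' \<and> (if bval I s b then R I s s' else R' I s s')"
    proof (cases "bval I s b")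
      case True
      then have "reach I [Cond b P Q] (Suc t) s s1" by (intro reach_step[OF _ 1(2)]) simp
      then show ?thesis using 1 True by (intro exI[of _ "Suc t"] exI[of _ s1]) auto
    next
      case False
      then have "reach I [Cond b P Q] (Suc u) s s2" by (intro reach_step[OF _ 2(2)]) simp
      then show ?thesis using 2 False by (intro exI[of _ "Suc u"] exI[of _ s2]) auto
    qed
  qed
qed

definition For :: "string \<Rightarrow> nat \<Rightarrow> nexp \<Rightarrow> com list \<Rightarrow> com list" where
  "For x lo h P = [NAssign x [] (NConst lo),
     While (NLess (NVar x []) h) (P @ [NAssign x [] (NAdd (NVar x []) (NConst 1))])]"

text \<open>\<open>Q I s0 v s\<close> is an invariant that remembers the initial store
  \<open>s0\<close>. The final counter is \<open>max lo (H I)\<close>, which also covers a loop that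
  never runs. The bound \<open>h\<close> is evaluated anew each time, hence its value must not
  depend on the store.\<close>

lemma prog_For:
  assumes body: "prog P R" and cnt: "\<And>I s s'. R I s s' \<Longrightarrow> nmem s' x [] = nmem s x []"
    and H: "\<And>I s. nval I s h = H I" "polynomially_bounded H"
    and init: "\<And>I s. Q I s lo (nwrite x [] lo s)"
    and step: "\<And>I s0 v s s'. lo \<le> v \<Longrightarrow> v < H I \<Longrightarrow> Q I s0 v s \<Longrightarrow> nmem s x [] = v \<Longrightarrow> R I s s' \<Longrightarrow>
      Q I s0 (Suc v) (nwrite x [] (Suc v) s')"
  shows "prog (For x lo h P) (\<lambda>I s s'. Q I s (max lo (H I)) s')"
proof -
  obtain T where T: "polynomially_bounded T" "\<And>I s. \<exists>t s'. t \<le> T I \<and> reach I P t s s' \<and> R I s s'"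
    using body unfolding prog_def by blast
  let ?P = "P @ [NAssign x [] (NAdd (NVar x []) (NConst 1))]"
  let ?W = "While (NLess (NVar x []) h) ?P"
  \<comment> \<open>Each iteration costs the body, one guard and one increment; the last 1 is the
    failing guard.\<close>
  have loop: "\<exists>t s'. t \<le> k * (T I + 2) + 1 \<and> reach I [?W] t s s' \<and> Q I s0 (max lo (H I)) s'"
    if "k = H I - v" "lo \<le> v" "Q I s0 v s" "nmem s x [] = v" "v \<le> max lo (H I)" for I k v s s0
    using that
  proof (induction k arbitrary: v s)
    case 0
    then have "reach I [?W] (Suc 0) s s" using H by (intro reach_step[of _ _ _ "[]"]) (auto simp: reach_def)
    moreover have "v = max lo (H I)" using 0 by auto
    ultimately show ?case using 0 by (intro exI[of _ "Suc 0"] exI[of _ s]) auto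
  next
    case (Suc k)
    obtain t s1 where 1: "t \<le> T I" "reach I P t s s1" "R I s s1" using T by blast
    have c: "nmem s1 x [] = v" using cnt[OF 1(3)] Suc.prems by simp
    let ?s2 = "nwrite x [] (Suc v) s1"
    have "reach I [NAssign x [] (NAdd (NVar x []) (NConst 1))] (Suc 0) s1 ?s2"
      using c by (intro reach_step[of _ _ _ "[]"]) (auto simp: reach_def)
    then have it: "reach I ?P (t + Suc 0) s ?s2" by (rule reach_append[OF 1(2)])
    have "Q I s0 (Suc v) ?s2" using Suc.prems 1 by (intro step[of v I s0 s s1]) auto
    then have "\<exists>u s'. u \<le> k * (T I + 2) + 1 \<and> reach I [?W] u ?s2 s' \<and> Q I s0 (max lo (H I)) s'"
      using Suc.prems by (intro Suc.IH[of "Suc v"]) auto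
    then obtain u s' where u: "u \<le> k * (T I + 2) + 1" "reach I [?W] u ?s2 s'" "Q I s0 (max lo (H I)) s'"
      by blast
    have "reach I (?P @ [?W]) (t + Suc 0 + u) s s'" by (rule reach_append[OF it u(2)])
    then have "reach I [?W] (Suc (t + Suc 0 + u)) s s'"
      using Suc.prems H by (intro reach_step[where P = "?P @ [?W]"]) auto
    then show ?case using u 1 by (intro exI[of _ "Suc (t + Suc 0 + u)"] exI[of _ s']) auto
  qed
  show ?thesis unfolding prog_def
  proof (intro exI[of _ "\<lambda>I. 1 + (H I * (T I + 2) + 1)"] conjI polynomially_bounded_intros allI T H)
    fix I s
    let ?s = "nwrite x [] lo s"
    obtain t s' where t: "t \<le> (H I - lo) * (T I + 2) + 1" "reach I [?W] t ?s s'" "Q I s (max lo (H I)) s'"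
      using loop[of "H I - lo" I lo s ?s] init by auto
    have "reach I [NAssign x [] (NConst lo)] (Suc 0) s ?s"
      by (intro reach_step[of _ _ _ "[]"]) (auto simp: reach_def)
    from reach_append[OF this t(2)] have "reach I (For x lo h P) (Suc 0 + t) s s'" by (simp add: For_def)
    moreover have "(H I - lo) * (T I + 2) \<le> H I * (T I + 2)" by (intro mult_le_mono1) simp
    ultimately show "\<exists>t s'. t \<le> 1 + (H I * (T I + 2) + 1) \<and> reach I (For x lo h P) t s s' \<and> Q I s (max lo (H I)) s'"
      using t by (intro exI[of _ "Suc 0 + t"] exI[of _ s']) linarith
  qed
qed

section \<open>The welfare of a set of (item, agent) pairs\<close>

definition recipients :: "msw \<Rightarrow> (nat \<times> nat) set \<Rightarrow> nat \<Rightarrow> nat set" where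
  "recipients I X i = {j \<in> {1..agents I}. (i, j) \<in> X}"

text \<open>Welfare extended to arbitrary sets of pairs, in which an agent may hold several items.
  Fractional solutions and unions such as \<open>Z \<union> Ot\<close> are of this kind.\<close>

definition worth :: "msw \<Rightarrow> (nat \<times> nat) set \<Rightarrow> real" where
  "worth I X = (\<Sum>i\<in>{1..items I}. \<Sum>j\<in>recipients I X i. extern I i j (\<Sum>k\<in>recipients I X i. weight I i j k))"

text \<open>An array holds a whole family of sets, one incidence matrix for each outcome number
  \<open>a\<close>.\<close>

definition decode :: "msw \<Rightarrow> store \<Rightarrow> string \<Rightarrow> nat \<Rightarrow> (nat \<times> nat) set" where
  "decode I s x a = {(i, j). i \<in> {1..items I} \<and> j \<in> {1..agents I} \<and> nmem s x [a, i, j] \<noteq> 0}"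

lemma recipients_decode: "i \<in> {1..items I} \<Longrightarrow> recipients I (decode I s x a) i = {j \<in> {1..agents I}. nmem s x [a, i, j] \<noteq> 0}"
  by (auto simp: recipients_def decode_def)

lemma sum_filter_Suc:
  fixes f :: "nat \<Rightarrow> real"
  assumes "1 \<le> v"
  shows "(\<Sum>j\<in>{j\<in>{1..<Suc v}. P j}. f j) = (\<Sum>j\<in>{j\<in>{1..<v}. P j}. f j) + (if P v then f v else 0)"
proof -
  have "{j\<in>{1..<Suc v}. P j} = (if P v then insert v {j\<in>{1..<v}. P j} else {j\<in>{1..<v}. P j})"
    using assms by (auto simp: less_Suc_eq)
  then show ?thesis by simp
qed

lemma sum_filter_1: "(\<Sum>j\<in>{j\<in>{1..<1::nat}. P j}. f j) = (0::real)"
  by (rule sum.neutral) auto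

lemma loop_interval: "{1..<max 1 (k + 1)} = {1..k::nat}"
  by auto

section \<open>Program fragments\<close>

abbreviation scalar :: "string \<Rightarrow> nexp" where "scalar x \<equiv> NVar x []"

abbreviation entry :: "string \<Rightarrow> nexp" where "entry x \<equiv> NVar x [scalar ''a'', scalar ''i'', scalar ''j'']"

abbreviation For_item :: "string \<Rightarrow> com list \<Rightarrow> com list" where "For_item x \<equiv> For x 1 (NAdd NItems (NConst 1))"

abbreviation For_agent :: "string \<Rightarrow> com list \<Rightarrow> com list" where "For_agent x \<equiv> For x 1 (NAdd NAgents (NConst 1))"

lemma item_bound: "nval I s (NAdd NItems (NConst 1)) = items I + 1"
  and agent_bound: "nval I s (NAdd NAgents (NConst 1)) = agents I + 1"
  and const_bound: "nval I s (NConst k) = k"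
  by simp_all

lemmas prog_For_item = prog_For[OF _ _ item_bound polynomially_bounded_intros(4)[OF polynomially_bounded_intros(3,1)]]
lemmas prog_For_agent = prog_For[OF _ _ agent_bound polynomially_bounded_intros(4)[OF polynomially_bounded_intros(2,1)]]
lemmas prog_For_const = prog_For[OF _ _ const_bound polynomially_bounded_intros(1)]

section \<open>Evaluating a weighted sum of welfare values\<close>

definition eval_load :: "com list" where
  "eval_load = RAssign ''ld'' [] (RNat (NConst 0)) #
     For_agent ''k'' [Cond (NLess (NConst 0) (NVar ''Y'' [scalar ''a'', scalar ''i'', scalar ''k'']))
       [RAssign ''ld'' [] (RAdd (RVar ''ld'' []) (RWeight (scalar ''i'') (scalar ''j'') (scalar ''k'')))] []]"

definition eval_row :: "com list" where
  "eval_row = For_agent ''j'' [Cond (NLess (NConst 0) (entry ''Y''))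
       (eval_load @ [RAssign ''val'' [] (RAdd (RVar ''val'' []) (RMul (RNat (NVar ''w'' [scalar ''a'']))
          (ROracle (scalar ''i'') (scalar ''j'') (RVar ''ld'' []))))]) []]"

definition eval_all :: "nat \<Rightarrow> com list" where
  "eval_all U = RAssign ''val'' [] (RNat (NConst 0)) # For ''a'' 0 (NConst U) (For_item ''i'' eval_row)"

lemma prog_eval_load:
  "prog eval_load (\<lambda>I s s'. keep {''ld'', ''k''} s s' \<and> rmem s' ''ld'' [] =
     (\<Sum>k\<in>{k\<in>{1..agents I}. nmem s ''Y'' [nmem s ''a'' [], nmem s ''i'' [], k] \<noteq> 0}.
        weight I (nmem s ''i'' []) (nmem s ''j'' []) k))"
proof -
  define Q where "Q = (\<lambda>(I::msw) s0 v s. keep {''ld'', ''k''} s0 s \<and> rmem s ''ld'' [] = rmem s0 ''ld'' [] +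
     (\<Sum>k\<in>{k\<in>{1..<v}. nmem s0 ''Y'' [nmem s0 ''a'' [], nmem s0 ''i'' [], k] \<noteq> 0}.
        weight I (nmem s0 ''i'' []) (nmem s0 ''j'' []) k))"
  have "prog (For_agent ''k'' [Cond (NLess (NConst 0) (NVar ''Y'' [scalar ''a'', scalar ''i'', scalar ''k'']))
       [RAssign ''ld'' [] (RAdd (RVar ''ld'' []) (RWeight (scalar ''i'') (scalar ''j'') (scalar ''k'')))] []])
     (\<lambda>I s s'. Q I s (max 1 (agents I + 1)) s')"
  proof (rule prog_For_agent[OF prog_Cond[OF prog_RAssign prog_Nil]])
    fix I s0 v s s'
    assume v: "1 \<le> v" and Q: "Q I s0 v s" and k: "nmem s ''k'' [] = v"
      and st: "if bval I s (NLess (NConst 0) (NVar ''Y'' [scalar ''a'', scalar ''i'', scalar ''k'']))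
         then s' = rwrite ''ld'' (map (nval I s) []) (rval I s (RAdd (RVar ''ld'' []) (RWeight (scalar ''i'') (scalar ''j'') (scalar ''k'')))) s
         else s' = s"
    have eq: "nmem s ''Y'' = nmem s0 ''Y''" "nmem s ''a'' = nmem s0 ''a''" "nmem s ''i'' = nmem s0 ''i''" "nmem s ''j'' = nmem s0 ''j''"
      using Q by (auto simp: Q_def keep_def)
    have "keep {''ld'', ''k''} s0 s'" using st Q by (auto simp: Q_def split: if_splits intro: keep_rwrite)
    then show "Q I s0 (Suc v) (nwrite ''k'' [] (Suc v) s')"
      using st Q k v unfolding Q_def sum_filter_Suc[OF v] by (auto simp: eq intro!: keep_nwrite split: if_splits)
  next
    show "Q I s 1 (nwrite ''k'' [] 1 s)" for I s unfolding Q_def sum_filter_1 by (simp add: keep_nwrite)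
  qed (simp split: if_splits)
  from prog_append[OF prog_RAssign[of "''ld''" "[]" "RNat (NConst 0)"] this]
  show ?thesis unfolding eval_load_def append_Cons append_Nil
  proof (rule prog_weaken, elim exE conjE)
    fix I s s' s1
    assume s1: "s1 = rwrite ''ld'' (map (nval I s) []) (rval I s (RNat (NConst 0))) s" and Q: "Q I s1 (max 1 (agents I + 1)) s'"
    have "keep {''ld'', ''k''} s s1" unfolding s1 by (intro keep_rwrite) auto
    moreover have "keep {''ld'', ''k''} s1 s'" using Q by (simp add: Q_def)
    ultimately have "keep {''ld'', ''k''} s s'" by (rule keep_trans) auto
    then show "keep {''ld'', ''k''} s s' \<and> rmem s' ''ld'' [] =
     (\<Sum>k\<in>{k\<in>{1..agents I}. nmem s ''Y'' [nmem s ''a'' [], nmem s ''i'' [], k] \<noteq> 0}.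
        weight I (nmem s ''i'' []) (nmem s ''j'' []) k)"
      using Q unfolding Q_def loop_interval by (simp add: s1)
  qed
qed

lemma decode_keep: "keep N s s' \<Longrightarrow> x \<notin> N \<Longrightarrow> decode I s' x = decode I s x"
  by (rule ext) (simp add: decode_def keepN)

lemma prog_eval_row:
  "prog eval_row (\<lambda>I s s'. keep {''ld'', ''k'', ''j'', ''val''} s s' \<and>
     (nmem s ''i'' [] \<in> {1..items I} \<longrightarrow> rmem s' ''val'' [] = rmem s ''val'' [] +
       real (nmem s ''w'' [nmem s ''a'' []]) *
       (\<Sum>j\<in>recipients I (decode I s ''Y'' (nmem s ''a'' [])) (nmem s ''i'' []).
          extern I (nmem s ''i'' []) j (\<Sum>k\<in>recipients I (decode I s ''Y'' (nmem s ''a'' [])) (nmem s ''i'' []).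
             weight I (nmem s ''i'' []) j k))))"
proof -
  let ?N = "{''ld'', ''k'', ''j'', ''val''}"
  define F where "F = (\<lambda>(I::msw) (s::store) j. extern I (nmem s ''i'' []) j
     (\<Sum>k\<in>{k\<in>{1..agents I}. nmem s ''Y'' [nmem s ''a'' [], nmem s ''i'' [], k] \<noteq> 0}. weight I (nmem s ''i'' []) j k))"
  define Q where "Q = (\<lambda>(I::msw) s0 v s. keep ?N s0 s \<and> rmem s ''val'' [] = rmem s0 ''val'' [] +
     real (nmem s0 ''w'' [nmem s0 ''a'' []]) *
     (\<Sum>j\<in>{j\<in>{1..<v}. nmem s0 ''Y'' [nmem s0 ''a'' [], nmem s0 ''i'' [], j] \<noteq> 0}. F I s0 j))"
  have "prog eval_row (\<lambda>I s s'. Q I s (max 1 (agents I + 1)) s')"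
    unfolding eval_row_def
  proof (rule prog_For_agent[OF prog_Cond[OF prog_append[OF prog_eval_load prog_RAssign] prog_Nil]])
    fix I s s' and v :: nat
    assume st0: "if bval I s (NLess (NConst 0) (entry ''Y''))
       then \<exists>s1. (keep {''ld'', ''k''} s s1 \<and> rmem s1 ''ld'' [] =
           (\<Sum>k\<in>{k\<in>{1..agents I}. nmem s ''Y'' [nmem s ''a'' [], nmem s ''i'' [], k] \<noteq> 0}.
              weight I (nmem s ''i'' []) (nmem s ''j'' []) k)) \<and>
          s' = rwrite ''val'' (map (nval I s1) []) (rval I s1 (RAdd (RVar ''val'' []) (RMul (RNat (NVar ''w'' [scalar ''a'']))
          (ROracle (scalar ''i'') (scalar ''j'') (RVar ''ld'' []))))) s1
       else s' = s"
    let ?y = "nmem s ''Y'' [nmem s ''a'' [], nmem s ''i'' [], nmem s ''j'' []]"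
    have st: "keep {''ld'', ''k'', ''val''} s s' \<and> rmem s' ''val'' [] = rmem s ''val'' [] +
      (if ?y \<noteq> 0 then real (nmem s ''w'' [nmem s ''a'' []]) * F I s (nmem s ''j'' []) else 0)"
    proof (cases "?y = 0")
      case False
      then obtain s1 where k1: "keep {''ld'', ''k''} s s1"
        and ld: "rmem s1 ''ld'' [] = (\<Sum>k\<in>{k\<in>{1..agents I}. nmem s ''Y'' [nmem s ''a'' [], nmem s ''i'' [], k] \<noteq> 0}.
              weight I (nmem s ''i'' []) (nmem s ''j'' []) k)"
        and s': "s' = rwrite ''val'' [] (rval I s1 (RAdd (RVar ''val'' []) (RMul (RNat (NVar ''w'' [scalar ''a'']))
          (ROracle (scalar ''i'') (scalar ''j'') (RVar ''ld'' []))))) s1"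
        using st0 by auto
      have "keep {''ld'', ''k'', ''val''} s s1" by (rule keep_trans[OF keep_refl k1]) auto
      then have "keep {''ld'', ''k'', ''val''} s s'" unfolding s' by (rule keep_rwrite) simp
      then show ?thesis using False unfolding s' by (simp add: ld F_def keepN[OF k1] keepR[OF k1])
    qed (use st0 in simp)
    show "nmem s' ''j'' [] = nmem s ''j'' []" using keepN[OF st[THEN conjunct1], of "''j''"] by simp
    show "Q I s0 (Suc v) (nwrite ''j'' [] (Suc v) s')"
      if v: "1 \<le> v" and Q: "Q I s0 v s" and j: "nmem s ''j'' [] = v" for s0
    proof -
      have eq: "nmem s ''Y'' = nmem s0 ''Y''" "nmem s ''a'' = nmem s0 ''a''" "nmem s ''i'' = nmem s0 ''i''" "nmem s ''w'' = nmem s0 ''w''"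
        using Q keepN[of ?N s0 s] by (simp_all add: Q_def)
      have F: "F I s = F I s0" unfolding F_def by (simp add: eq)
      have "keep ?N s0 s" using Q by (simp add: Q_def)
      then have "keep ?N s0 s'" using st[THEN conjunct1] by (rule keep_trans) auto
      then show ?thesis
        using st Q unfolding Q_def sum_filter_Suc[OF v] by (simp add: eq F j algebra_simps keep_nwrite)
    qed
  next
    show "Q I s 1 (nwrite ''j'' [] 1 s)" for I s unfolding Q_def sum_filter_1 by (simp add: keep_nwrite)
  qed
  then show ?thesis unfolding Q_def F_def loop_interval
    by (rule prog_weaken) (simp add: recipients_decode)
qed

lemma prog_eval_all:
  "prog (eval_all U) (\<lambda>I s s'. keep {''ld'', ''k'', ''j'', ''i'', ''a'', ''val''} s s' \<and>
     rmem s' ''val'' [] = (\<Sum>a<U. real (nmem s ''w'' [a]) * worth I (decode I s ''Y'' a)))"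
proof -
  let ?M = "{''ld'', ''k'', ''j'', ''i'', ''val''}" and ?N = "{''ld'', ''k'', ''j'', ''i'', ''a'', ''val''}"
  define G where "G = (\<lambda>(I::msw) (s::store) a i. \<Sum>j\<in>recipients I (decode I s ''Y'' a) i.
          extern I i j (\<Sum>k\<in>recipients I (decode I s ''Y'' a) i. weight I i j k))"
  define Q where "Q = (\<lambda>(I::msw) s0 v s. keep ?M s0 s \<and> (v \<le> items I + 1 \<longrightarrow> rmem s ''val'' [] = rmem s0 ''val'' [] +
     real (nmem s0 ''w'' [nmem s0 ''a'' []]) * (\<Sum>i=1..<v. G I s0 (nmem s0 ''a'' []) i)))"
  have "prog (For_item ''i'' eval_row) (\<lambda>I s s'. Q I s (max 1 (items I + 1)) s')"
  proof (rule prog_For_item[OF prog_eval_row])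
    fix I s0 v s s'
    assume v: "1 \<le> v" "v < items I + 1" and Q: "Q I s0 v s" and i: "nmem s ''i'' [] = v"
      and st: "keep {''ld'', ''k'', ''j'', ''val''} s s' \<and>
     (nmem s ''i'' [] \<in> {1..items I} \<longrightarrow> rmem s' ''val'' [] = rmem s ''val'' [] +
       real (nmem s ''w'' [nmem s ''a'' []]) *
       (\<Sum>j\<in>recipients I (decode I s ''Y'' (nmem s ''a'' [])) (nmem s ''i'' []).
          extern I (nmem s ''i'' []) j (\<Sum>k\<in>recipients I (decode I s ''Y'' (nmem s ''a'' [])) (nmem s ''i'' []).
             weight I (nmem s ''i'' []) j k)))"
    have eq: "nmem s ''a'' = nmem s0 ''a''" "nmem s ''w'' = nmem s0 ''w''" "decode I s ''Y'' = decode I s0 ''Y''"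
      using Q decode_keep[of ?M s0 s] keepN[of ?M s0 s] by (simp_all add: Q_def)
    have "keep ?M s0 s" using Q by (simp add: Q_def)
    then have k: "keep ?M s0 s'" using st[THEN conjunct1] by (rule keep_trans) auto
    have "rmem s' ''val'' [] = rmem s ''val'' [] + real (nmem s0 ''w'' [nmem s0 ''a'' []]) * G I s0 (nmem s0 ''a'' []) v"
      using st i v by (simp add: eq G_def)
    also have "rmem s ''val'' [] = rmem s0 ''val'' [] + real (nmem s0 ''w'' [nmem s0 ''a'' []]) * (\<Sum>i=1..<v. G I s0 (nmem s0 ''a'' []) i)"
      using Q v by (simp add: Q_def)
    finally have "rmem s' ''val'' [] = rmem s0 ''val'' [] + real (nmem s0 ''w'' [nmem s0 ''a'' []]) * (\<Sum>i=1..<Suc v. G I s0 (nmem s0 ''a'' []) i)"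
      using v by (simp add: algebra_simps)
    then show "Q I s0 (Suc v) (nwrite ''i'' [] (Suc v) s')" using k by (simp add: Q_def keep_nwrite)
  next
    show "Q I s 1 (nwrite ''i'' [] 1 s)" for I s by (simp add: Q_def keep_nwrite)
  qed (simp add: keep_def)
  then have row: "prog (For_item ''i'' eval_row) (\<lambda>I s s'. keep ?M s s' \<and> rmem s' ''val'' [] = rmem s ''val'' [] +
     real (nmem s ''w'' [nmem s ''a'' []]) * worth I (decode I s ''Y'' (nmem s ''a'' [])))"
    by (rule prog_weaken) (simp add: Q_def G_def worth_def atLeastLessThanSuc_atLeastAtMost)
  define Q' where "Q' = (\<lambda>(I::msw) s0 v s. keep ?N s0 s \<and> rmem s ''val'' [] = rmem s0 ''val'' [] +
     (\<Sum>a<v. real (nmem s0 ''w'' [a]) * worth I (decode I s0 ''Y'' a)))"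
  have "prog (For ''a'' 0 (NConst U) (For_item ''i'' eval_row)) (\<lambda>I s s'. Q' I s (max 0 U) s')"
  proof (rule prog_For_const[OF row])
    fix I s0 v s s'
    assume Q: "Q' I s0 v s" and a: "nmem s ''a'' [] = v"
      and st: "keep ?M s s' \<and> rmem s' ''val'' [] = rmem s ''val'' [] +
     real (nmem s ''w'' [nmem s ''a'' []]) * worth I (decode I s ''Y'' (nmem s ''a'' []))"
    have eq: "nmem s ''w'' = nmem s0 ''w''" "decode I s ''Y'' = decode I s0 ''Y''"
      using Q decode_keep[of ?N s0 s] keepN[of ?N s0 s] by (simp_all add: Q'_def)
    have "keep ?N s0 s" using Q by (simp add: Q'_def)
    then have "keep ?N s0 s'" using st[THEN conjunct1] by (rule keep_trans) auto
    then show "Q' I s0 (Suc v) (nwrite ''a'' [] (Suc v) s')" using st Q by (simp add: Q'_def keep_nwrite eq a)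
  next
    show "Q' I s 0 (nwrite ''a'' [] 0 s)" for I s by (simp add: Q'_def keep_nwrite)
  qed (simp add: keep_def)
  from prog_append[OF prog_RAssign[of "''val''" "[]" "RNat (NConst 0)"] this]
  show ?thesis unfolding eval_all_def append_Cons append_Nil
  proof (rule prog_weaken, elim exE conjE)
    fix I s s' s1
    assume s1: "s1 = rwrite ''val'' (map (nval I s) []) (rval I s (RNat (NConst 0))) s" and Q: "Q' I s1 (max 0 U) s'"
    have k: "keep ?N s s1" unfolding s1 by (intro keep_rwrite) auto
    moreover have "keep ?N s1 s'" using Q by (simp add: Q'_def)
    ultimately have "keep ?N s s'" by (rule keep_trans) auto
    then show "keep ?N s s' \<and> rmem s' ''val'' [] = (\<Sum>a<U. real (nmem s ''w'' [a]) * worth I (decode I s ''Y'' a))"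
      using Q decode_keep[OF k] by (simp add: Q'_def s1)
  qed
qed

text \<open>\<open>A\<close> tells which cells of \<open>y\<close> are written at a given counter
  value and \<open>V\<close> what is written. Neither may depend on what the loop changes, so the
  iterations do not interact and the written cells simply accumulate.\<close>

lemma prog_For_write:
  assumes P: "prog P (\<lambda>I s s'. keep N s s' \<and>
      (\<forall>is. nmem s' y is = (if A I s (nmem s x []) is then V I s is else nmem s y is)))"
    and y: "y \<in> N" and x: "x \<notin> N"
    and stable: "\<And>I s s'. keep (insert x N) s s' \<Longrightarrow> A I s' = A I s \<and> V I s' = V I s"
    and H: "\<And>I s. nval I s h = H I" "polynomially_bounded H"
  shows "prog (For x lo h P) (\<lambda>I s s'. keep (insert x N) s s' \<and>
    (\<forall>is. nmem s' y is = (if \<exists>u. lo \<le> u \<and> u < H I \<and> A I s u is then V I s is else nmem s y is)))"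
proof -
  define Q where "Q = (\<lambda>(I::msw) s0 v s. keep (insert x N) s0 s \<and>
    (\<forall>is. nmem s y is = (if \<exists>u. lo \<le> u \<and> u < v \<and> A I s0 u is then V I s0 is else nmem s0 y is)))"
  have xy: "x \<noteq> y" "y \<noteq> x" using x y by auto
  have "prog (For x lo h P) (\<lambda>I s s'. Q I s (max lo (H I)) s')"
  proof (rule prog_For[OF P _ H])
    show "nmem s' x [] = nmem s x []" if "keep N s s' \<and>
      (\<forall>is. nmem s' y is = (if A I s (nmem s x []) is then V I s is else nmem s y is))" for I s s'
      using keepN[OF that[THEN conjunct1] x] by simp
    show "Q I s lo (nwrite x [] lo s)" for I s
      using xy by (auto simp: Q_def intro!: keep_nwrite)
    fix I s0 v s s'
    assume v: "lo \<le> v" and Q: "Q I s0 v s" and xv: "nmem s x [] = v" and st: "keep N s s' \<and>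
      (\<forall>is. nmem s' y is = (if A I s (nmem s x []) is then V I s is else nmem s y is))"
    have k0: "keep (insert x N) s0 s" using Q by (simp add: Q_def)
    have AV: "A I s = A I s0" "V I s = V I s0" using stable[OF k0, of I] by auto
    have "keep (insert x N) s0 s'" by (rule keep_trans[OF k0 st[THEN conjunct1]]) auto
    then have k: "keep (insert x N) s0 (nwrite x [] (Suc v) s')" by (rule keep_nwrite) simp
    have "nmem (nwrite x [] (Suc v) s') y is = (if \<exists>u. lo \<le> u \<and> u < Suc v \<and> A I s0 u is then V I s0 is else nmem s0 y is)" for "is"
    proof -
      have "nmem (nwrite x [] (Suc v) s') y is = (if A I s0 v is then V I s0 is else nmem s y is)"
        using st xv xy by (simp add: AV)
      moreover have "nmem s y is = (if \<exists>u. lo \<le> u \<and> u < v \<and> A I s0 u is then V I s0 is else nmem s0 y is)"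
        using Q by (simp add: Q_def)
      moreover have "(\<exists>u. lo \<le> u \<and> u < Suc v \<and> A I s0 u is) \<longleftrightarrow> A I s0 v is \<or> (\<exists>u. lo \<le> u \<and> u < v \<and> A I s0 u is)"
        using v by (auto simp: less_Suc_eq)
      ultimately show ?thesis by (simp only: split: if_split) blast
    qed
    then show "Q I s0 (Suc v) (nwrite x [] (Suc v) s')" unfolding Q_def using k by blast
  qed
  moreover have "(lo \<le> u \<and> u < max lo (H I) \<and> A I s u is) = (lo \<le> u \<and> u < H I \<and> A I s u is)" for I s u "is"
    by auto
  ultimately show ?thesis unfolding Q_def by simp
qed

lemma prog_fill_matrix:
  assumes P: "prog P (\<lambda>I s s'. s' = nwrite y (pre s @ [nmem s ''i'' [], nmem s ''j'' []]) (V I s (pre s @ [nmem s ''i'' [], nmem s ''j'' []])) s)"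
    and y: "y \<notin> {''i'', ''j''}"
    and stable: "\<And>I s s'. keep {''i'', ''j'', y} s s' \<Longrightarrow> pre s' = pre s \<and> V I s' = V I s"
  shows "prog (For_item ''i'' (For_agent ''j'' P)) (\<lambda>I s s'. keep {''i'', ''j'', y} s s' \<and>
    (\<forall>is. nmem s' y is = (if \<exists>i. 1 \<le> i \<and> i < items I + 1 \<and> (\<exists>j. 1 \<le> j \<and> j < agents I + 1 \<and> is = pre s @ [i, j])
       then V I s is else nmem s y is)))"
proof (rule prog_For_write[where A = "\<lambda>I s i is. \<exists>j. 1 \<le> j \<and> j < agents I + 1 \<and> is = pre s @ [i, j]" and V = V,
      OF prog_For_write[where A = "\<lambda>I s j is. is = pre s @ [nmem s ''i'' [], j]" and V = V]])
  show "prog P (\<lambda>I s s'. keep {y} s s' \<and> (\<forall>is. nmem s' y is =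
      (if is = pre s @ [nmem s ''i'' [], nmem s ''j'' []] then V I s is else nmem s y is)))"
    by (rule prog_weaken[OF P]) (simp add: keep_nwrite)
  show "(\<lambda>j is. is = pre s' @ [nmem s' ''i'' [], j]) = (\<lambda>j is. is = pre s @ [nmem s ''i'' [], j]) \<and> V I s' = V I s"
    if k: "keep {''j'', y} s s'" for I s s'
  proof -
    have "keep {''i'', ''j'', y} s s'" by (rule keep_trans[OF keep_refl k]) auto
    moreover have "''i'' \<notin> {''j'', y}" using y by auto
    ultimately show ?thesis using stable keepN[OF k] by simp
  qed
  show "(\<lambda>i is. \<exists>j. 1 \<le> j \<and> j < agents I + 1 \<and> is = pre s' @ [i, j]) = (\<lambda>i is. \<exists>j. 1 \<le> j \<and> j < agents I + 1 \<and> is = pre s @ [i, j]) \<and> V I s' = V I s"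
    if k: "keep {''i'', ''j'', y} s s'" for I s s'
    using stable[OF k] by simp
qed (rule item_bound agent_bound polynomially_bounded_intros(4)[OF polynomially_bounded_intros(2,1)]
  polynomially_bounded_intros(4)[OF polynomially_bounded_intros(3,1)] | use y in \<open>auto; fail\<close>)+

definition fill :: "nat \<Rightarrow> com list \<Rightarrow> com list" where
  "fill U P = For ''a'' 0 (NConst U) (For_item ''i'' (For_agent ''j'' P))"

lemma prog_fill:
  assumes P: "prog P (\<lambda>I s s'. s' = nwrite y [nmem s ''a'' [], nmem s ''i'' [], nmem s ''j'' []]
        (V I s [nmem s ''a'' [], nmem s ''i'' [], nmem s ''j'' []]) s)"
    and y: "y \<notin> {''a'', ''i'', ''j''}"
    and stable: "\<And>I s s'. keep {''a'', ''i'', ''j'', y} s s' \<Longrightarrow> V I s' = V I s"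
  shows "prog (fill U P) (\<lambda>I s s'. keep {''a'', ''i'', ''j'', y} s s' \<and>
    (\<forall>a<U. \<forall>i\<in>{1..items I}. \<forall>j\<in>{1..agents I}. nmem s' y [a, i, j] = V I s [a, i, j]))"
proof -
  let ?A = "\<lambda>I s a is. \<exists>i. 1 \<le> i \<and> i < items I + 1 \<and> (\<exists>j. 1 \<le> j \<and> j < agents I + 1 \<and> is = [a] @ [i, j])"
  have "prog (fill U P) (\<lambda>I s s'. keep {''a'', ''i'', ''j'', y} s s' \<and>
    (\<forall>is. nmem s' y is = (if \<exists>u. 0 \<le> u \<and> u < U \<and> ?A I s u is then V I s is else nmem s y is)))"
    unfolding fill_def
  proof (rule prog_For_write[where A = ?A and V = V, OF prog_fill_matrix[where pre = "\<lambda>s. [nmem s ''a'' []]" and V = V]])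
    show "prog P (\<lambda>I s s'. s' = nwrite y ([nmem s ''a'' []] @ [nmem s ''i'' [], nmem s ''j'' []])
        (V I s ([nmem s ''a'' []] @ [nmem s ''i'' [], nmem s ''j'' []])) s)" using P by simp
    show "[nmem s' ''a'' []] = [nmem s ''a'' []] \<and> V I s' = V I s" if k: "keep {''i'', ''j'', y} s s'" for I s s'
    proof -
      have "keep {''a'', ''i'', ''j'', y} s s'" by (rule keep_trans[OF keep_refl k]) auto
      moreover have "''a'' \<notin> {''i'', ''j'', y}" using y by auto
      ultimately show ?thesis using stable keepN[OF k] by simp
    qed
  qed (use y stable in \<open>auto intro: polynomially_bounded_intros\<close>)
  then show ?thesis
  proof (rule prog_weaken, elim conjE, intro conjI allI ballI impI)
    fix I s s' a i j
    assume *: "\<forall>is. nmem s' y is = (if \<exists>u. 0 \<le> u \<and> u < U \<and> ?A I s u is then V I s is else nmem s y is)"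
      and "a < U" "i \<in> {1..items I}" "j \<in> {1..agents I}"
    then have "\<exists>u. 0 \<le> u \<and> u < U \<and> ?A I s u [a, i, j]"
      by (intro exI[of _ a] exI[of _ i] exI[of _ j] conjI) auto
    then show "nmem s' y [a, i, j] = V I s [a, i, j]" using * by simp
  qed
qed

definition copy :: "nat \<Rightarrow> string \<Rightarrow> string \<Rightarrow> com list" where
  "copy U x y = fill U [NAssign y [scalar ''a'', scalar ''i'', scalar ''j''] (entry x)]"

lemma prog_copy:
  assumes "y \<notin> {''a'', ''i'', ''j''}" "x \<notin> {''a'', ''i'', ''j'', y}"
  shows "prog (copy U x y) (\<lambda>I s s'. keep {''a'', ''i'', ''j'', y} s s' \<and> (\<forall>a<U. decode I s' y a = decode I s x a))"
proof -
  have "prog (copy U x y) (\<lambda>I s s'. keep {''a'', ''i'', ''j'', y} s s' \<and>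
    (\<forall>a<U. \<forall>i\<in>{1..items I}. \<forall>j\<in>{1..agents I}. nmem s' y [a, i, j] = nmem s x [a, i, j]))"
    unfolding copy_def
  proof (rule prog_fill[OF _ assms(1)])
    show "prog [NAssign y [scalar ''a'', scalar ''i'', scalar ''j''] (entry x)]
     (\<lambda>I s s'. s' = nwrite y [nmem s ''a'' [], nmem s ''i'' [], nmem s ''j'' []] (nmem s x [nmem s ''a'' [], nmem s ''i'' [], nmem s ''j'' []]) s)"
      by (rule prog_weaken[OF prog_NAssign]) simp
    show "nmem s' x = nmem s x" if "keep {''a'', ''i'', ''j'', y} s s'" for s s' using keepN[OF that assms(2)] .
  qed
  then show ?thesis by (rule prog_weaken) (auto simp: decode_def)
qed

text \<open>Straight-line code with constants computed when the program is written. Since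
  \<open>U\<close> is constant, arbitrary tables, in particular powers, become available without
  multiplication on natural numbers.\<close>

definition load :: "nat \<Rightarrow> string \<Rightarrow> (nat \<Rightarrow> nat) \<Rightarrow> com list" where
  "load U x f = map (\<lambda>a. NAssign x [NConst a] (NConst (f a))) [0..<U]"

lemma prog_load: "prog (load U x f) (\<lambda>I s s'. keep {x} s s' \<and> (\<forall>a<U. nmem s' x [a] = f a))"
proof (induction U)
  case 0
  show ?case unfolding load_def by (simp, rule prog_weaken[OF prog_Nil]) simp
next
  case (Suc U)
  have "load (Suc U) x f = load U x f @ [NAssign x [NConst U] (NConst (f U))]" by (simp add: load_def)
  then show ?case
    by (simp only:, intro prog_weaken[OF prog_append[OF Suc prog_NAssign]]) (auto simp: less_Suc_eq intro!: keep_nwrite)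
qed

section \<open>Selecting the best modification\<close>

type_synonym family = "nat \<Rightarrow> (nat \<times> nat) set"

definition beq :: "nexp \<Rightarrow> nexp \<Rightarrow> bexp" where
  "beq a b = BAnd (BNot (NLess a b)) (BNot (NLess b a))"

lemma bval_beq [simp]: "bval I s (beq a b) \<longleftrightarrow> nval I s a = nval I s b"
  by (auto simp: beq_def)

text \<open>Writes a modification of \<open>X\<close> to \<open>Y\<close>; the flags in
  \<open>K\<close> select the outcomes that receive the new pair.
  \<open>NLess (NConst 0) (NConst 0)\<close> stands for falsity.\<close>

definition trial :: "nat \<Rightarrow> bool \<Rightarrow> com list" where
  "trial U clr = fill U [Cond (BAnd (BAnd (beq (scalar ''i'') (scalar ''c'')) (beq (scalar ''j'') (scalar ''q'')))
       (NLess (NConst 0) (NVar ''K'' [scalar ''a''])))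
     [NAssign ''Y'' [scalar ''a'', scalar ''i'', scalar ''j''] (NConst 1)]
     [Cond (if clr then beq (scalar ''j'') (scalar ''q'') else NLess (NConst 0) (NConst 0))
       [NAssign ''Y'' [scalar ''a'', scalar ''i'', scalar ''j''] (NConst 0)]
       [NAssign ''Y'' [scalar ''a'', scalar ''i'', scalar ''j''] (entry ''X'')]]]"

text \<open>One form for all moves. With \<open>clr\<close> and \<open>\<kappa>\<close> always true,
  agent \<open>q\<close> is reassigned, as in local search and rounding. Without \<open>clr\<close>,
  and with \<open>\<kappa> a\<close> saying that outcome \<open>a\<close> includes a given block,
  the pair is inserted into that block. With \<open>none\<close>, the agent is removed or nothing
  happens.\<close>

definition modify :: "bool \<Rightarrow> (nat \<Rightarrow> bool) \<Rightarrow> nat \<Rightarrow> nat \<Rightarrow> family \<Rightarrow> family" where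
  "modify clr \<kappa> c q A = (\<lambda>a. (if clr then {e \<in> A a. snd e \<noteq> q} else A a) \<union> (if \<kappa> a then {(c, q)} else {}))"

abbreviation none :: "nat \<Rightarrow> bool" where "none \<equiv> \<lambda>_. False"
abbreviation all :: "nat \<Rightarrow> bool" where "all \<equiv> \<lambda>_. True"

lemma prog_trial:
  "prog (trial U clr) (\<lambda>I s s'. keep {''a'', ''i'', ''j'', ''Y''} s s' \<and>
    (nmem s ''q'' [] \<in> {1..agents I} \<longrightarrow> (nmem s ''c'' [] \<in> {1..items I} \<or> (\<forall>a<U. nmem s ''K'' [a] = 0)) \<longrightarrow>
     (\<forall>a<U. decode I s' ''Y'' a = modify clr (\<lambda>a. nmem s ''K'' [a] \<noteq> 0) (nmem s ''c'' []) (nmem s ''q'' []) (decode I s ''X'') a)))"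
proof -
  define V :: "msw \<Rightarrow> store \<Rightarrow> nat list \<Rightarrow> nat" where "V = (\<lambda>I s is.
    if is ! 1 = nmem s ''c'' [] \<and> is ! 2 = nmem s ''q'' [] \<and> nmem s ''K'' [is ! 0] \<noteq> 0 then 1
    else if clr \<and> is ! 2 = nmem s ''q'' [] then 0 else nmem s ''X'' is)"
  have "prog (trial U clr) (\<lambda>I s s'. keep {''a'', ''i'', ''j'', ''Y''} s s' \<and>
    (\<forall>a<U. \<forall>i\<in>{1..items I}. \<forall>j\<in>{1..agents I}. nmem s' ''Y'' [a, i, j] = V I s [a, i, j]))"
    unfolding trial_def
  proof (rule prog_fill)
    show "prog [Cond (BAnd (BAnd (beq (scalar ''i'') (scalar ''c'')) (beq (scalar ''j'') (scalar ''q'')))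
       (NLess (NConst 0) (NVar ''K'' [scalar ''a''])))
     [NAssign ''Y'' [scalar ''a'', scalar ''i'', scalar ''j''] (NConst 1)]
     [Cond (if clr then beq (scalar ''j'') (scalar ''q'') else NLess (NConst 0) (NConst 0))
       [NAssign ''Y'' [scalar ''a'', scalar ''i'', scalar ''j''] (NConst 0)]
       [NAssign ''Y'' [scalar ''a'', scalar ''i'', scalar ''j''] (entry ''X'')]]]
     (\<lambda>I s s'. s' = nwrite ''Y'' [nmem s ''a'' [], nmem s ''i'' [], nmem s ''j'' []] (V I s [nmem s ''a'' [], nmem s ''i'' [], nmem s ''j'' []]) s)"
      by (rule prog_weaken[OF prog_Cond[OF prog_NAssign prog_Cond[OF prog_NAssign prog_NAssign]]])
        (simp add: V_def split: if_splits)
    show "V I s' = V I s" if k: "keep {''a'', ''i'', ''j'', ''Y''} s s'" for I s s'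
    proof -
      have eq: "nmem s' ''c'' = nmem s ''c''" "nmem s' ''q'' = nmem s ''q''" "nmem s' ''K'' = nmem s ''K''" "nmem s' ''X'' = nmem s ''X''"
        by (simp_all add: keepN[OF k])
      show ?thesis unfolding V_def eq ..
    qed
  qed simp
  then show ?thesis
  proof (rule prog_weaken, elim conjE, intro conjI impI allI)
    fix I :: msw and s s' :: store and a
    assume V: "\<forall>a<U. \<forall>i\<in>{1..items I}. \<forall>j\<in>{1..agents I}. nmem s' ''Y'' [a, i, j] = V I s [a, i, j]"
      and q: "nmem s ''q'' [] \<in> {1..agents I}" and a: "a < U"
      and c: "nmem s ''c'' [] \<in> {1..items I} \<or> (\<forall>a<U. nmem s ''K'' [a] = 0)"
    show "decode I s' ''Y'' a = modify clr (\<lambda>a. nmem s ''K'' [a] \<noteq> 0) (nmem s ''c'' []) (nmem s ''q'' []) (decode I s ''X'') a"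
    proof (rule set_eqI)
      fix e :: "nat \<times> nat"
      obtain i j where e: "e = (i, j)" by (cases e)
      show "e \<in> decode I s' ''Y'' a \<longleftrightarrow> e \<in> modify clr (\<lambda>a. nmem s ''K'' [a] \<noteq> 0) (nmem s ''c'' []) (nmem s ''q'' []) (decode I s ''X'') a"
      proof (cases "i \<in> {1..items I} \<and> j \<in> {1..agents I}")
        case True
        then have "nmem s' ''Y'' [a, i, j] = V I s [a, i, j]" using V a by blast
        then show ?thesis using True by (auto simp: e decode_def modify_def V_def split: if_splits)
      next
        case False
        then show ?thesis using c q a by (auto simp: e decode_def modify_def)
      qed
    qed
  qed
qed

text \<open>The common objective of all phases. Depending on the table in \<open>w\<close> it is the
  value of set number 0, a multiple of \<open>Psi\<close>, or a multiple of the full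
  expectation.\<close>

definition weighted :: "msw \<Rightarrow> nat \<Rightarrow> store \<Rightarrow> family \<Rightarrow> real" where
  "weighted I U s A = (\<Sum>a<U. real (nmem s ''w'' [a]) * worth I (A a))"

lemma weighted_keep: "keep N s s' \<Longrightarrow> ''w'' \<notin> N \<Longrightarrow> weighted I U s' A = weighted I U s A"
  by (simp add: weighted_def keepN)

lemma weighted_cong: "(\<And>a. a < U \<Longrightarrow> A a = B a) \<Longrightarrow> weighted I U s A = weighted I U s B"
  unfolding weighted_def by (intro sum.cong) auto

definition assess :: "nat \<Rightarrow> bool \<Rightarrow> (nat \<Rightarrow> bool) \<Rightarrow> com list" where
  "assess U clr \<kappa> = load U ''K'' (\<lambda>a. of_bool (\<kappa> a)) @ trial U clr @ eval_all U"

definition scratch :: "string set" where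
  "scratch = {''a'', ''i'', ''j'', ''k'', ''Y'', ''K'', ''ld'', ''val'', ''best'', ''B''}"

lemma prog_assess:
  "prog (assess U clr \<kappa>) (\<lambda>I s s'. keep (scratch - {''best'', ''B''}) s s' \<and>
    (nmem s ''q'' [] \<in> {1..agents I} \<longrightarrow> nmem s ''c'' [] \<in> {1..items I} \<or> (\<forall>a<U. \<not> \<kappa> a) \<longrightarrow>
      (\<forall>a<U. decode I s' ''Y'' a = modify clr \<kappa> (nmem s ''c'' []) (nmem s ''q'' []) (decode I s ''X'') a) \<and>
      rmem s' ''val'' [] = weighted I U s (modify clr \<kappa> (nmem s ''c'' []) (nmem s ''q'' []) (decode I s ''X''))))"
  unfolding assess_def
proof (rule prog_weaken[OF prog_append[OF prog_load prog_append[OF prog_trial prog_eval_all]]], elim exE conjE)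
  fix I :: msw and s s' s1 s2 :: store
  assume 1: "keep {''K''} s s1" "\<forall>a<U. nmem s1 ''K'' [a] = of_bool (\<kappa> a)"
    and 2: "keep {''a'', ''i'', ''j'', ''Y''} s1 s2"
      "nmem s1 ''q'' [] \<in> {1..agents I} \<longrightarrow> nmem s1 ''c'' [] \<in> {1..items I} \<or> (\<forall>a<U. nmem s1 ''K'' [a] = 0) \<longrightarrow>
       (\<forall>a<U. decode I s2 ''Y'' a = modify clr (\<lambda>a. nmem s1 ''K'' [a] \<noteq> 0) (nmem s1 ''c'' []) (nmem s1 ''q'' []) (decode I s1 ''X'') a)"
    and 3: "keep {''ld'', ''k'', ''j'', ''i'', ''a'', ''val''} s2 s'"
      "rmem s' ''val'' [] = (\<Sum>a<U. real (nmem s2 ''w'' [a]) * worth I (decode I s2 ''Y'' a))"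
  have k2: "keep {''a'', ''i'', ''j'', ''Y'', ''K''} s s2" by (rule keep_trans[OF 1(1) 2(1)]) auto
  have k3: "keep (scratch - {''best'', ''B''}) s s'" by (rule keep_trans[OF k2 3(1)]) (auto simp: scratch_def)
  let ?C = "modify clr \<kappa> (nmem s ''c'' []) (nmem s ''q'' []) (decode I s ''X'')"
  have "(\<forall>a<U. decode I s' ''Y'' a = ?C a) \<and> rmem s' ''val'' [] = weighted I U s ?C"
    if q: "nmem s ''q'' [] \<in> {1..agents I}" and c: "nmem s ''c'' [] \<in> {1..items I} \<or> (\<forall>a<U. \<not> \<kappa> a)"
  proof -
    have eq: "nmem s1 ''q'' = nmem s ''q''" "nmem s1 ''c'' = nmem s ''c''" "decode I s1 ''X'' = decode I s ''X''"
      "nmem s2 ''w'' = nmem s ''w''" "decode I s' ''Y'' = decode I s2 ''Y''"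
      using keepN[OF 1(1)] keepN[OF k2] decode_keep[OF 1(1)] decode_keep[OF 3(1)] by simp_all
    have "nmem s ''c'' [] \<in> {1..items I} \<or> (\<forall>a<U. nmem s1 ''K'' [a] = 0)" using c 1(2) by auto
    then have Y: "\<forall>a<U. decode I s2 ''Y'' a = modify clr (\<lambda>a. nmem s1 ''K'' [a] \<noteq> 0) (nmem s ''c'' []) (nmem s ''q'' []) (decode I s ''X'') a"
      using 2(2) q by (simp only: eq) blast
    have Y': "decode I s2 ''Y'' a = ?C a" if "a < U" for a using Y that 1(2) by (simp add: modify_def)
    then show ?thesis using 3(2) by (simp add: weighted_def eq)
  qed
  then show "keep (scratch - {''best'', ''B''}) s s' \<and> (nmem s ''q'' [] \<in> {1..agents I} \<longrightarrow>
     nmem s ''c'' [] \<in> {1..items I} \<or> (\<forall>a<U. \<not> \<kappa> a) \<longrightarrow>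
     (\<forall>a<U. decode I s' ''Y'' a = ?C a) \<and> rmem s' ''val'' [] = weighted I U s ?C)"
    using k3 by simp
qed

text \<open>The state of a running maximum search over the candidates tried so far.\<close>

definition best_of :: "msw \<Rightarrow> nat \<Rightarrow> store \<Rightarrow> family set \<Rightarrow> bool" where
  "best_of I U s \<C> \<longleftrightarrow> (\<exists>A\<in>\<C>. rmem s ''best'' [] = weighted I U s A \<and> (\<forall>a<U. decode I s ''B'' a = A a) \<and>
     (\<forall>C\<in>\<C>. weighted I U s C \<le> weighted I U s A))"

lemma best_of_keep:
  assumes "keep N s s'" "''best'' \<notin> N" "''B'' \<notin> N" "''w'' \<notin> N"
  shows "best_of I U s' \<C> = best_of I U s \<C>"
  using assms by (simp add: best_of_def weighted_keep[OF assms(1)] decode_keep[OF assms(1)] keepR[OF assms(1)])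

lemma prog_copy_YB: "prog (copy U ''Y'' ''B'') (\<lambda>I s s'. keep {''a'', ''i'', ''j'', ''B''} s s' \<and> (\<forall>a<U. decode I s' ''B'' a = decode I s ''Y'' a))"
  by (rule prog_copy) simp_all

text \<open>The first candidate inserts no pair, so the item in \<open>c\<close> is immaterial and
  may be out of range; the specification normalizes it to 0.\<close>

definition start :: "nat \<Rightarrow> bool \<Rightarrow> com list" where
  "start U clr = assess U clr none @ [RAssign ''best'' [] (RVar ''val'' [])] @ copy U ''Y'' ''B''"

lemma start_correct:
  fixes I :: msw and s s1 s2 s' :: store
  assumes 1: "keep (scratch - {''best'', ''B''}) s s1"
      "nmem s ''q'' [] \<in> {1..agents I} \<longrightarrow> nmem s ''c'' [] \<in> {1..items I} \<or> (\<forall>a<U. \<not> False) \<longrightarrow>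
        (\<forall>a<U. decode I s1 ''Y'' a = modify clr none (nmem s ''c'' []) (nmem s ''q'' []) (decode I s ''X'') a) \<and>
        rmem s1 ''val'' [] = weighted I U s (modify clr none (nmem s ''c'' []) (nmem s ''q'' []) (decode I s ''X''))"
    and 2: "s2 = rwrite ''best'' (map (nval I s1) []) (rval I s1 (RVar ''val'' [])) s1"
    and 3: "keep {''a'', ''i'', ''j'', ''B''} s2 s'" "\<forall>a<U. decode I s' ''B'' a = decode I s2 ''Y'' a"
  shows "keep scratch s s' \<and> (nmem s ''q'' [] \<in> {1..agents I} \<longrightarrow>
     best_of I U s' {modify clr none 0 (nmem s ''q'' []) (decode I s ''X'')})"
proof -
  let ?D = "modify clr none (nmem s ''c'' []) (nmem s ''q'' []) (decode I s ''X'')"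
  let ?C = "modify clr none 0 (nmem s ''q'' []) (decode I s ''X'')"
  have 2: "s2 = rwrite ''best'' [] (rmem s1 ''val'' []) s1" using 2 by (simp only: rval.simps list.map)
  have C: "?D = ?C" by (simp add: modify_def)
  have "keep scratch s s1" by (rule keep_trans[OF keep_refl 1(1)]) auto
  then have k2: "keep scratch s s2" unfolding 2 by (rule keep_rwrite) (simp add: scratch_def)
  then have k: "keep scratch s s'" using 3(1) by (rule keep_trans) (auto simp: scratch_def)
  have "best_of I U s' {?C}" if "nmem s ''q'' [] \<in> {1..agents I}"
  proof -
    have "nmem s ''c'' [] \<in> {1..items I} \<or> (\<forall>a<U. \<not> False)" by simp
    note * = mp[OF mp[OF 1(2) that] this]
    have Y: "\<forall>a<U. decode I s1 ''Y'' a = ?C a"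
      by (rule back_subst[where P = "\<lambda>A. \<forall>a<U. decode I s1 ''Y'' a = A a", OF conjunct1[OF *] C])
    have val: "rmem s1 ''val'' [] = weighted I U s ?C"
      by (rule back_subst[where P = "\<lambda>A. rmem s1 ''val'' [] = weighted I U s A", OF conjunct2[OF *] C])
    have "rmem s' ''best'' = rmem s2 ''best''" by (rule keepR[OF 3(1)]) simp
    then have b: "rmem s' ''best'' [] = weighted I U s ?C" unfolding 2 val[symmetric] by simp
    have "decode I s2 ''Y'' = decode I s1 ''Y''" unfolding 2 by (rule ext) (simp add: decode_def)
    then have B: "\<forall>a<U. decode I s' ''B'' a = ?C a" using 3(2) Y by simp
    have "weighted I U s' = weighted I U s" using weighted_keep[OF k] by (intro ext) (simp add: scratch_def)
    then show ?thesis unfolding best_of_def using b B by simp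
  qed
  then show ?thesis using k by simp
qed

lemma prog_start:
  "prog (start U clr) (\<lambda>I s s'. keep scratch s s' \<and> (nmem s ''q'' [] \<in> {1..agents I} \<longrightarrow>
     best_of I U s' {modify clr none 0 (nmem s ''q'' []) (decode I s ''X'')}))"
  unfolding start_def
  by (rule prog_weaken[OF prog_append[OF prog_assess prog_append[OF prog_RAssign prog_copy_YB]]], elim exE conjE)
    (rule start_correct; assumption)

definition test :: "nat \<Rightarrow> bool \<Rightarrow> (nat \<Rightarrow> bool) \<Rightarrow> com list" where
  "test U clr \<kappa> = assess U clr \<kappa> @ [Cond (RLess (RVar ''best'' []) (RVar ''val'' []))
     ([RAssign ''best'' [] (RVar ''val'' [])] @ copy U ''Y'' ''B'') []]"

lemma test_correct:
  fixes I :: msw and s s1 s' :: store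
  assumes 1: "keep (scratch - {''best'', ''B''}) s s1"
      "nmem s ''q'' [] \<in> {1..agents I} \<longrightarrow> nmem s ''c'' [] \<in> {1..items I} \<or> (\<forall>a<U. \<not> \<kappa> a) \<longrightarrow>
        (\<forall>a<U. decode I s1 ''Y'' a = modify clr \<kappa> (nmem s ''c'' []) (nmem s ''q'' []) (decode I s ''X'') a) \<and>
        rmem s1 ''val'' [] = weighted I U s (modify clr \<kappa> (nmem s ''c'' []) (nmem s ''q'' []) (decode I s ''X''))"
    and 20: "if bval I s1 (RLess (RVar ''best'' []) (RVar ''val'' [])) then
      \<exists>s2. s2 = rwrite ''best'' (map (nval I s1) []) (rval I s1 (RVar ''val'' [])) s1 \<and>
        keep {''a'', ''i'', ''j'', ''B''} s2 s' \<and> (\<forall>a<U. decode I s' ''B'' a = decode I s2 ''Y'' a)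
      else s' = s1"
  shows "keep scratch s s' \<and>
    (nmem s ''q'' [] \<in> {1..agents I} \<longrightarrow> nmem s ''c'' [] \<in> {1..items I} \<or> (\<forall>a<U. \<not> \<kappa> a) \<longrightarrow>
     (\<forall>\<C>. best_of I U s \<C> \<longrightarrow>
      best_of I U s' (insert (modify clr \<kappa> (nmem s ''c'' []) (nmem s ''q'' []) (decode I s ''X'')) \<C>)))"
proof -
  let ?C = "modify clr \<kappa> (nmem s ''c'' []) (nmem s ''q'' []) (decode I s ''X'')"
  have 2: "if rmem s1 ''best'' [] < rmem s1 ''val'' [] then
      \<exists>s2. s2 = rwrite ''best'' [] (rmem s1 ''val'' []) s1 \<and>
        keep {''a'', ''i'', ''j'', ''B''} s2 s' \<and> (\<forall>a<U. decode I s' ''B'' a = decode I s2 ''Y'' a) else s' = s1"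
    using 20 by (simp only: bval.simps rval.simps list.map)
  have k1: "keep scratch s s1" by (rule keep_trans[OF keep_refl 1(1)]) auto
  have w1: "best_of I U s1 \<C> = best_of I U s \<C>" for \<C> using best_of_keep[OF 1(1)] by (simp add: scratch_def)
  show ?thesis
  proof (cases "rmem s1 ''best'' [] < rmem s1 ''val'' []")
    case True
    then obtain s2 where s2: "s2 = rwrite ''best'' [] (rmem s1 ''val'' []) s1"
      and 3: "keep {''a'', ''i'', ''j'', ''B''} s2 s'" "\<forall>a<U. decode I s' ''B'' a = decode I s2 ''Y'' a"
      using 2 by (simp only: if_True) blast
    have k2: "keep scratch s s2" unfolding s2 using k1 by (rule keep_rwrite) (simp add: scratch_def)
    then have k: "keep scratch s s'" using 3(1) by (rule keep_trans) (auto simp: scratch_def)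
    have t: "weighted I U s' = weighted I U s" using weighted_keep[OF k] by (intro ext) (simp add: scratch_def)
    have t1: "weighted I U s1 = weighted I U s" using weighted_keep[OF k1] by (intro ext) (simp add: scratch_def)
    have "best_of I U s' (insert ?C \<C>)" if q: "nmem s ''q'' [] \<in> {1..agents I}"
      "nmem s ''c'' [] \<in> {1..items I} \<or> (\<forall>a<U. \<not> \<kappa> a)" and b: "best_of I U s \<C>" for \<C>
    proof -
      have C: "\<forall>a<U. decode I s1 ''Y'' a = ?C a" "rmem s1 ''val'' [] = weighted I U s ?C"
        using mp[OF mp[OF 1(2) q(1)] q(2)] by (rule conjunct1, rule conjunct2)
      have "rmem s' ''best'' [] = weighted I U s ?C" using C keepR[OF 3(1), of "''best''"] by (simp add: s2)
      moreover have "decode I s2 ''Y'' = decode I s1 ''Y''" by (rule ext) (simp add: decode_def s2)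
      then have "\<forall>a<U. decode I s' ''B'' a = ?C a" using 3(2) C(1) by simp
      moreover have "weighted I U s D \<le> weighted I U s ?C" if "D \<in> \<C>" for D
      proof -
        have "best_of I U s1 \<C>" using b w1 by simp
        then have "weighted I U s D \<le> rmem s1 ''best'' []" using that unfolding best_of_def t1 by auto
        then show ?thesis using True C(2) by simp
      qed
      ultimately show ?thesis unfolding best_of_def t by (intro bexI[of _ ?C]) auto
    qed
    then show ?thesis using k by blast
  next
    case False
    then have s': "s' = s1" using 2 by simp
    have t1: "weighted I U s1 = weighted I U s" using weighted_keep[OF k1] by (intro ext) (simp add: scratch_def)
    have "best_of I U s' (insert ?C \<C>)" if q: "nmem s ''q'' [] \<in> {1..agents I}"
      "nmem s ''c'' [] \<in> {1..items I} \<or> (\<forall>a<U. \<not> \<kappa> a)" and b: "best_of I U s \<C>" for \<C>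
    proof -
      have C: "rmem s1 ''val'' [] = weighted I U s ?C" using mp[OF mp[OF 1(2) q(1)] q(2)] by (rule conjunct2)
      have "best_of I U s1 \<C>" using b w1 by simp
      then obtain A where "A \<in> \<C>" "rmem s1 ''best'' [] = weighted I U s A" "\<forall>a<U. decode I s1 ''B'' a = A a"
        "\<forall>C\<in>\<C>. weighted I U s C \<le> weighted I U s A" unfolding best_of_def t1 by blast
      then show ?thesis unfolding best_of_def s' t1 using False C by (intro bexI[of _ A]) auto
    qed
    then show ?thesis using k1 s' by blast
  qed
qed

lemma prog_test:
  "prog (test U clr \<kappa>) (\<lambda>I s s'. keep scratch s s' \<and>
    (nmem s ''q'' [] \<in> {1..agents I} \<longrightarrow> nmem s ''c'' [] \<in> {1..items I} \<or> (\<forall>a<U. \<not> \<kappa> a) \<longrightarrow>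
     (\<forall>\<C>. best_of I U s \<C> \<longrightarrow>
      best_of I U s' (insert (modify clr \<kappa> (nmem s ''c'' []) (nmem s ''q'' []) (decode I s ''X'')) \<C>))))"
  unfolding test_def
  by (rule prog_weaken[OF prog_append[OF prog_assess prog_Cond[OF prog_append[OF prog_RAssign prog_copy_YB] prog_Nil]]], elim exE conjE)
    (rule test_correct; assumption)

text \<open>Candidate sets of successive iterations are united. The condition \<open>g\<close>
  carries the range information under which an iteration is meaningful.\<close>

lemma prog_For_best:
  assumes P: "prog P (\<lambda>I s s'. keep N s s' \<and> (g I s (nmem s x []) \<longrightarrow>
      (\<forall>\<C>. best_of I U s \<C> \<longrightarrow> best_of I U s' (\<C> \<union> D I s (nmem s x [])))))"
    and x: "x \<notin> N" "x \<notin> {''best'', ''B'', ''w''}"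
    and stable: "\<And>I s s'. keep (insert x N) s s' \<Longrightarrow> g I s' = g I s \<and> D I s' = D I s"
    and H: "\<And>I s. nval I s h = H I" "polynomially_bounded H"
  shows "prog (For x lo h P) (\<lambda>I s s'. keep (insert x N) s s' \<and> ((\<forall>u. lo \<le> u \<longrightarrow> u < H I \<longrightarrow> g I s u) \<longrightarrow>
      (\<forall>\<C>. best_of I U s \<C> \<longrightarrow> best_of I U s' (\<C> \<union> (\<Union>u\<in>{lo..<H I}. D I s u)))))"
proof -
  define Q where "Q = (\<lambda>(I::msw) s0 v s. keep (insert x N) s0 s \<and> (v \<le> max lo (H I) \<longrightarrow> (\<forall>u. lo \<le> u \<longrightarrow> u < H I \<longrightarrow> g I s0 u) \<longrightarrow>
      (\<forall>\<C>. best_of I U s0 \<C> \<longrightarrow> best_of I U s (\<C> \<union> (\<Union>u\<in>{lo..<v}. D I s0 u)))))"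
  have wr: "best_of I U (nwrite x [] v s) \<C> = best_of I U s \<C>" for I v s \<C>
    by (rule best_of_keep[where N = "{x}"]) (use x in \<open>auto intro: keep_nwrite\<close>)
  have "prog (For x lo h P) (\<lambda>I s s'. Q I s (max lo (H I)) s')"
  proof (rule prog_For[OF P _ H])
    fix I :: msw and s s' :: store
    assume st: "keep N s s' \<and> (g I s (nmem s x []) \<longrightarrow>
      (\<forall>\<C>. best_of I U s \<C> \<longrightarrow> best_of I U s' (\<C> \<union> D I s (nmem s x []))))"
    show "nmem s' x [] = nmem s x []" using keepN[OF st[THEN conjunct1] x(1)] by simp
    fix s0 v
    assume v: "lo \<le> v" "v < H I" and Q: "Q I s0 v s" and xv: "nmem s x [] = v"
    have k0: "keep (insert x N) s0 s" using Q by (simp add: Q_def)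
    have eq: "g I s = g I s0" "D I s = D I s0" using stable[OF k0] by auto
    have "keep (insert x N) s0 s'" by (rule keep_trans[OF k0 st[THEN conjunct1]]) auto
    then have k: "keep (insert x N) s0 (nwrite x [] (Suc v) s')" by (rule keep_nwrite) simp
    have "best_of I U s' (\<C> \<union> (\<Union>u\<in>{lo..<Suc v}. D I s0 u))"
      if g: "\<forall>u. lo \<le> u \<longrightarrow> u < H I \<longrightarrow> g I s0 u" and b: "best_of I U s0 \<C>" for \<C>
    proof -
      have "best_of I U s (\<C> \<union> (\<Union>u\<in>{lo..<v}. D I s0 u))" using Q v g b by (simp add: Q_def)
      then have "best_of I U s' ((\<C> \<union> (\<Union>u\<in>{lo..<v}. D I s0 u)) \<union> D I s0 v)" using st g v by (simp add: eq xv)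
      moreover have "(\<C> \<union> (\<Union>u\<in>{lo..<v}. D I s0 u)) \<union> D I s0 v = \<C> \<union> (\<Union>u\<in>{lo..<Suc v}. D I s0 u)"
        using v by (auto simp: less_Suc_eq)
      ultimately show ?thesis by simp
    qed
    then show "Q I s0 (Suc v) (nwrite x [] (Suc v) s')" unfolding Q_def wr using k by simp
  next
    show "Q I s lo (nwrite x [] lo s)" for I :: msw and s :: store
      unfolding Q_def wr by (simp add: keep_nwrite)
  qed
  then show ?thesis
    by (rule prog_weaken) (auto simp: Q_def max_def split: if_splits)
qed

lemma scratch_simps [simp]: "''X'' \<notin> scratch" "''c'' \<notin> scratch" "''q'' \<notin> scratch" "''S'' \<notin> scratch" "''w'' \<notin> scratch"
  "''cur'' \<notin> scratch" "''r'' \<notin> scratch" "''u'' \<notin> scratch" "''zval'' \<notin> scratch"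
  by (simp_all add: scratch_def)

lemma modify_none: "modify clr none c q A = modify clr none c' q A"
  by (simp add: modify_def)

lemma prog_tests:
  "prog (concat (map (test U clr) \<kappa>s)) (\<lambda>I s s'. keep scratch s s' \<and>
    (nmem s ''q'' [] \<in> {1..agents I} \<longrightarrow> nmem s ''c'' [] \<in> {1..items I} \<longrightarrow> (\<forall>\<C>. best_of I U s \<C> \<longrightarrow>
      best_of I U s' (\<C> \<union> (\<lambda>\<kappa>. modify clr \<kappa> (nmem s ''c'' []) (nmem s ''q'' []) (decode I s ''X'')) ` set \<kappa>s))))"
proof (induction \<kappa>s)
  case Nil
  show ?case by (simp, rule prog_weaken[OF prog_Nil]) simp
next
  case (Cons \<kappa> \<kappa>s)
  show ?case unfolding list.map concat.simps
  proof (rule prog_weaken[OF prog_append[OF prog_test Cons]], elim exE conjE, intro conjI impI allI)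
    fix I :: msw and s s' s1 :: store and \<C>
    assume k1: "keep scratch s s1" and k2: "keep scratch s1 s'"
    show "keep scratch s s'" by (rule keep_trans[OF k1 k2]) auto
    have eq: "nmem s1 ''q'' = nmem s ''q''" "nmem s1 ''c'' = nmem s ''c''" "decode I s1 ''X'' = decode I s ''X''"
      using keepN[OF k1] decode_keep[OF k1] by simp_all
    let ?f = "\<lambda>\<kappa>. modify clr \<kappa> (nmem s ''c'' []) (nmem s ''q'' []) (decode I s ''X'')"
    assume q: "nmem s ''q'' [] \<in> {1..agents I}" and c: "nmem s ''c'' [] \<in> {1..items I}" and b: "best_of I U s \<C>"
      and 1: "nmem s ''q'' [] \<in> {1..agents I} \<longrightarrow> nmem s ''c'' [] \<in> {1..items I} \<or> (\<forall>a<U. \<not> \<kappa> a) \<longrightarrow>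
        (\<forall>\<C>. best_of I U s \<C> \<longrightarrow> best_of I U s1 (insert (?f \<kappa>) \<C>))"
      and 2: "nmem s1 ''q'' [] \<in> {1..agents I} \<longrightarrow> nmem s1 ''c'' [] \<in> {1..items I} \<longrightarrow> (\<forall>\<C>. best_of I U s1 \<C> \<longrightarrow>
        best_of I U s' (\<C> \<union> (\<lambda>\<kappa>. modify clr \<kappa> (nmem s1 ''c'' []) (nmem s1 ''q'' []) (decode I s1 ''X'')) ` set \<kappa>s))"
    have "best_of I U s1 (insert (?f \<kappa>) \<C>)" using 1 q c b by simp
    then have "best_of I U s' (insert (?f \<kappa>) \<C> \<union> ?f ` set \<kappa>s)"
      by (rule mp[OF mp[OF 2[unfolded eq] q] c, rule_format])
    then show "best_of I U s' (\<C> \<union> ?f ` set (\<kappa> # \<kappa>s))" by (simp add: insert_commute Un_insert_right)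
  qed
qed

text \<open>The guard \<open>gd\<close> skips pairs recorded in \<open>S\<close>. During the greedy
  rounds \<open>S\<close> contains the local optimum, so this is how the early rounds avoid
  it.\<close>

definition optimize :: "nat \<Rightarrow> bool \<Rightarrow> bool \<Rightarrow> (nat \<Rightarrow> bool) list \<Rightarrow> com list" where
  "optimize U clr gd \<kappa>s = start U clr @
     For_item ''c'' [Cond (if gd then NLess (NConst 0) (NVar ''S'' [scalar ''c'', scalar ''q'']) else NLess (NConst 0) (NConst 0))
       [] (concat (map (test U clr) \<kappa>s))] @ copy U ''B'' ''X''"

definition choices :: "msw \<Rightarrow> store \<Rightarrow> bool \<Rightarrow> bool \<Rightarrow> (nat \<Rightarrow> bool) list \<Rightarrow> nat \<Rightarrow> family \<Rightarrow> family set" where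
  "choices I s clr gd \<kappa>s q A = {modify clr none 0 q A} \<union>
     (\<Union>c\<in>{1..<items I + 1}. if gd \<and> nmem s ''S'' [c, q] \<noteq> 0 then {} else (\<lambda>\<kappa>. modify clr \<kappa> c q A) ` set \<kappa>s)"

lemma choices_iff:
  "C \<in> choices I s clr gd \<kappa>s q A \<longleftrightarrow> C = modify clr none 0 q A \<or>
     (\<exists>c\<in>{1..items I}. (gd \<longrightarrow> nmem s ''S'' [c, q] = 0) \<and> (\<exists>\<kappa>\<in>set \<kappa>s. C = modify clr \<kappa> c q A))"
proof -
  have "{1..<items I + 1} = {1..items I}" by auto
  then show ?thesis unfolding choices_def by (simp only: Un_iff UN_iff singleton_iff image_iff if_split empty_iff) auto
qed

lemma prog_copy_BX: "prog (copy U ''B'' ''X'') (\<lambda>I s s'. keep {''a'', ''i'', ''j'', ''X''} s s' \<and> (\<forall>a<U. decode I s' ''X'' a = decode I s ''B'' a))"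
  by (rule prog_copy) simp_all

lemma prog_optimize:
  "prog (optimize U clr gd \<kappa>s) (\<lambda>I s s'. keep (scratch \<union> {''c'', ''X''}) s s' \<and>
    (nmem s ''q'' [] \<in> {1..agents I} \<longrightarrow>
      (\<exists>A\<in>choices I s clr gd \<kappa>s (nmem s ''q'' []) (decode I s ''X''). (\<forall>a<U. decode I s' ''X'' a = A a) \<and>
        (\<forall>C\<in>choices I s clr gd \<kappa>s (nmem s ''q'' []) (decode I s ''X''). weighted I U s C \<le> weighted I U s A))))"
proof -
  let ?D = "\<lambda>I s c. if gd \<and> nmem s ''S'' [c, nmem s ''q'' []] \<noteq> 0 then {} else
     (\<lambda>\<kappa>. modify clr \<kappa> c (nmem s ''q'' []) (decode I s ''X'')) ` set \<kappa>s"
  let ?b = "if gd then NLess (NConst 0) (NVar ''S'' [scalar ''c'', scalar ''q'']) else NLess (NConst 0) (NConst 0)"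
  have loop: "prog (For_item ''c'' [Cond ?b [] (concat (map (test U clr) \<kappa>s))])
     (\<lambda>I s s'. keep (insert ''c'' scratch) s s' \<and> ((\<forall>u. 1 \<le> u \<longrightarrow> u < items I + 1 \<longrightarrow> nmem s ''q'' [] \<in> {1..agents I} \<and> u \<in> {1..items I}) \<longrightarrow>
      (\<forall>\<C>. best_of I U s \<C> \<longrightarrow> best_of I U s' (\<C> \<union> (\<Union>u\<in>{1..<items I + 1}. ?D I s u)))))"
  proof (rule prog_For_best[OF _ _ _ _ item_bound polynomially_bounded_intros(4)[OF polynomially_bounded_intros(3,1)],
        where g = "\<lambda>I s u. nmem s ''q'' [] \<in> {1..agents I} \<and> u \<in> {1..items I}" and D = ?D])
    show "prog [Cond ?b [] (concat (map (test U clr) \<kappa>s))] (\<lambda>I s s'. keep scratch s s' \<and>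
      (nmem s ''q'' [] \<in> {1..agents I} \<and> nmem s ''c'' [] \<in> {1..items I} \<longrightarrow>
       (\<forall>\<C>. best_of I U s \<C> \<longrightarrow> best_of I U s' (\<C> \<union> ?D I s (nmem s ''c'' [])))))"
    proof (rule prog_weaken[OF prog_Cond[OF prog_Nil prog_tests]])
      fix I :: msw and s s' :: store
      assume *: "if bval I s ?b then s' = s else keep scratch s s' \<and>
        (nmem s ''q'' [] \<in> {1..agents I} \<longrightarrow> nmem s ''c'' [] \<in> {1..items I} \<longrightarrow> (\<forall>\<C>. best_of I U s \<C> \<longrightarrow>
          best_of I U s' (\<C> \<union> (\<lambda>\<kappa>. modify clr \<kappa> (nmem s ''c'' []) (nmem s ''q'' []) (decode I s ''X'')) ` set \<kappa>s)))"
      show "keep scratch s s' \<and> (nmem s ''q'' [] \<in> {1..agents I} \<and> nmem s ''c'' [] \<in> {1..items I} \<longrightarrow>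
       (\<forall>\<C>. best_of I U s \<C> \<longrightarrow> best_of I U s' (\<C> \<union> ?D I s (nmem s ''c'' []))))"
      proof (cases "gd \<and> nmem s ''S'' [nmem s ''c'' [], nmem s ''q'' []] \<noteq> 0")
        case True
        then have "s' = s" using * by simp
        then show ?thesis using True by simp
      next
        case False
        then have "\<not> bval I s ?b" by auto
        then show ?thesis using * False by (simp only: if_False) simp
      qed
    qed
    show "(\<lambda>u. nmem s' ''q'' [] \<in> {1..agents I} \<and> u \<in> {1..items I}) = (\<lambda>u. nmem s ''q'' [] \<in> {1..agents I} \<and> u \<in> {1..items I}) \<and>
      ?D I s' = ?D I s" if k: "keep (insert ''c'' scratch) s s'" for I s s'
    proof -
      have eq: "nmem s' ''q'' = nmem s ''q''" "nmem s' ''S'' = nmem s ''S''" "decode I s' ''X'' = decode I s ''X''"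
        using keepN[OF k] decode_keep[OF k] by simp_all
      show ?thesis unfolding eq by simp
    qed
  qed simp_all
  show ?thesis unfolding optimize_def
  proof (rule prog_weaken[OF prog_append[OF prog_start prog_append[OF loop prog_copy_BX]]], elim exE conjE, intro conjI impI)
    fix I :: msw and s s1 s2 s' :: store
    assume k1: "keep scratch s s1" and k2: "keep (insert ''c'' scratch) s1 s2" and k3: "keep {''a'', ''i'', ''j'', ''X''} s2 s'"
    have k12: "keep (insert ''c'' scratch) s s2" by (rule keep_trans[OF k1 k2]) auto
    show "keep (scratch \<union> {''c'', ''X''}) s s'" by (rule keep_trans[OF k12 k3]) (auto simp: scratch_def)
    assume X: "\<forall>a<U. decode I s' ''X'' a = decode I s2 ''B'' a" and q: "nmem s ''q'' [] \<in> {1..agents I}"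
      and 1: "nmem s ''q'' [] \<in> {1..agents I} \<longrightarrow> best_of I U s1 {modify clr none 0 (nmem s ''q'' []) (decode I s ''X'')}"
      and 2: "(\<forall>u. 1 \<le> u \<longrightarrow> u < items I + 1 \<longrightarrow> nmem s1 ''q'' [] \<in> {1..agents I} \<and> u \<in> {1..items I}) \<longrightarrow>
      (\<forall>\<C>. best_of I U s1 \<C> \<longrightarrow> best_of I U s2 (\<C> \<union> (\<Union>u\<in>{1..<items I + 1}. ?D I s1 u)))"
    have eq: "nmem s1 ''q'' = nmem s ''q''" "nmem s1 ''S'' = nmem s ''S''" "decode I s1 ''X'' = decode I s ''X''"
      using keepN[OF k1] decode_keep[OF k1] by simp_all
    let ?q = "nmem s ''q'' []" and ?X = "decode I s ''X''"
    have "\<forall>u. 1 \<le> u \<longrightarrow> u < items I + 1 \<longrightarrow> nmem s1 ''q'' [] \<in> {1..agents I} \<and> u \<in> {1..items I}"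
      using q by (simp add: eq)
    then have "best_of I U s2 ({modify clr none 0 ?q ?X} \<union> (\<Union>u\<in>{1..<items I + 1}. ?D I s1 u))"
      using 2 1 q by blast
    moreover have "{modify clr none 0 ?q ?X} \<union> (\<Union>u\<in>{1..<items I + 1}. ?D I s1 u) = choices I s clr gd \<kappa>s ?q ?X"
      unfolding choices_def eq ..
    ultimately have b: "best_of I U s2 (choices I s clr gd \<kappa>s ?q ?X)" by simp
    have "weighted I U s2 = weighted I U s" using weighted_keep[OF k12] by (intro ext) simp
    then show "\<exists>A\<in>choices I s clr gd \<kappa>s ?q ?X. (\<forall>a<U. decode I s' ''X'' a = A a) \<and>
        (\<forall>C\<in>choices I s clr gd \<kappa>s ?q ?X. weighted I U s C \<le> weighted I U s A)"
    proof -
      assume w: "weighted I U s2 = weighted I U s"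
      from b obtain A where "A \<in> choices I s clr gd \<kappa>s ?q ?X" "\<forall>a<U. decode I s2 ''B'' a = A a"
        "\<forall>C\<in>choices I s clr gd \<kappa>s ?q ?X. weighted I U s C \<le> weighted I U s A" unfolding best_of_def w by blast
      then show ?thesis using X by (intro bexI[of _ A]) simp_all
    qed
  qed
qed

text \<open>The unmodified \<open>X\<close> is the first candidate and its value goes to
  \<open>cur\<close>. The best move is accepted only if its gain exceeds
  \<open>cur / (p * n)\<close>; the test is cleared of denominators and multiplies reals, as natural
  numbers cannot be multiplied.\<close>

definition local_step :: "nat \<Rightarrow> nat \<Rightarrow> com list" where
  "local_step U p = NAssign ''q'' [] (NConst 1) # start U False @ RAssign ''cur'' [] (RVar ''best'' []) #
     For_agent ''q'' (test U True none @ For_item ''c'' (test U True all)) @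
     [Cond (RLess (RVar ''cur'' []) (RMul (RSub (RVar ''best'' []) (RVar ''cur'' [])) (RMul (RNat (NConst p)) (RNat NAgents))))
       (copy U ''B'' ''X'') []]"

definition moves :: "msw \<Rightarrow> family \<Rightarrow> family set" where
  "moves I A = (\<Union>q\<in>{1..<agents I + 1}. {modify True none 0 q A} \<union> (\<Union>c\<in>{1..<items I + 1}. {modify True all c q A}))"

lemma prog_local_moves:
  "prog (For_agent ''q'' (test U True none @ For_item ''c'' (test U True all))) (\<lambda>I s s'.
     keep (scratch \<union> {''c'', ''q''}) s s' \<and>
     (\<forall>\<C>. best_of I U s \<C> \<longrightarrow> best_of I U s' (\<C> \<union> moves I (decode I s ''X''))))"
proof -
  let ?D = "\<lambda>I s c. {modify True all c (nmem s ''q'' []) (decode I s ''X'')}"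
  have inner: "prog (For_item ''c'' (test U True all))
     (\<lambda>I s s'. keep (insert ''c'' scratch) s s' \<and> ((\<forall>u. 1 \<le> u \<longrightarrow> u < items I + 1 \<longrightarrow> nmem s ''q'' [] \<in> {1..agents I} \<and> u \<in> {1..items I}) \<longrightarrow>
      (\<forall>\<C>. best_of I U s \<C> \<longrightarrow> best_of I U s' (\<C> \<union> (\<Union>u\<in>{1..<items I + 1}. ?D I s u)))))"
  proof (rule prog_For_best[OF _ _ _ _ item_bound polynomially_bounded_intros(4)[OF polynomially_bounded_intros(3,1)],
        where g = "\<lambda>I s u. nmem s ''q'' [] \<in> {1..agents I} \<and> u \<in> {1..items I}" and D = ?D])
    show "prog (test U True all) (\<lambda>I s s'. keep scratch s s' \<and>
      (nmem s ''q'' [] \<in> {1..agents I} \<and> nmem s ''c'' [] \<in> {1..items I} \<longrightarrow>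
       (\<forall>\<C>. best_of I U s \<C> \<longrightarrow> best_of I U s' (\<C> \<union> ?D I s (nmem s ''c'' [])))))"
      by (rule prog_weaken[OF prog_test]) simp
    show "(\<lambda>u. nmem s' ''q'' [] \<in> {1..agents I} \<and> u \<in> {1..items I}) = (\<lambda>u. nmem s ''q'' [] \<in> {1..agents I} \<and> u \<in> {1..items I}) \<and>
      ?D I s' = ?D I s" if k: "keep (insert ''c'' scratch) s s'" for I s s'
    proof -
      have eq: "nmem s' ''q'' = nmem s ''q''" "decode I s' ''X'' = decode I s ''X''"
        using keepN[OF k] decode_keep[OF k] by simp_all
      show ?thesis unfolding eq by simp
    qed
  qed simp_all
  let ?E = "\<lambda>I s q. {modify True none 0 q (decode I s ''X'')} \<union> (\<Union>c\<in>{1..<items I + 1}. {modify True all c q (decode I s ''X'')})"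
  have "prog (For_agent ''q'' (test U True none @ For_item ''c'' (test U True all)))
     (\<lambda>I s s'. keep (insert ''q'' (insert ''c'' scratch)) s s' \<and> ((\<forall>u. 1 \<le> u \<longrightarrow> u < agents I + 1 \<longrightarrow> u \<in> {1..agents I}) \<longrightarrow>
      (\<forall>\<C>. best_of I U s \<C> \<longrightarrow> best_of I U s' (\<C> \<union> (\<Union>u\<in>{1..<agents I + 1}. ?E I s u)))))"
  proof (rule prog_For_best[OF _ _ _ _ agent_bound polynomially_bounded_intros(4)[OF polynomially_bounded_intros(2,1)],
        where g = "\<lambda>I s u. u \<in> {1..agents I}" and D = ?E])
    show "prog (test U True none @ For_item ''c'' (test U True all)) (\<lambda>I s s'. keep (insert ''c'' scratch) s s' \<and>
      (nmem s ''q'' [] \<in> {1..agents I} \<longrightarrow>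
       (\<forall>\<C>. best_of I U s \<C> \<longrightarrow> best_of I U s' (\<C> \<union> ?E I s (nmem s ''q'' [])))))"
    proof (rule prog_weaken[OF prog_append[OF prog_test inner]], elim exE conjE, intro conjI impI allI)
      fix I :: msw and s s1 s' :: store and \<C>
      assume k1: "keep scratch s s1" and k2: "keep (insert ''c'' scratch) s1 s'"
      show "keep (insert ''c'' scratch) s s'" by (rule keep_trans[OF k1 k2]) auto
      have eq: "nmem s1 ''q'' = nmem s ''q''" "decode I s1 ''X'' = decode I s ''X''"
        using keepN[OF k1] decode_keep[OF k1] by simp_all
      let ?q = "nmem s ''q'' []" and ?X = "decode I s ''X''"
      assume q: "?q \<in> {1..agents I}" and b: "best_of I U s \<C>"
        and 1: "?q \<in> {1..agents I} \<longrightarrow> nmem s ''c'' [] \<in> {1..items I} \<or> (\<forall>a<U. \<not> False) \<longrightarrow>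
          (\<forall>\<C>. best_of I U s \<C> \<longrightarrow> best_of I U s1 (insert (modify True none (nmem s ''c'' []) ?q ?X) \<C>))"
        and 2: "(\<forall>u. 1 \<le> u \<longrightarrow> u < items I + 1 \<longrightarrow> nmem s1 ''q'' [] \<in> {1..agents I} \<and> u \<in> {1..items I}) \<longrightarrow>
          (\<forall>\<C>. best_of I U s1 \<C> \<longrightarrow> best_of I U s' (\<C> \<union> (\<Union>u\<in>{1..<items I + 1}. ?D I s1 u)))"
      have "nmem s ''c'' [] \<in> {1..items I} \<or> (\<forall>a<U. \<not> False)" by simp
      from mp[OF mp[OF 1 q] this, rule_format, OF b]
      have b1: "best_of I U s1 (insert (modify True none 0 ?q ?X) \<C>)" unfolding modify_none[of _ "nmem s ''c'' []" _ _ 0] .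
      have "\<forall>u. 1 \<le> u \<longrightarrow> u < items I + 1 \<longrightarrow> nmem s1 ''q'' [] \<in> {1..agents I} \<and> u \<in> {1..items I}"
        using q by (simp add: eq)
      from mp[OF 2 this, rule_format, OF b1]
      have "best_of I U s' (insert (modify True none 0 ?q ?X) \<C> \<union> (\<Union>u\<in>{1..<items I + 1}. {modify True all u ?q ?X}))"
        unfolding eq .
      moreover have "insert (modify True none 0 ?q ?X) \<C> \<union> (\<Union>u\<in>{1..<items I + 1}. {modify True all u ?q ?X}) = \<C> \<union> ?E I s ?q"
        by blast
      ultimately show "best_of I U s' (\<C> \<union> ?E I s ?q)" by (simp only:)
    qed
    show "(\<lambda>u. u \<in> {1..agents I}) = (\<lambda>u. u \<in> {1..agents I}) \<and> ?E I s' = ?E I s"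
      if k: "keep (insert ''q'' (insert ''c'' scratch)) s s'" for I s s'
    proof -
      have eq: "decode I s' ''X'' = decode I s ''X''" using decode_keep[OF k] by simp
      show ?thesis unfolding eq by simp
    qed
  qed simp_all
  then show ?thesis
  proof (rule prog_weaken, elim conjE, intro conjI)
    fix I :: msw and s s' :: store
    assume k: "keep (insert ''q'' (insert ''c'' scratch)) s s'"
    show "keep (scratch \<union> {''c'', ''q''}) s s'" by (rule keep_trans[OF keep_refl k]) auto
    assume *: "(\<forall>u. 1 \<le> u \<longrightarrow> u < agents I + 1 \<longrightarrow> u \<in> {1..agents I}) \<longrightarrow>
      (\<forall>\<C>. best_of I U s \<C> \<longrightarrow> best_of I U s' (\<C> \<union> (\<Union>u\<in>{1..<agents I + 1}. ?E I s u)))"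
    have "\<forall>u. 1 \<le> u \<longrightarrow> u < agents I + 1 \<longrightarrow> u \<in> {1..agents I}" by simp
    from mp[OF * this] show "\<forall>\<C>. best_of I U s \<C> \<longrightarrow> best_of I U s' (\<C> \<union> moves I (decode I s ''X''))"
      unfolding moves_def .
  qed
qed

definition local_search_step :: "msw \<Rightarrow> nat \<Rightarrow> nat \<Rightarrow> store \<Rightarrow> family \<Rightarrow> family \<Rightarrow> bool" where
  "local_search_step I U p s X X' \<longleftrightarrow> (\<exists>M\<in>insert X (moves I X). (\<forall>C\<in>insert X (moves I X). weighted I U s C \<le> weighted I U s M) \<and>
     (if weighted I U s X < (weighted I U s M - weighted I U s X) * (real p * real (agents I))
      then \<forall>a<U. X' a = M a else \<forall>a<U. X' a = X a))"

definition local_vars :: "string set" where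
  "local_vars = scratch \<union> {''c'', ''q'', ''X'', ''cur''}"

lemma prog_local_step:
  "prog (local_step U p) (\<lambda>I s s'. keep local_vars s s' \<and>
     (agents I \<ge> 1 \<longrightarrow> local_search_step I U p s (decode I s ''X'') (decode I s' ''X'')))"
  unfolding local_step_def
proof -
  let ?b = "RLess (RVar ''cur'' []) (RMul (RSub (RVar ''best'' []) (RVar ''cur'' [])) (RMul (RNat (NConst p)) (RNat NAgents)))"
  let ?R = "\<lambda>(I::msw) s s'. keep local_vars s s' \<and>
     (agents I \<ge> 1 \<longrightarrow> local_search_step I U p s (decode I s ''X'') (decode I s' ''X''))"
  have "prog ([NAssign ''q'' [] (NConst 1)] @ start U False @ [RAssign ''cur'' [] (RVar ''best'' [])] @
     For_agent ''q'' (test U True none @ For_item ''c'' (test U True all)) @ [Cond ?b (copy U ''B'' ''X'') []]) ?R"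
  proof (rule prog_weaken[OF prog_append[OF prog_NAssign prog_append[OF prog_start prog_append[OF prog_RAssign
            prog_append[OF prog_local_moves prog_Cond[OF prog_copy_BX prog_Nil]]]]]], elim exE conjE)
    fix I :: msw and s s1 s2 s3 s4 s' :: store
    assume s1: "s1 = nwrite ''q'' (map (nval I s) []) (nval I s (NConst 1)) s"
      and k2: "keep scratch s1 s2" and b2: "nmem s1 ''q'' [] \<in> {1..agents I} \<longrightarrow>
        best_of I U s2 {modify False none 0 (nmem s1 ''q'' []) (decode I s1 ''X'')}"
      and s3: "s3 = rwrite ''cur'' (map (nval I s2) []) (rval I s2 (RVar ''best'' [])) s2"
      and k4: "keep (scratch \<union> {''c'', ''q''}) s3 s4"
      and b4: "\<forall>\<C>. best_of I U s3 \<C> \<longrightarrow> best_of I U s4 (\<C> \<union> moves I (decode I s3 ''X''))"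
      and s': "if bval I s4 ?b then keep {''a'', ''i'', ''j'', ''X''} s4 s' \<and> (\<forall>a<U. decode I s' ''X'' a = decode I s4 ''B'' a) else s' = s4"
    let ?N = "scratch \<union> {''c'', ''q'', ''cur''}"
    have k01: "keep ?N s s1" unfolding s1 by (rule keep_nwrite) auto
    have k02: "keep ?N s s2" by (rule keep_trans[OF k01 k2]) auto
    have k03: "keep ?N s s3" unfolding s3 using k02 by (rule keep_rwrite) auto
    have k04: "keep ?N s s4" by (rule keep_trans[OF k03 k4]) auto
    have "keep {''a'', ''i'', ''j'', ''X''} s4 s'" using s' by (simp split: if_splits)
    then have k: "keep local_vars s s'" by (rule keep_trans[OF k04]) (auto simp: local_vars_def scratch_def)
    have w: "weighted I U s2 = weighted I U s" "weighted I U s4 = weighted I U s"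
      using weighted_keep[OF k02] weighted_keep[OF k04] by (auto intro!: ext)
    let ?X = "decode I s ''X''"
    have X: "decode I s1 ''X'' = ?X" "decode I s3 ''X'' = ?X" "decode I s4 ''X'' = ?X"
      using decode_keep[OF k01] decode_keep[OF k03] decode_keep[OF k04] by simp_all
    have "local_search_step I U p s ?X (decode I s' ''X'')" if n: "agents I \<ge> 1"
    proof -
      have "modify False none 0 (nmem s1 ''q'' []) ?X = ?X" by (simp add: modify_def)
      moreover have "nmem s1 ''q'' [] \<in> {1..agents I}" using n by (simp add: s1)
      ultimately have b: "best_of I U s2 {?X}" using b2 unfolding X by simp
      then have best2: "rmem s2 ''best'' [] = weighted I U s ?X" unfolding best_of_def w by simp
      have k23: "keep {''cur''} s2 s3" unfolding s3 by (rule keep_rwrite) auto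
      have "best_of I U s3 {?X}" using b best_of_keep[OF k23] by simp
      then have "best_of I U s4 ({?X} \<union> moves I ?X)" using b4[rule_format] unfolding X by blast
      then have "best_of I U s4 (insert ?X (moves I ?X))" by (simp only: insert_is_Un[symmetric])
      then obtain M where M: "M \<in> insert ?X (moves I ?X)" "rmem s4 ''best'' [] = weighted I U s M"
        "\<forall>a<U. decode I s4 ''B'' a = M a" "\<forall>C\<in>insert ?X (moves I ?X). weighted I U s C \<le> weighted I U s M"
        unfolding best_of_def w by blast
      have "rmem s4 ''cur'' = rmem s3 ''cur''" using keepR[OF k4] by simp
      then have cur: "rmem s4 ''cur'' [] = weighted I U s ?X" by (simp add: s3 best2)
      have "bval I s4 ?b \<longleftrightarrow> weighted I U s ?X < (weighted I U s M - weighted I U s ?X) * (real p * real (agents I))"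
        by (simp add: cur M(2))
      then have "if weighted I U s ?X < (weighted I U s M - weighted I U s ?X) * (real p * real (agents I))
        then \<forall>a<U. decode I s' ''X'' a = M a else \<forall>a<U. decode I s' ''X'' a = ?X a"
        using s' M(3) X(3) by (simp split: if_splits)
      then show ?thesis unfolding local_search_step_def using M(1,4) by blast
    qed
    then show "?R I s s'" using k by simp
  qed
  then show "prog (NAssign ''q'' [] (NConst 1) # start U False @ RAssign ''cur'' [] (RVar ''best'' []) #
     For_agent ''q'' (test U True none @ For_item ''c'' (test U True all)) @ [Cond ?b (copy U ''B'' ''X'') []]) ?R"
    by simp
qed

section \<open>The welfare function is submodular\<close>

text \<open>\<open>u'\<close> and \<open>v'\<close> are convex combinations of \<open>u\<close> and
  \<open>v\<close> with interchanged coefficients; the two concavity inequalities add up.\<close>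

lemma concave_exchange:
  fixes f :: "real \<Rightarrow> real"
  assumes f: "concave_on UNIV f" and "u \<le> u'" "u' \<le> v" "u + v = u' + v'"
  shows "f u + f v \<le> f u' + f v'"
proof (cases "u = v")
  case False
  then have uv: "u < v" using assms by simp
  define t where "t = (u' - u) / (v - u)"
  have t: "0 \<le> t" "t \<le> 1" using assms uv by (auto simp: t_def)
  have tv: "t * (v - u) = u' - u" using uv by (simp add: t_def)
  have u': "(1 - t) * u + t * v = u'" using tv by (simp add: algebra_simps)
  have v': "(1 - t) * v + t * u = v'" using tv assms(4) by (simp add: algebra_simps)
  have "(1 - t) * f u + t * f v \<le> f u'" using concave_onD[OF f t, of u v] u' by simp
  moreover have "(1 - t) * f v + t * f u \<le> f v'" using concave_onD[OF f t, of v u] v' by simp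
  ultimately show ?thesis by (simp add: algebra_simps)
qed (use assms in auto)

text \<open>For an agent in \<open>A \<inter> B\<close> the loads at \<open>A\<close> and
  \<open>B\<close> lie between those at \<open>A \<union> B\<close> and \<open>A \<inter> B\<close>
  and have the same sum, so concavity applies. An agent in only one of the sets has a smaller load
  at the union, and monotonicity of \<open>f\<close> suffices.\<close>

lemma item_submodular:
  fixes f :: "nat \<Rightarrow> real \<Rightarrow> real" and a :: "nat \<Rightarrow> nat \<Rightarrow> real"
  assumes fin: "finite A" "finite B"
    and f: "\<And>j. j \<in> A \<union> B \<Longrightarrow> mono (f j)" "\<And>j. j \<in> A \<union> B \<Longrightarrow> concave_on UNIV (f j)"
    and a: "\<And>j k. j \<in> A \<union> B \<Longrightarrow> k \<in> A \<union> B \<Longrightarrow> j \<noteq> k \<Longrightarrow> a j k \<le> 0"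
  defines "F \<equiv> \<lambda>S. \<Sum>j\<in>S. f j (\<Sum>k\<in>S. a j k)"
  shows "F (A \<union> B) + F (A \<inter> B) \<le> F A + F B"
proof -
  define s where "s j S = (\<Sum>k\<in>S. a j k)" for j S
  have less: "s j T \<le> s j S" if "S \<subseteq> T" "T \<subseteq> A \<union> B" "j \<in> S" for j S T
  proof -
    have "finite T" using that fin by (meson finite_UnI finite_subset)
    then have "s j T = s j S + (\<Sum>k\<in>T - S. a j k)" unfolding s_def using that
      by (metis add.commute sum.subset_diff)
    moreover have "(\<Sum>k\<in>T - S. a j k) \<le> 0" using that by (intro sum_nonpos a) auto
    ultimately show ?thesis by simp
  qed
  have both: "f j (s j (A \<union> B)) + f j (s j (A \<inter> B)) \<le> f j (s j A) + f j (s j B)" if "j \<in> A \<inter> B" for j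
  proof (rule concave_exchange[where f = "f j"])
    show "concave_on UNIV (f j)" using f that by auto
    show "s j (A \<union> B) \<le> s j A" using that by (intro less) auto
    show "s j A \<le> s j (A \<inter> B)" using that by (intro less) auto
    show "s j (A \<union> B) + s j (A \<inter> B) = s j A + s j B" unfolding s_def by (rule sum.union_inter[OF fin])
  qed
  have AB: "f j (s j (A \<union> B)) \<le> f j (s j A)" if "j \<in> A - B" for j
    using that f(1)[of j] less[of A "A \<union> B" j] by (auto dest: monoD)
  have BA: "f j (s j (A \<union> B)) \<le> f j (s j B)" if "j \<in> B - A" for j
    using that f(1)[of j] less[of B "A \<union> B" j] by (auto dest: monoD)
  have split: "sum h X = sum h (X \<inter> Y) + sum h (X - Y)" if "finite X" for h :: "nat \<Rightarrow> real" and X Y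
    using that by (rule sum.Int_Diff)
  have "A \<union> B = (A \<inter> B) \<union> (A - B) \<union> (B - A)" by blast
  then have "F (A \<union> B) = (\<Sum>j\<in>(A \<inter> B) \<union> (A - B) \<union> (B - A). f j (s j (A \<union> B)))" unfolding F_def s_def by simp
  also have "\<dots> = (\<Sum>j\<in>(A \<inter> B) \<union> (A - B). f j (s j (A \<union> B))) + (\<Sum>j\<in>B - A. f j (s j (A \<union> B)))"
    using fin by (intro sum.union_disjoint) auto
  also have "(\<Sum>j\<in>(A \<inter> B) \<union> (A - B). f j (s j (A \<union> B))) = (\<Sum>j\<in>A \<inter> B. f j (s j (A \<union> B))) + (\<Sum>j\<in>A - B. f j (s j (A \<union> B)))"
    using fin by (intro sum.union_disjoint) auto
  also have "\<dots> + (\<Sum>j\<in>B - A. f j (s j (A \<union> B))) \<le> (\<Sum>j\<in>A \<inter> B. f j (s j (A \<union> B))) + (\<Sum>j\<in>A - B. f j (s j A)) + (\<Sum>j\<in>B - A. f j (s j B))"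
    using AB BA by (intro add_mono sum_mono order_refl) auto
  finally have "F (A \<union> B) + F (A \<inter> B) \<le> (\<Sum>j\<in>A \<inter> B. f j (s j (A \<union> B)) + f j (s j (A \<inter> B))) + (\<Sum>j\<in>A - B. f j (s j A)) + (\<Sum>j\<in>B - A. f j (s j B))"
    by (simp add: F_def s_def sum.distrib)
  also have "\<dots> \<le> (\<Sum>j\<in>A \<inter> B. f j (s j A) + f j (s j B)) + (\<Sum>j\<in>A - B. f j (s j A)) + (\<Sum>j\<in>B - A. f j (s j B))"
    by (intro add_right_mono sum_mono both)
  also have "\<dots> = F A + F B"
    using split[OF fin(1), of "\<lambda>j. f j (s j A)" B] split[OF fin(2), of "\<lambda>j. f j (s j B)" A]
    by (simp add: F_def s_def sum.distrib Int_commute)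
  finally show ?thesis .
qed

lemma worth_assignment_function:
  assumes I: "negative_concave I" and nonneg: "\<forall>S\<in>feasible I. welfare I S \<ge> 0"
  shows "assignment_function (worth I)"
proof
  show "worth I {} = 0" by (simp add: worth_def recipients_def)
  fix A B :: "(nat \<times> nat) set"
  have rec: "recipients I (A \<union> B) i = recipients I A i \<union> recipients I B i"
    "recipients I (A \<inter> B) i = recipients I A i \<inter> recipients I B i" "finite (recipients I A i)" "recipients I A i \<subseteq> {1..agents I}" for i A B
    by (auto simp: recipients_def)
  let ?F = "\<lambda>i S. \<Sum>j\<in>S. extern I i j (\<Sum>k\<in>S. weight I i j k)"
  have "worth I (A \<union> B) + worth I (A \<inter> B) = (\<Sum>i\<in>{1..items I}. ?F i (recipients I A i \<union> recipients I B i) + ?F i (recipients I A i \<inter> recipients I B i))"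
    by (simp add: worth_def rec sum.distrib)
  also have "\<dots> \<le> (\<Sum>i\<in>{1..items I}. ?F i (recipients I A i) + ?F i (recipients I B i))"
  proof (intro sum_mono item_submodular rec(3))
    fix i assume i: "i \<in> {1..items I}"
    have U: "recipients I A i \<union> recipients I B i \<subseteq> {1..agents I}" using rec(4) by blast
    show "mono (extern I i j)" "concave_on UNIV (extern I i j)" if "j \<in> recipients I A i \<union> recipients I B i" for j
      using I i that U unfolding negative_concave_def by blast+
    show "weight I i j k \<le> 0" if "j \<in> recipients I A i \<union> recipients I B i" "k \<in> recipients I A i \<union> recipients I B i" "j \<noteq> k" for j k
      using I i that U unfolding negative_concave_def by blast
  qed
  also have "\<dots> = worth I A + worth I B" by (simp add: worth_def sum.distrib)
  finally show "worth I (A \<union> B) + worth I (A \<inter> B) \<le> worth I A + worth I B" .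
  show "0 \<le> worth I A" unfolding worth_def
  proof (rule sum_nonneg)
    fix i assume i: "i \<in> {1..items I}"
    define S where "S = (\<lambda>k\<in>{1..items I}. if k = i then recipients I A i else {})"
    have "S \<in> feasible I" using rec(4)[of A i] by (auto simp: feasible_def S_def disjoint_family_on_def)
    then have "0 \<le> welfare I S" using nonneg by blast
    also have "welfare I S = (\<Sum>k\<in>{1..items I}. if k = i then ?F i (recipients I A i) else 0)"
      unfolding welfare_def by (intro sum.cong) (auto simp: S_def)
    also have "\<dots> = ?F i (recipients I A i)" using i by simp
    finally show "0 \<le> ?F i (recipients I A i)" .
  qed
qed

lemma optimum_as_pairs:
  obtains Ot where "Ot \<subseteq> {1..items I} \<times> {1..agents I}" "inj_on snd Ot" "worth I Ot = max_welfare I"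
proof -
  have "finite ({1..items I} \<rightarrow>\<^sub>E Pow {1..agents I})" by (intro finite_PiE) auto
  then have fin: "finite (feasible I)" by (rule rev_finite_subset) (auto simp: feasible_def)
  have "(\<lambda>k\<in>{1..items I}. {}) \<in> feasible I" by (auto simp: feasible_def disjoint_family_on_def)
  then have "max_welfare I \<in> welfare I ` feasible I" unfolding max_welfare_def using fin by (intro Max_in) auto
  then obtain S where S: "S \<in> feasible I" "max_welfare I = welfare I S" by blast
  have sub: "S i \<subseteq> {1..agents I}" if "i \<in> {1..items I}" for i using S(1) that by (auto simp: feasible_def PiE_iff)
  have disj: "S i \<inter> S i' = {}" if "i \<in> {1..items I}" "i' \<in> {1..items I}" "i \<noteq> i'" for i i'
    using S(1) that by (auto simp: feasible_def disjoint_family_on_def)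
  define Ot where "Ot = {(i, j). i \<in> {1..items I} \<and> j \<in> S i}"
  have r: "recipients I Ot i = S i" if "i \<in> {1..items I}" for i
    using that sub[OF that] by (auto simp: recipients_def Ot_def)
  show thesis
  proof (rule that[of Ot])
    show "Ot \<subseteq> {1..items I} \<times> {1..agents I}" using sub by (auto simp: Ot_def)
    show "inj_on snd Ot"
    proof (rule inj_onI)
      fix x y assume "x \<in> Ot" "y \<in> Ot" "snd x = snd y"
      then obtain i i' j where *: "x = (i, j)" "y = (i', j)" "i \<in> {1..items I}" "i' \<in> {1..items I}" "j \<in> S i" "j \<in> S i'"
        unfolding Ot_def by (cases x, cases y) auto
      then have "i = i'" using disj[of i i'] by blast
      then show "x = y" using * by simp
    qed
    show "worth I Ot = max_welfare I" unfolding S(2) worth_def welfare_def by (intro sum.cong refl) (simp_all add: r)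
  qed
qed

section \<open>Local search\<close>

text \<open>Flattens nested loops: the step count \<open>n * (n * p)\<close> of the local search is
  realized by two loops over the agents around \<open>p\<close> copies of the step.\<close>

lemma chain_const_mult: "chain (\<lambda>_. chain (\<lambda>_. r) k) n x y \<Longrightarrow> chain (\<lambda>_. r) (n * k) x y"
proof (induction n arbitrary: y)
  case (Suc n)
  have add: "chain (\<lambda>_. r) a x y \<Longrightarrow> chain (\<lambda>_. r) b y z \<Longrightarrow> chain (\<lambda>_. r) (b + a) x z" for a b x y z
    by (induction b arbitrary: z) auto
  from Suc.prems obtain z where z: "chain (\<lambda>_. chain (\<lambda>_. r) k) n x z" "chain (\<lambda>_. r) k z y" by auto
  show ?case using add[OF Suc.IH[OF z(1)] z(2)] by simp
qed simp

lemma chain_map: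
  assumes "chain st n x y" "\<And>v x y. v < n \<Longrightarrow> st v x y \<Longrightarrow> st' v (f x) (f y)"
  shows "chain st' n (f x) (f y)"
  using assms
proof (induction n arbitrary: y)
  case (Suc n)
  then obtain z where z: "chain st n x z" "st n z y" by auto
  have "chain st' n (f x) (f z)" using Suc.IH[OF z(1)] Suc.prems(2) by simp
  moreover have "st' n (f z) (f y)" using Suc.prems(2)[OF _ z(2)] by simp
  ultimately show ?case by auto
qed simp

context assignment_function
begin

definition reassignments :: "nat \<Rightarrow> nat \<Rightarrow> (nat \<times> nat) set \<Rightarrow> (nat \<times> nat) set set" where
  "reassignments m n Z = (\<Union>q\<in>{1..n}. {{e \<in> Z. snd e \<noteq> q}} \<union> (\<Union>c\<in>{1..m}. {insert (c, q) {e \<in> Z. snd e \<noteq> q}}))"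

definition improving_step where
  "improving_step m n p Z Z' \<longleftrightarrow> (\<exists>M\<in>insert Z (reassignments m n Z). (\<forall>C\<in>insert Z (reassignments m n Z). W C \<le> W M) \<and>
     Z' = (if W Z < (W M - W Z) * (real p * real n) then M else Z))"

text \<open>Once no move passes the threshold, nothing changes any more. Before that, the first move
  reaches at least the best single pair, because it starts from value 0, and every further move adds
  more than \<open>W Y / (p * n)\<close>, hence at least \<open>W {e} / (p * n)\<close> for every
  pair \<open>e\<close>.\<close>

lemma improving_chain:
  assumes "chain (\<lambda>_. improving_step m n p) v {} Z" and pn: "p \<ge> 1" "n \<ge> 1"
  shows "Z \<subseteq> {1..m} \<times> {1..n} \<and> inj_on snd Z \<and>
    ((\<forall>C\<in>reassignments m n Z. (W C - W Z) * (real p * real n) \<le> W Z) \<or>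
     (v = 0 \<and> Z = {}) \<or> (v > 0 \<and> W Z > 0 \<and> (\<forall>e\<in>{1..m} \<times> {1..n}. W {e} * (1 + (real v - 1) / (real p * real n)) \<le> W Z)))"
  using assms(1)
proof (induction v arbitrary: Z)
  case (Suc v)
  then obtain Y where Y: "chain (\<lambda>_. improving_step m n p) v {} Y" "improving_step m n p Y Z" by auto
  note IH = Suc.IH[OF Y(1)]
  have N: "real p * real n > 0" using pn by simp
  obtain M where M: "M \<in> insert Y (reassignments m n Y)" "\<And>C. C \<in> insert Y (reassignments m n Y) \<Longrightarrow> W C \<le> W M"
    and Z: "Z = (if W Y < (W M - W Y) * (real p * real n) then M else Y)"
    using Y(2) unfolding improving_step_def by blast
  show ?case
  proof (cases "W Y < (W M - W Y) * (real p * real n)")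
    case False
    then have ZY: "Z = Y" using Z by simp
    have "(W C - W Y) * (real p * real n) \<le> W Y" if "C \<in> reassignments m n Y" for C
    proof -
      have "(W C - W Y) * (real p * real n) \<le> (W M - W Y) * (real p * real n)"
        using M(2)[of C] that N by (intro mult_right_mono) auto
      then show ?thesis using False by simp
    qed
    then show ?thesis using IH ZY by blast
  next
    case True
    then have ZM: "Z = M" using Z by simp
    then have MY: "M \<noteq> Y" using True nonneg[of Y] by auto
    then have "Z \<in> reassignments m n Y" using M(1) ZM by blast
    then obtain q where q: "q \<in> {1..n}" and ZZ: "Z = {e \<in> Y. snd e \<noteq> q} \<or> (\<exists>c\<in>{1..m}. Z = insert (c, q) {e \<in> Y. snd e \<noteq> q})"
      unfolding reassignments_def by blast
    have sub: "Z \<subseteq> {1..m} \<times> {1..n}" using ZZ IH q by auto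
    have "inj_on snd {e \<in> Y. snd e \<noteq> q}" using IH by (auto intro: inj_on_subset)
    then have inj: "inj_on snd Z" using ZZ by auto
    have nstuck: "\<not> (\<forall>C\<in>reassignments m n Y. (W C - W Y) * (real p * real n) \<le> W Y)"
      using True \<open>Z \<in> reassignments m n Y\<close> ZM by (meson not_le)
    have inc: "W Y / (real p * real n) < W Z - W Y" unfolding pos_divide_less_eq[OF N] using True ZM by simp
    have "0 \<le> W Y / (real p * real n)" using nonneg N by simp
    then have pos: "0 < W Z" using inc nonneg[of Y] by linarith
    have "W {e} * (1 + (real (Suc v) - 1) / (real p * real n)) \<le> W Z" if e: "e \<in> {1..m} \<times> {1..n}" for e
    proof (cases "v = 0")
      case True
      then have "Y = {}" using Y(1) by simp
      then have "{e} \<in> reassignments m n Y" using e unfolding reassignments_def by auto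
      then show ?thesis using M(2)[of "{e}"] ZM True by simp
    next
      case False
      then have *: "W {e} * (1 + (real v - 1) / (real p * real n)) \<le> W Y" using IH nstuck e by blast
      have "W {e} * 1 \<le> W {e} * (1 + (real v - 1) / (real p * real n))"
        using False N nonneg by (intro mult_left_mono) auto
      then have "W {e} \<le> W Y" using * by simp
      then have "W {e} / (real p * real n) \<le> W Y / (real p * real n)" using N by (intro divide_right_mono) auto
      moreover have "W {e} * (1 + (real (Suc v) - 1) / (real p * real n)) =
        W {e} * (1 + (real v - 1) / (real p * real n)) + W {e} / (real p * real n)"
        by (simp add: algebra_simps add_divide_distrib diff_divide_distrib)
      ultimately show ?thesis using * inc by linarith
    qed
    then show ?thesis using sub inj pos by simp
  qed
qed simp

text \<open>By subadditivity \<open>W Z\<close> is at most \<open>n\<close> times the value of its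
  best pair, which the linear growth of \<open>improving_chain\<close> would exceed after
  \<open>n * (n * p)\<close> moves. So the search is stuck by then, and \<open>local_optimum\<close>
  applies.\<close>

lemma local_search:
  assumes ch: "chain (\<lambda>_. improving_step m n p) (n * (n * p)) {} Z" and pn: "p \<ge> 2" "n \<ge> 1"
    and Ot: "Ot \<subseteq> {1..m} \<times> {1..n}" "inj_on snd Ot"
  shows "W (Z \<union> Ot) + W (Z \<inter> Ot) \<le> (2 + 1 / real p) * W Z"
    and "Z \<subseteq> {1..m} \<times> {1..n}" "inj_on snd Z"
proof -
  have N: "real p * real n > 0" using pn by simp
  note * = improving_chain[OF ch _ pn(2)]
  show sub: "Z \<subseteq> {1..m} \<times> {1..n}" and inj: "inj_on snd Z" using * pn by auto
  have fin: "finite Z" using sub by (rule finite_subset) simp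
  \<comment> \<open>The growth factor is \<open>1 + n - 1 / (p * n)\<close>, which exceeds
    \<open>n\<close> because \<open>p * n \<ge> 2\<close>.\<close>
  have "\<not> (n * (n * p) > 0 \<and> W Z > 0 \<and> (\<forall>e\<in>{1..m} \<times> {1..n}. W {e} * (1 + (real (n * (n * p)) - 1) / (real p * real n)) \<le> W Z))"
  proof (intro notI, elim conjE)
    assume pos: "W Z > 0" and e: "\<forall>e\<in>{1..m} \<times> {1..n}. W {e} * (1 + (real (n * (n * p)) - 1) / (real p * real n)) \<le> W Z"
    have "Z \<noteq> {}" using pos empty by auto
    define b where "b = Max ((\<lambda>e. W {e}) ` Z)"
    have "b \<in> (\<lambda>e. W {e}) ` Z" unfolding b_def using fin \<open>Z \<noteq> {}\<close> by (intro Max_in) auto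
    then obtain x where x: "x \<in> Z" "b = W {x}" by auto
    have "W Z \<le> (\<Sum>z\<in>Z. W {z})" using union_le_sum_marginals[OF fin, of "{}"] empty by simp
    also have "\<dots> \<le> (\<Sum>z\<in>Z. b)" unfolding b_def using fin by (intro sum_mono Max_ge) auto
    also have "\<dots> = card Z * b" by simp
    also have "\<dots> \<le> n * b"
    proof (intro mult_right_mono)
      have "card Z = card (snd ` Z)" using inj by (simp add: card_image)
      also have "\<dots> \<le> card {1..n}" using sub by (intro card_mono) auto
      finally show "real (card Z) \<le> real n" by simp
      show "0 \<le> b" using x nonneg by simp
    qed
    finally have WZ: "W Z \<le> n * b" .
    then have bpos: "b > 0" using pos pn by (smt (verit) mult_nonneg_nonpos of_nat_0_le_iff)
    have "real (n * (n * p)) = real n * (real p * real n)" by simp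
    then have "1 + (real (n * (n * p)) - 1) / (real p * real n) = 1 + real n - 1 / (real p * real n)"
      using pn by (simp only: diff_divide_distrib) simp
    moreover have "b * (1 + (real (n * (n * p)) - 1) / (real p * real n)) \<le> n * b"
    proof -
      have "b * (1 + (real (n * (n * p)) - 1) / (real p * real n)) \<le> W Z" using e x sub by blast
      then show ?thesis using WZ by linarith
    qed
    ultimately have "b * (1 + real n - 1 / (real p * real n)) \<le> n * b" by (simp only:)
    moreover have "b * (1 + real n - 1 / (real p * real n)) = b * (1 - 1 / (real p * real n)) + n * b" by (simp add: algebra_simps)
    ultimately have "b * (1 - 1 / (real p * real n)) \<le> 0" by simp
    moreover have "1 / (real p * real n) < 1"
    proof -
      have "2 * 1 \<le> real p * real n" using pn by (intro mult_mono) auto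
      then show ?thesis by (simp add: field_simps)
    qed
    ultimately show False using bpos by (simp add: mult_le_0_iff)
  qed
  moreover have "n * (n * p) \<noteq> 0" using pn by simp
  ultimately have stuck: "(W C - W Z) * (real p * real n) \<le> W Z" if "C \<in> reassignments m n Z" for C
    using * pn that by (auto simp del: mult_eq_0_iff)
  \<comment> \<open>The acceptance threshold; over the \<open>n\<close> agents it accumulates to
    \<open>W Z / p\<close>.\<close>
  define \<eta> where "\<eta> = W Z / (real p * real n)"
  have st: "W C \<le> W Z + \<eta>" if "C \<in> reassignments m n Z" for C
  proof -
    have "W C - W Z \<le> \<eta>" unfolding \<eta>_def pos_le_divide_eq[OF N] by (rule stuck[OF that])
    then show ?thesis by simp
  qed
  have "W (Z \<union> Ot) + W (Z \<inter> Ot) \<le> 2 * W Z + card {1..n} * \<eta>"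
  proof (rule local_optimum[where agent = snd])
    show "finite Ot" using Ot(1) by (rule finite_subset) simp
    show "W (insert e {z\<in>Z. snd z \<noteq> snd e}) \<le> W Z + \<eta>" if "e \<in> Ot" for e
    proof (rule st)
      show "insert e {z \<in> Z. snd z \<noteq> snd e} \<in> reassignments m n Z"
      proof -
        obtain c q where e: "e = (c, q)" by (cases e)
        then have "c \<in> {1..m}" "q \<in> {1..n}" using that Ot(1) by auto
        then show ?thesis unfolding reassignments_def e snd_conv by blast
      qed
    qed
    show "W {z\<in>Z. snd z \<noteq> q} \<le> W Z + \<eta>" if "q \<in> {1..n}" for q
      using that by (intro st) (auto simp: reassignments_def)
    show "0 \<le> \<eta>" using nonneg N by (simp add: \<eta>_def)
  qed (use fin Ot inj sub in auto)
  moreover have "card {1..n} * \<eta> = W Z / p" using pn by (simp add: \<eta>_def field_simps)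
  ultimately show "W (Z \<union> Ot) + W (Z \<inter> Ot) \<le> (2 + 1 / real p) * W Z" by (simp add: algebra_simps)
qed

end

section \<open>The phases of the algorithm\<close>

text \<open>The counter starts at 1 while \<open>chain\<close> numbers its steps from 0, which
  explains \<open>- 1\<close> here and \<open>Suc\<close> in the step relations.\<close>

lemma prog_For_chain:
  assumes P: "prog P (\<lambda>I s s'. keep N s s' \<and> (g I s (nmem s x []) \<longrightarrow>
      st I s (nmem s x [] - 1) (decode I s ''X'') (decode I s' ''X'')))"
    and x: "x \<notin> N" "x \<noteq> ''X''"
    and stable: "\<And>I s s'. keep (insert x N) s s' \<Longrightarrow> g I s' = g I s \<and> st I s' = st I s"
    and H: "\<And>I s. nval I s h = H I" "polynomially_bounded H" "\<And>I. 1 \<le> H I"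
  shows "prog (For x 1 h P) (\<lambda>I s s'. keep (insert x N) s s' \<and> ((\<forall>u. 1 \<le> u \<longrightarrow> u < H I \<longrightarrow> g I s u) \<longrightarrow>
      chain (st I s) (H I - 1) (decode I s ''X'') (decode I s' ''X'')))"
proof -
  define Q where "Q = (\<lambda>(I::msw) s0 v s. keep (insert x N) s0 s \<and> ((\<forall>u. 1 \<le> u \<longrightarrow> u < H I \<longrightarrow> g I s0 u) \<longrightarrow>
      chain (st I s0) (v - 1) (decode I s0 ''X'') (decode I s ''X'')))"
  have wr: "decode I (nwrite x [] v s) ''X'' = decode I s ''X''" for I v s
    by (rule decode_keep[of "{x}"]) (use x in \<open>auto intro: keep_nwrite\<close>)
  have "prog (For x 1 h P) (\<lambda>I s s'. Q I s (max 1 (H I)) s')"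
  proof (rule prog_For[OF P _ H(1,2)])
    fix I :: msw and s s' :: store
    assume st: "keep N s s' \<and> (g I s (nmem s x []) \<longrightarrow> st I s (nmem s x [] - 1) (decode I s ''X'') (decode I s' ''X''))"
    show "nmem s' x [] = nmem s x []" using keepN[OF st[THEN conjunct1] x(1)] by simp
    fix s0 v
    assume v: "1 \<le> v" "v < H I" and Q: "Q I s0 v s" and xv: "nmem s x [] = v"
    have k0: "keep (insert x N) s0 s" using Q by (simp add: Q_def)
    have eq: "g I s = g I s0" "st I s = st I s0" using stable[OF k0] by auto
    have "keep (insert x N) s0 s'" by (rule keep_trans[OF k0 st[THEN conjunct1]]) auto
    then have k: "keep (insert x N) s0 (nwrite x [] (Suc v) s')" by (rule keep_nwrite) simp
    have "chain (st I s0) (Suc v - 1) (decode I s0 ''X'') (decode I s' ''X'')"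
      if g: "\<forall>u. 1 \<le> u \<longrightarrow> u < H I \<longrightarrow> g I s0 u"
    proof -
      have "g I s (nmem s x [])" using g v unfolding xv eq by blast
      then have "st I s0 (v - 1) (decode I s ''X'') (decode I s' ''X'')" using st unfolding xv eq by blast
      moreover have "chain (st I s0) (v - 1) (decode I s0 ''X'') (decode I s ''X'')" using Q g by (simp add: Q_def)
      ultimately have "chain (st I s0) (Suc (v - 1)) (decode I s0 ''X'') (decode I s' ''X'')" by auto
      then show ?thesis using v by simp
    qed
    then show "Q I s0 (Suc v) (nwrite x [] (Suc v) s')" unfolding Q_def wr using k by blast
  next
    show "Q I s 1 (nwrite x [] 1 s)" for I :: msw and s :: store
      unfolding Q_def wr by (simp add: keep_nwrite)
  qed
  then show ?thesis unfolding Q_def max_absorb2[OF H(3)] .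
qed

lemma prog_replicate_chain:
  assumes P: "prog P (\<lambda>I s s'. keep N s s' \<and> (g I \<longrightarrow> st I s (decode I s ''X'') (decode I s' ''X'')))"
    and stable: "\<And>I s s'. keep N s s' \<Longrightarrow> st I s' = st I s"
  shows "prog (concat (replicate k P)) (\<lambda>I s s'. keep N s s' \<and> (g I \<longrightarrow> chain (\<lambda>_. st I s) k (decode I s ''X'') (decode I s' ''X'')))"
proof (induction k)
  case 0
  show ?case by (simp, rule prog_weaken[OF prog_Nil]) simp
next
  case (Suc k)
  have "concat (replicate (Suc k) P) = concat (replicate k P) @ P" by (induction k) auto
  moreover have "prog (concat (replicate k P) @ P) (\<lambda>I s s'. keep N s s' \<and> (g I \<longrightarrow> chain (\<lambda>_. st I s) (Suc k) (decode I s ''X'') (decode I s' ''X'')))"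
  proof (rule prog_weaken[OF prog_append[OF Suc P]], elim exE conjE, intro conjI impI)
    fix I :: msw and s s1 s' :: store
    assume k: "keep N s s1" "keep N s1 s'"
    show "keep N s s'" by (rule keep_trans[OF k]) auto
    assume "g I" "g I \<longrightarrow> chain (\<lambda>_. st I s) k (decode I s ''X'') (decode I s1 ''X'')"
      "g I \<longrightarrow> st I s1 (decode I s1 ''X'') (decode I s' ''X'')"
    then show "chain (\<lambda>_. st I s) (Suc k) (decode I s ''X'') (decode I s' ''X'')" using stable[OF k(1), of I] by auto
  qed
  ultimately show ?case by simp
qed

definition reset :: "nat \<Rightarrow> com list" where
  "reset U = fill U [NAssign ''X'' [scalar ''a'', scalar ''i'', scalar ''j''] (NConst 0)]"

lemma prog_reset: "prog (reset U) (\<lambda>I s s'. keep {''a'', ''i'', ''j'', ''X''} s s' \<and> (\<forall>a<U. decode I s' ''X'' a = {}))"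
proof -
  have "prog (reset U) (\<lambda>I s s'. keep {''a'', ''i'', ''j'', ''X''} s s' \<and>
    (\<forall>a<U. \<forall>i\<in>{1..items I}. \<forall>j\<in>{1..agents I}. nmem s' ''X'' [a, i, j] = 0))"
    unfolding reset_def by (rule prog_fill[where V = "\<lambda>_ _ _. 0", OF prog_weaken[OF prog_NAssign]]) simp_all
  then show ?thesis by (rule prog_weaken) (auto simp: decode_def)
qed

definition stored :: "msw \<Rightarrow> store \<Rightarrow> (nat \<times> nat) set" where
  "stored I s = {(i, j). i \<in> {1..items I} \<and> j \<in> {1..agents I} \<and> nmem s ''S'' [i, j] \<noteq> 0}"

definition save :: "com list" where
  "save = For_item ''i'' (For_agent ''j'' [NAssign ''S'' [scalar ''i'', scalar ''j''] (NVar ''X'' [NConst 0, scalar ''i'', scalar ''j''])])"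

lemma prog_save: "prog save (\<lambda>I s s'. keep {''i'', ''j'', ''S''} s s' \<and> stored I s' = decode I s ''X'' 0)"
proof -
  let ?V = "\<lambda>(I::msw) s is. nmem s ''X'' (0 # is) :: nat"
  have "prog save (\<lambda>I s s'. keep {''i'', ''j'', ''S''} s s' \<and>
    (\<forall>is. nmem s' ''S'' is = (if \<exists>i. 1 \<le> i \<and> i < items I + 1 \<and> (\<exists>j. 1 \<le> j \<and> j < agents I + 1 \<and> is = [] @ [i, j])
       then ?V I s is else nmem s ''S'' is)))"
    unfolding save_def
  proof (rule prog_fill_matrix[where pre = "\<lambda>_. []" and V = ?V])
    show "prog [NAssign ''S'' [scalar ''i'', scalar ''j''] (NVar ''X'' [NConst 0, scalar ''i'', scalar ''j''])]
      (\<lambda>I s s'. s' = nwrite ''S'' ([] @ [nmem s ''i'' [], nmem s ''j'' []]) (?V I s ([] @ [nmem s ''i'' [], nmem s ''j'' []])) s)"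
      by (rule prog_weaken[OF prog_NAssign]) simp
    show "[] = [] \<and> ?V I s' = ?V I s" if k: "keep {''i'', ''j'', ''S''} s s'" for I s s'
      using keepN[OF k, of "''X''"] by simp
  qed simp
  then show ?thesis
  proof (rule prog_weaken, elim conjE, intro conjI)
    fix I :: msw and s s' :: store
    assume *: "\<forall>is. nmem s' ''S'' is = (if \<exists>i. 1 \<le> i \<and> i < items I + 1 \<and> (\<exists>j. 1 \<le> j \<and> j < agents I + 1 \<and> is = [] @ [i, j])
       then ?V I s is else nmem s ''S'' is)"
    have "nmem s' ''S'' [i, j] = nmem s ''X'' [0, i, j]" if "i \<in> {1..items I}" "j \<in> {1..agents I}" for i j
    proof -
      have "\<exists>i'. 1 \<le> i' \<and> i' < items I + 1 \<and> (\<exists>j'. 1 \<le> j' \<and> j' < agents I + 1 \<and> [i, j] = [] @ [i', j'])"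
        using that by (intro exI[of _ i] exI[of _ j] conjI) auto
      then show ?thesis using * by (simp only: if_True)
    qed
    then show "stored I s' = decode I s ''X'' 0" unfolding stored_def decode_def by auto
  qed
qed

text \<open>With weight 1 on outcome 0 and 0 elsewhere, the family behaves like a single set, so the
  machinery for families also serves the local search.\<close>

definition local_phase :: "nat \<Rightarrow> nat \<Rightarrow> com list" where
  "local_phase U p = load U ''w'' (\<lambda>a. of_bool (a = 0)) @ reset U @
     For_agent ''r'' (For_agent ''u'' (concat (replicate p (local_step U p))))"

lemma weighted_first:
  assumes "U \<ge> 1" "\<forall>a<U. nmem s ''w'' [a] = of_bool (a = 0)"
  shows "weighted I U s A = worth I (A 0)"
proof -
  have "weighted I U s A = (\<Sum>a<U. if a = 0 then worth I (A a) else 0)"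
    unfolding weighted_def using assms by (intro sum.cong) auto
  also have "\<dots> = worth I (A 0)" using assms by simp
  finally show ?thesis .
qed

lemma local_search_step_improving:
  assumes af: "assignment_function (worth I)" and U: "U \<ge> 1" "\<forall>a<U. nmem s ''w'' [a] = of_bool (a = 0)"
    and st: "local_search_step I U p s X X'"
  shows "assignment_function.improving_step (worth I) (items I) (agents I) p (X 0) (X' 0)"
proof -
  have int: "{1..<agents I + 1} = {1..agents I}" "{1..<items I + 1} = {1..items I}" by auto
  have img: "(\<lambda>A. A 0) ` insert X (moves I X) = insert (X 0) (assignment_function.reassignments (items I) (agents I) (X 0))"
    unfolding moves_def int assignment_function.reassignments_def[OF af]
    by (simp add: image_UN image_Un modify_def Un_commute)
  obtain M where M: "M \<in> insert X (moves I X)" "\<forall>C\<in>insert X (moves I X). worth I (C 0) \<le> worth I (M 0)"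
    "if worth I (X 0) < (worth I (M 0) - worth I (X 0)) * (real p * real (agents I)) then \<forall>a<U. X' a = M a else \<forall>a<U. X' a = X a"
    using st unfolding local_search_step_def weighted_first[OF U] by blast
  have "M 0 \<in> insert (X 0) (assignment_function.reassignments (items I) (agents I) (X 0))"
    unfolding img[symmetric] using M(1) by (rule imageI)
  moreover have "\<forall>C\<in>insert (X 0) (assignment_function.reassignments (items I) (agents I) (X 0)). worth I C \<le> worth I (M 0)"
    unfolding img[symmetric] using M(2) by simp
  moreover have "X' 0 = (if worth I (X 0) < (worth I (M 0) - worth I (X 0)) * (real p * real (agents I)) then M 0 else X 0)"
    using M(3) U(1) by (auto split: if_splits)
  ultimately show ?thesis unfolding assignment_function.improving_step_def[OF af] by blast
qed

lemma prog_local_phase: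
  assumes U: "U \<ge> 1"
  shows "prog (local_phase U p) (\<lambda>I s s'. (\<forall>a<U. nmem s' ''w'' [a] = of_bool (a = 0)) \<and>
    (agents I \<ge> 1 \<longrightarrow> assignment_function (worth I) \<longrightarrow>
      chain (\<lambda>_. assignment_function.improving_step (worth I) (items I) (agents I) p) (agents I * (agents I * p)) {} (decode I s' ''X'' 0)))"
proof -
  let ?st = "\<lambda>(I::msw) s. local_search_step I U p s"
  have lv: "''w'' \<notin> insert ''r'' (insert ''u'' local_vars)" "''w'' \<notin> insert ''u'' local_vars" "''w'' \<notin> local_vars"
    "''u'' \<notin> local_vars" "''r'' \<notin> insert ''u'' local_vars"
    by (simp_all add: local_vars_def)
  have stable: "?st I s' = ?st I s" if "keep N s s'" "''w'' \<notin> N" for I s s' N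
    by (intro ext) (simp add: local_search_step_def weighted_keep[OF that])
  have 1: "prog (concat (replicate p (local_step U p))) (\<lambda>I s s'. keep local_vars s s' \<and>
    (agents I \<ge> 1 \<longrightarrow> chain (\<lambda>_. ?st I s) p (decode I s ''X'') (decode I s' ''X'')))"
    by (rule prog_replicate_chain[where g = "\<lambda>I. agents I \<ge> 1" and st = ?st, OF prog_local_step])
      (rule stable[OF _ lv(3)])
  have 2: "prog (For_agent ''u'' (concat (replicate p (local_step U p)))) (\<lambda>I s s'. keep (insert ''u'' local_vars) s s' \<and>
    ((\<forall>u. 1 \<le> u \<longrightarrow> u < agents I + 1 \<longrightarrow> agents I \<ge> 1) \<longrightarrow>
      chain (\<lambda>_. chain (\<lambda>_. ?st I s) p) (agents I + 1 - 1) (decode I s ''X'') (decode I s' ''X'')))"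
  proof (rule prog_For_chain[where g = "\<lambda>I s u. agents I \<ge> 1" and st = "\<lambda>I s _. chain (\<lambda>_. ?st I s) p", OF 1 _ _ _ agent_bound
        polynomially_bounded_intros(4)[OF polynomially_bounded_intros(2,1)]])
    fix I :: msw and s s' :: store assume k: "keep (insert ''u'' local_vars) s s'"
    show "(\<lambda>u. agents I \<ge> 1) = (\<lambda>u. agents I \<ge> 1) \<and> (\<lambda>_::nat. chain (\<lambda>_. ?st I s') p) = (\<lambda>_. chain (\<lambda>_. ?st I s) p)"
      unfolding stable[OF k lv(2)] by simp
  qed (use lv in simp_all)
  have 3: "prog (For_agent ''r'' (For_agent ''u'' (concat (replicate p (local_step U p))))) (\<lambda>I s s'. keep (insert ''r'' (insert ''u'' local_vars)) s s' \<and>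
    ((\<forall>u. 1 \<le> u \<longrightarrow> u < agents I + 1 \<longrightarrow> (\<forall>u. 1 \<le> u \<longrightarrow> u < agents I + 1 \<longrightarrow> agents I \<ge> 1)) \<longrightarrow>
      chain (\<lambda>_. chain (\<lambda>_. chain (\<lambda>_. ?st I s) p) (agents I + 1 - 1)) (agents I + 1 - 1) (decode I s ''X'') (decode I s' ''X'')))"
  proof (rule prog_For_chain[where g = "\<lambda>I s _. \<forall>u. 1 \<le> u \<longrightarrow> u < agents I + 1 \<longrightarrow> agents I \<ge> 1"
          and st = "\<lambda>I s _. chain (\<lambda>_. chain (\<lambda>_. ?st I s) p) (agents I + 1 - 1)", OF 2 _ _ _ agent_bound
        polynomially_bounded_intros(4)[OF polynomially_bounded_intros(2,1)]])
    fix I :: msw and s s' :: store assume k: "keep (insert ''r'' (insert ''u'' local_vars)) s s'"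
    show "(\<lambda>_::nat. \<forall>u. 1 \<le> u \<longrightarrow> u < agents I + 1 \<longrightarrow> agents I \<ge> 1) = (\<lambda>_. \<forall>u. 1 \<le> u \<longrightarrow> u < agents I + 1 \<longrightarrow> agents I \<ge> 1) \<and>
      (\<lambda>_::nat. chain (\<lambda>_. chain (\<lambda>_. ?st I s') p) (agents I + 1 - 1)) = (\<lambda>_. chain (\<lambda>_. chain (\<lambda>_. ?st I s) p) (agents I + 1 - 1))"
      unfolding stable[OF k lv(1)] by simp
  qed (use lv in simp_all)
  show ?thesis unfolding local_phase_def
  proof (rule prog_weaken[OF prog_append[OF prog_load prog_append[OF prog_reset 3]]], elim exE conjE, intro conjI impI)
    fix I :: msw and s s1 s2 s' :: store
    assume w: "\<forall>a<U. nmem s1 ''w'' [a] = of_bool (a = 0)" and k2: "keep {''a'', ''i'', ''j'', ''X''} s1 s2"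
      and k3: "keep (insert ''r'' (insert ''u'' local_vars)) s2 s'"
    have w2: "nmem s2 ''w'' = nmem s1 ''w''" "nmem s' ''w'' = nmem s1 ''w''" using keepN[OF k2] keepN[OF k3] lv(1) by simp_all
    show "\<forall>a<U. nmem s' ''w'' [a] = of_bool (a = 0)" using w w2 by simp
    assume n: "agents I \<ge> 1" and af: "assignment_function (worth I)" and e: "\<forall>a<U. decode I s2 ''X'' a = {}"
      and ch: "(\<forall>u. 1 \<le> u \<longrightarrow> u < agents I + 1 \<longrightarrow> (\<forall>u. 1 \<le> u \<longrightarrow> u < agents I + 1 \<longrightarrow> agents I \<ge> 1)) \<longrightarrow>
      chain (\<lambda>_. chain (\<lambda>_. chain (\<lambda>_. ?st I s2) p) (agents I + 1 - 1)) (agents I + 1 - 1) (decode I s2 ''X'') (decode I s' ''X'')"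
    have "chain (\<lambda>_. chain (\<lambda>_. chain (\<lambda>_. ?st I s2) p) (agents I)) (agents I) (decode I s2 ''X'') (decode I s' ''X'')"
      using ch n by simp
    then have "chain (\<lambda>_. chain (\<lambda>_. ?st I s2) (agents I * p)) (agents I) (decode I s2 ''X'') (decode I s' ''X'')"
      by (rule chain_map[where f = "\<lambda>x. x"]) (rule chain_const_mult)
    then have "chain (\<lambda>_. ?st I s2) (agents I * (agents I * p)) (decode I s2 ''X'') (decode I s' ''X'')" by (rule chain_const_mult)
    then have "chain (\<lambda>_. assignment_function.improving_step (worth I) (items I) (agents I) p) (agents I * (agents I * p)) (decode I s2 ''X'' 0) (decode I s' ''X'' 0)"
      by (rule chain_map[where f = "\<lambda>A. A 0"]) (rule local_search_step_improving[OF af U], use w w2 in simp_all)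
    then show "chain (\<lambda>_. assignment_function.improving_step (worth I) (items I) (agents I) p) (agents I * (agents I * p)) {} (decode I s' ''X'' 0)"
      using e U by simp
  qed
qed

section \<open>Expectations as sums with natural-number weights\<close>

lemma avg_scaled:
  assumes "L \<ge> 1"
  shows "real L ^ K * avg (1 / real L) K g = (\<Sum>S\<in>Pow {..<K}. real ((L - 1) ^ (K - card S)) * g S)"
  unfolding avg_eq_sum sum_distrib_left
proof (intro sum.cong refl)
  fix S assume "S \<in> Pow {..<K}"
  then have "card S \<le> card {..<K}" by (intro card_mono) auto
  then have K: "K = card S + (K - card S)" by simp
  have "real L ^ K = real L ^ card S * real L ^ (K - card S)" by (subst K) (rule power_add)
  then have "real L ^ K * ((1 / real L) ^ card S * (1 - 1 / real L) ^ (K - card S)) =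
    (real L * (1 / real L)) ^ card S * (real L * (1 - 1 / real L)) ^ (K - card S)"
    by (simp only: power_mult_distrib) (simp only: mult_ac)
  also have "\<dots> = real ((L - 1) ^ (K - card S))"
  proof -
    have "real L * (1 / real L) = 1" "real L * (1 - 1 / real L) = real (L - 1)" using assms by (auto simp: field_simps of_nat_diff)
    then show ?thesis by simp
  qed
  finally show "real L ^ K * ((1 / real L) ^ card S * (1 - 1 / real L) ^ (K - card S) * g S) = real ((L - 1) ^ (K - card S)) * g S"
    by (simp only: mult.assoc[symmetric])
qed

text \<open>With \<open>d = 1 / L\<close>, an outcome including \<open>i\<close> of \<open>K\<close>
  blocks has probability \<open>(L - 1) ^ (K - i) / L ^ K\<close>. The common denominator is
  dropped, which does not affect maximization.\<close>

definition full_weight :: "(nat \<Rightarrow> nat set) \<Rightarrow> nat \<Rightarrow> nat \<Rightarrow> nat \<Rightarrow> nat" where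
  "full_weight J L K a = (L - 1) ^ (K - card (J a))"

text \<open>The sum of the weighted values \<open>h (J a)\<close> is a multiple of the potential \<open>Psi\<close> of round \<open>t\<close>.\<close>

definition round_weight :: "(nat \<Rightarrow> nat set) \<Rightarrow> nat \<Rightarrow> nat \<Rightarrow> nat \<Rightarrow> nat \<Rightarrow> nat" where
  "round_weight J L l t a = (if \<exists>r<l. J a - {..<t * l} = {t * l + r} then (L - 1) ^ (t * l - card (J a \<inter> {..<t * l})) else 0)"

lemma sum_full_weight:
  assumes J: "bij_betw J {..<2 ^ K} (Pow {..<K})" and L: "L \<ge> 1"
  shows "(\<Sum>a<2 ^ K. real (full_weight J L K a) * h (J a)) = real L ^ K * avg (1 / real L) K h"
  unfolding avg_scaled[OF L] full_weight_def
  by (rule sum.reindex_bij_betw[OF J, of "\<lambda>S. real ((L - 1) ^ (K - card S)) * h S"])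

text \<open>Index sets with exactly one element from \<open>t * l\<close> on, lying in round
  \<open>t\<close>, correspond to pairs of that element and an arbitrary set of earlier indices; all
  other index sets have weight 0.\<close>

lemma sum_round_weight:
  assumes J: "bij_betw J {..<2 ^ K} (Pow {..<K})" and L: "L \<ge> 1" and t: "t * l + l \<le> K"
  shows "(\<Sum>a<2 ^ K. real (round_weight J L l t a) * h (J a)) =
    real L ^ (t * l) * (\<Sum>r<l. avg (1 / real L) (t * l) (\<lambda>S. h (insert (t * l + r) S)))"
proof -
  let ?K = "t * l"
  let ?w = "\<lambda>S. real (if \<exists>r<l. S - {..<?K} = {?K + r} then (L - 1) ^ (?K - card (S \<inter> {..<?K})) else 0)"
  let ?f = "\<lambda>(r, T). insert (?K + r) T"
  let ?P = "{..<l} \<times> Pow {..<?K}"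
  have fS: "?f (r, T) - {..<?K} = {?K + r}" "?f (r, T) \<inter> {..<?K} = T" if "T \<subseteq> {..<?K}" for r T using that by auto
  have inj: "inj_on ?f ?P"
  proof (rule inj_onI, clarify)
    fix r r' T T' assume "T \<subseteq> {..<?K}" "T' \<subseteq> {..<?K}" "insert (?K + r) T = insert (?K + r') T'"
    then have "{?K + r} = {?K + r'}" "T = T'" using fS[of T r] fS[of T' r'] by auto
    then show "r = r' \<and> T = T'" by simp
  qed
  have "(\<Sum>a<2 ^ K. real (round_weight J L l t a) * h (J a)) = (\<Sum>S\<in>Pow {..<K}. ?w S * h S)"
    unfolding round_weight_def by (rule sum.reindex_bij_betw[OF J, of "\<lambda>S. ?w S * h S"])
  also have "\<dots> = (\<Sum>S\<in>?f ` ?P. ?w S * h S)"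
  proof (rule sum.mono_neutral_right)
    show "?f ` ?P \<subseteq> Pow {..<K}" using t by auto
    show "\<forall>S\<in>Pow {..<K} - ?f ` ?P. ?w S * h S = 0"
    proof
      fix S assume S: "S \<in> Pow {..<K} - ?f ` ?P"
      have "\<not> (\<exists>r<l. S - {..<?K} = {?K + r})"
      proof
        assume "\<exists>r<l. S - {..<?K} = {?K + r}"
        then obtain r where r: "r < l" "S - {..<?K} = {?K + r}" by blast
        then have "S = ?f (r, S \<inter> {..<?K})" by auto
        then have "S \<in> ?f ` ?P" using r by (intro image_eqI[of _ _ "(r, S \<inter> {..<?K})"]) auto
        then show False using S by blast
      qed
      then show "?w S * h S = 0" by (simp only: if_False of_nat_0 mult_zero_left)
    qed
  qed simp
  also have "\<dots> = (\<Sum>x\<in>?P. ?w (?f x) * h (?f x))" by (rule sum.reindex[OF inj, unfolded o_def])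
  also have "\<dots> = (\<Sum>(r, T)\<in>?P. real ((L - 1) ^ (?K - card T)) * h (insert (?K + r) T))"
  proof (intro sum.cong refl)
    fix x assume "x \<in> ?P"
    then obtain r T where x: "x = (r, T)" and r: "r \<in> {..<l}" and T: "T \<subseteq> {..<?K}" by (cases x) auto
    have "\<exists>r'<l. insert (?K + r) T - {..<?K} = {?K + r'}" using fS(1)[OF T, of r] r by auto
    moreover have "insert (?K + r) T \<inter> {..<?K} = T" using fS(2)[OF T, of r] by simp
    ultimately show "?w (?f x) * h (?f x) = (case x of (r, T) \<Rightarrow> real ((L - 1) ^ (?K - card T)) * h (insert (?K + r) T))"
      unfolding x prod.case by (simp only: if_True)
  qed
  also have "\<dots> = (\<Sum>r<l. \<Sum>T\<in>Pow {..<?K}. real ((L - 1) ^ (?K - card T)) * h (insert (?K + r) T))"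
    by (rule sum.cartesian_product[symmetric])
  also have "\<dots> = (\<Sum>r<l. real L ^ ?K * avg (1 / real L) ?K (\<lambda>S. h (insert (?K + r) S)))"
    by (intro sum.cong refl avg_scaled[OF L, symmetric])
  finally show ?thesis by (simp add: sum_distrib_left)
qed

definition best_choice :: "nat \<Rightarrow> bool \<Rightarrow> bool \<Rightarrow> (nat \<Rightarrow> bool) list \<Rightarrow> msw \<Rightarrow> store \<Rightarrow> nat \<Rightarrow> family \<Rightarrow> family \<Rightarrow> bool" where
  "best_choice U clr gd \<kappa>s I s v A A' \<longleftrightarrow> (\<exists>M\<in>choices I s clr gd \<kappa>s (Suc v) A. (\<forall>a<U. A' a = M a) \<and>
     (\<forall>C\<in>choices I s clr gd \<kappa>s (Suc v) A. weighted I U s C \<le> weighted I U s M))"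

definition sweep :: "nat \<Rightarrow> bool \<Rightarrow> bool \<Rightarrow> (nat \<Rightarrow> bool) list \<Rightarrow> (nat \<Rightarrow> nat) \<Rightarrow> com list" where
  "sweep U clr gd \<kappa>s \<omega> = load U ''w'' \<omega> @ For_agent ''q'' (optimize U clr gd \<kappa>s)"

definition sweep_vars :: "string set" where
  "sweep_vars = scratch \<union> {''c'', ''X'', ''q'', ''w''}"

text \<open>\<open>s1\<close> is the store after loading the weights. The choices and their values
  depend on the store only through \<open>S\<close> and \<open>w\<close>, which the loop over the
  agents keeps.\<close>

lemma prog_sweep:
  "prog (sweep U clr gd \<kappa>s \<omega>) (\<lambda>I s s'. keep sweep_vars s s' \<and>
     (\<exists>s1. nmem s1 ''S'' = nmem s ''S'' \<and> (\<forall>a<U. nmem s1 ''w'' [a] = \<omega> a) \<and>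
       chain (best_choice U clr gd \<kappa>s I s1) (agents I) (decode I s ''X'') (decode I s' ''X'')))"
proof -
  let ?N = "scratch \<union> {''c'', ''X''}"
  have "prog (For_agent ''q'' (optimize U clr gd \<kappa>s)) (\<lambda>I s s'. keep (insert ''q'' ?N) s s' \<and>
    ((\<forall>u. 1 \<le> u \<longrightarrow> u < agents I + 1 \<longrightarrow> u \<in> {1..agents I}) \<longrightarrow>
      chain (best_choice U clr gd \<kappa>s I s) (agents I + 1 - 1) (decode I s ''X'') (decode I s' ''X'')))"
  proof (rule prog_For_chain[where g = "\<lambda>I s u. u \<in> {1..agents I}" and st = "\<lambda>I s. best_choice U clr gd \<kappa>s I s" and N = ?N,
      OF _ _ _ _ agent_bound polynomially_bounded_intros(4)[OF polynomially_bounded_intros(2,1)]])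
    show "prog (optimize U clr gd \<kappa>s) (\<lambda>I s s'. keep ?N s s' \<and> (nmem s ''q'' [] \<in> {1..agents I} \<longrightarrow>
      best_choice U clr gd \<kappa>s I s (nmem s ''q'' [] - 1) (decode I s ''X'') (decode I s' ''X'')))"
    proof (rule prog_weaken[OF prog_optimize], elim conjE, intro conjI impI)
      fix I :: msw and s s' :: store
      assume q: "nmem s ''q'' [] \<in> {1..agents I}" and *: "nmem s ''q'' [] \<in> {1..agents I} \<longrightarrow>
      (\<exists>A\<in>choices I s clr gd \<kappa>s (nmem s ''q'' []) (decode I s ''X''). (\<forall>a<U. decode I s' ''X'' a = A a) \<and>
        (\<forall>C\<in>choices I s clr gd \<kappa>s (nmem s ''q'' []) (decode I s ''X''). weighted I U s C \<le> weighted I U s A))"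
      have "Suc (nmem s ''q'' [] - 1) = nmem s ''q'' []" using q by simp
      then show "best_choice U clr gd \<kappa>s I s (nmem s ''q'' [] - 1) (decode I s ''X'') (decode I s' ''X'')"
        unfolding best_choice_def using mp[OF * q] by (simp only:)
    qed
    fix I :: msw and s s' :: store assume k: "keep (insert ''q'' ?N) s s'"
    have "weighted I U s' C = weighted I U s C" for C by (rule weighted_keep[OF k]) simp
    moreover have "nmem s' ''S'' = nmem s ''S''" by (rule keepN[OF k]) simp
    ultimately have "best_choice U clr gd \<kappa>s I s' = best_choice U clr gd \<kappa>s I s"
      unfolding best_choice_def choices_def by (intro ext) (simp only:)
    then show "(\<lambda>u. u \<in> {1..agents I}) = (\<lambda>u. u \<in> {1..agents I}) \<and> best_choice U clr gd \<kappa>s I s' = best_choice U clr gd \<kappa>s I s"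
      by simp
  qed simp_all
  note loop = this
  show ?thesis unfolding sweep_def
  proof (rule prog_weaken[OF prog_append[OF prog_load loop]], elim exE conjE, intro conjI)
    fix I :: msw and s s1 s' :: store
    assume k1: "keep {''w''} s s1" and w: "\<forall>a<U. nmem s1 ''w'' [a] = \<omega> a" and k2: "keep (insert ''q'' ?N) s1 s'"
      and ch: "(\<forall>u. 1 \<le> u \<longrightarrow> u < agents I + 1 \<longrightarrow> u \<in> {1..agents I}) \<longrightarrow>
        chain (best_choice U clr gd \<kappa>s I s1) (agents I + 1 - 1) (decode I s1 ''X'') (decode I s' ''X'')"
    show "keep sweep_vars s s'" by (rule keep_trans[OF k1 k2]) (auto simp: sweep_vars_def)
    have "\<forall>u. 1 \<le> u \<longrightarrow> u < agents I + 1 \<longrightarrow> u \<in> {1..agents I}" by simp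
    from mp[OF ch this] have "chain (best_choice U clr gd \<kappa>s I s1) (agents I) (decode I s ''X'') (decode I s' ''X'')"
      using decode_keep[OF k1, of "''X''"] by simp
    moreover have "nmem s1 ''S'' = nmem s ''S''" using keepN[OF k1] by simp
    ultimately show "\<exists>s1. nmem s1 ''S'' = nmem s ''S'' \<and> (\<forall>a<U. nmem s1 ''w'' [a] = \<omega> a) \<and>
       chain (best_choice U clr gd \<kappa>s I s1) (agents I) (decode I s ''X'') (decode I s' ''X'')" using w by blast
  qed
qed

text \<open>Inserting a pair into block \<open>t * l + r\<close> means inserting it into every
  outcome whose index set contains \<open>t * l + r\<close>. Under this correspondence the objective
  is \<open>L ^ (t * l)\<close> times \<open>Psi\<close>, so maximizers agree.\<close>

lemma best_choice_greedy_step: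
  assumes af: "assignment_function (worth I)" and J: "bij_betw J {..<2 ^ K} (Pow {..<K})" and L: "L \<ge> 1"
    and t: "t * l + l \<le> K" and v: "v < agents I"
    and w: "\<forall>a<2 ^ K. nmem s ''w'' [a] = round_weight J L l t a"
    and F: "F = (if gd then stored I s else {})"
    and AB: "\<forall>a<2 ^ K. A a = (\<Union>k\<in>J a. B k)"
    and ch: "best_choice (2 ^ K) False gd (map (\<lambda>r a. t * l + r \<in> J a) [0..<l]) I s v A A'"
  shows "\<exists>B'. (\<forall>a<2 ^ K. A' a = (\<Union>k\<in>J a. B' k)) \<and>
    assignment_function.greedy_step (worth I) (1 / real L) (t * l) l (items I) F v B B'"
proof -
  let ?d = "1 / real L" and ?K = "t * l"
  let ?\<kappa>s = "map (\<lambda>r a. t * l + r \<in> J a) [0..<l]"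
  let ?Ch = "choices I s False gd ?\<kappa>s (Suc v) A"
  let ?Psi = "assignment_function.Psi (worth I) ?d ?K l"
  let ?upd = "\<lambda>r c. B(?K + r := insert (c, Suc v) (B (?K + r)))"
  have val: "weighted I (2 ^ K) s C = real L ^ ?K * ?Psi B'" if "\<forall>a<2 ^ K. C a = (\<Union>k\<in>J a. B' k)" for C B'
  proof -
    have "weighted I (2 ^ K) s C = (\<Sum>a<2 ^ K. real (round_weight J L l t a) * worth I (\<Union>k\<in>J a. B' k))"
      unfolding weighted_def using that w by (intro sum.cong) auto
    also have "\<dots> = real L ^ ?K * (\<Sum>r<l. avg ?d ?K (\<lambda>S. worth I (\<Union>k\<in>insert (?K + r) S. B' k)))"
      by (rule sum_round_weight[OF J L t])
    also have "(\<Sum>r<l. avg ?d ?K (\<lambda>S. worth I (\<Union>k\<in>insert (?K + r) S. B' k))) = ?Psi B'"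
      unfolding assignment_function.Psi_def[OF af] by (simp add: Un_commute)
    finally show ?thesis .
  qed
  have base: "modify False none 0 (Suc v) A = A" by (simp add: modify_def)
  have upd: "\<forall>a<2 ^ K. modify False (\<lambda>a. ?K + r \<in> J a) c (Suc v) A a = (\<Union>k\<in>J a. ?upd r c k)" for r c
    using AB by (auto simp: modify_def)
  have Fc: "(c, Suc v) \<notin> F \<longleftrightarrow> (gd \<longrightarrow> nmem s ''S'' [c, Suc v] = 0)" if "c \<in> {1..items I}" for c
    using that v unfolding F stored_def by auto
  have chs: "modify False (\<lambda>a. ?K + r \<in> J a) c (Suc v) A \<in> ?Ch" if "r < l" "c \<in> {1..items I}" "(c, Suc v) \<notin> F" for r c
    unfolding choices_iff using that Fc[OF that(2)] by (intro disjI2 bexI[of _ c] conjI bexI[of _ "\<lambda>a. ?K + r \<in> J a"]) auto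
  have Lp: "real L ^ ?K > 0" using L by simp
  obtain M where M: "M \<in> ?Ch" "\<forall>a<2 ^ K. A' a = M a" "\<And>C. C \<in> ?Ch \<Longrightarrow> weighted I (2 ^ K) s C \<le> weighted I (2 ^ K) s M"
    using ch unfolding best_choice_def by blast
  have "\<exists>B'. (\<forall>a<2 ^ K. M a = (\<Union>k\<in>J a. B' k)) \<and>
     (B' = B \<or> (\<exists>r<l. \<exists>c\<in>{1..items I}. (c, Suc v) \<notin> F \<and> B' = ?upd r c))"
  proof -
    from M(1) consider "M = A" | c r where "c \<in> {1..items I}" "gd \<longrightarrow> nmem s ''S'' [c, Suc v] = 0" "r < l"
      "M = modify False (\<lambda>a. ?K + r \<in> J a) c (Suc v) A"
      unfolding choices_iff base by auto
    then show ?thesis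
    proof cases
      case 1
      then show ?thesis using AB by (intro exI[of _ B]) simp
    next
      case 2
      then show ?thesis using upd[of r c] Fc[of c] by (intro exI[of _ "?upd r c"]) blast
    qed
  qed
  then obtain B' where B': "\<forall>a<2 ^ K. M a = (\<Union>k\<in>J a. B' k)"
     "B' = B \<or> (\<exists>r<l. \<exists>c\<in>{1..items I}. (c, Suc v) \<notin> F \<and> B' = ?upd r c)" by blast
  have le: "?Psi B'' \<le> ?Psi B'" if "C \<in> ?Ch" "\<forall>a<2 ^ K. C a = (\<Union>k\<in>J a. B'' k)" for C B''
  proof -
    have "real L ^ ?K * ?Psi B'' \<le> real L ^ ?K * ?Psi B'"
      using M(3)[OF that(1)] unfolding val[OF that(2)] val[OF B'(1)] .
    then show ?thesis using Lp by (simp only: mult_le_cancel_left_pos)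
  qed
  have "A \<in> ?Ch" unfolding choices_iff base by simp
  then have "?Psi B \<le> ?Psi B'" using AB by (rule le)
  moreover have "?Psi (?upd r c) \<le> ?Psi B'" if "r < l" "c \<in> {1..items I}" "(c, Suc v) \<notin> F" for r c
    using chs[OF that] upd by (rule le)
  ultimately have "assignment_function.greedy_step (worth I) ?d ?K l (items I) F v B B'"
    unfolding assignment_function.greedy_step_def[OF af] using B'(2) by blast
  then show ?thesis using B'(1) M(2) by auto
qed

lemma best_choice_rounding_step:
  assumes af: "assignment_function (worth I)" and J: "bij_betw J {..<2 ^ K} (Pow {..<K})" and L: "L \<ge> 1"
    and w: "\<forall>a<2 ^ K. nmem s ''w'' [a] = full_weight J L K a"
    and AG: "\<forall>a<2 ^ K. A a = G (J a)"
    and ch: "best_choice (2 ^ K) True False [all] I s v A A'"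
  shows "\<exists>G'. (\<forall>a<2 ^ K. A' a = G' (J a)) \<and>
    assignment_function.rounding_step (worth I) (1 / real L) K (items I) v G G'"
proof -
  let ?d = "1 / real L"
  let ?Ch = "choices I s True False [all] (Suc v) A"
  define D where "D S = {e \<in> G S. snd e \<noteq> Suc v}" for S
  have val: "weighted I (2 ^ K) s C = real L ^ K * avg ?d K (\<lambda>S. worth I (H S))" if "\<forall>a<2 ^ K. C a = H (J a)" for C H
  proof -
    have "weighted I (2 ^ K) s C = (\<Sum>a<2 ^ K. real (full_weight J L K a) * worth I (H (J a)))"
      unfolding weighted_def using that w by (intro sum.cong) auto
    also have "\<dots> = real L ^ K * avg ?d K (\<lambda>S. worth I (H S))" by (rule sum_full_weight[OF J L])
    finally show ?thesis .
  qed
  have base: "\<forall>a<2 ^ K. modify True none 0 (Suc v) A a = D (J a)" using AG by (simp add: modify_def D_def)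
  have ins: "\<forall>a<2 ^ K. modify True all c (Suc v) A a = insert (c, Suc v) (D (J a))" for c using AG by (simp add: modify_def D_def)
  have Lp: "real L ^ K > 0" using L by simp
  obtain M where M: "M \<in> ?Ch" "\<forall>a<2 ^ K. A' a = M a" "\<And>C. C \<in> ?Ch \<Longrightarrow> weighted I (2 ^ K) s C \<le> weighted I (2 ^ K) s M"
    using ch unfolding best_choice_def by blast
  from M(1) consider "M = modify True none 0 (Suc v) A" | c where "c \<in> {1..items I}" "M = modify True all c (Suc v) A"
    unfolding choices_iff by auto
  then have "\<exists>G'. (\<forall>a<2 ^ K. M a = G' (J a)) \<and> (G' = D \<or> (\<exists>c\<in>{1..items I}. G' = (\<lambda>S. insert (c, Suc v) (D S))))"
  proof cases
    case 1
    then show ?thesis using base by (intro exI[of _ D]) simp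
  next
    case 2
    then show ?thesis using ins[of c] by (intro exI[of _ "\<lambda>S. insert (c, Suc v) (D S)"]) auto
  qed
  then obtain G' where "(\<forall>a<2 ^ K. M a = G' (J a)) \<and> (G' = D \<or> (\<exists>c\<in>{1..items I}. G' = (\<lambda>S. insert (c, Suc v) (D S))))" by (rule exE)
  note G' = conjunct1[OF this] conjunct2[OF this]
  have le: "avg ?d K (\<lambda>S. worth I (H S)) \<le> avg ?d K (\<lambda>S. worth I (G' S))" if "C \<in> ?Ch" "\<forall>a<2 ^ K. C a = H (J a)" for C H
  proof -
    have "real L ^ K * avg ?d K (\<lambda>S. worth I (H S)) \<le> real L ^ K * avg ?d K (\<lambda>S. worth I (G' S))"
      using M(3)[OF that(1)] unfolding val[OF that(2)] val[OF G'(1)] .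
    then show ?thesis using Lp by (simp only: mult_le_cancel_left_pos)
  qed
  have "modify True none 0 (Suc v) A \<in> ?Ch" unfolding choices_iff by simp
  then have "avg ?d K (\<lambda>S. worth I (D S)) \<le> avg ?d K (\<lambda>S. worth I (G' S))" using base by (rule le)
  moreover have "avg ?d K (\<lambda>S. worth I (insert (c, Suc v) (D S))) \<le> avg ?d K (\<lambda>S. worth I (G' S))" if "c \<in> {1..items I}" for c
  proof (rule le)
    show "modify True all c (Suc v) A \<in> ?Ch" unfolding choices_iff using that by auto
    show "\<forall>a<2 ^ K. modify True all c (Suc v) A a = insert (c, Suc v) (D (J a))" by (rule ins)
  qed
  ultimately have "assignment_function.rounding_step (worth I) ?d K (items I) v G G'"
    unfolding assignment_function.rounding_step_def[OF af] Let_def using G'(2) unfolding D_def by blast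
  then show ?thesis using G'(1) M(2) by auto
qed

text \<open>A simulation argument: \<open>R\<close> relates the stored family to its mathematical
  description, either by blocks or by a function of outcomes.\<close>

lemma chain_abstract:
  assumes "chain st n x x'" "R x y" "\<And>v x x' y. v < n \<Longrightarrow> st v x x' \<Longrightarrow> R x y \<Longrightarrow> \<exists>y'. R x' y' \<and> st' v y y'"
  shows "\<exists>y'. R x' y' \<and> chain st' n y y'"
  using assms
proof (induction n arbitrary: x')
  case (Suc n)
  then obtain z where z: "chain st n x z" "st n z x'" by auto
  obtain y1 where "R z y1" "chain st' n y y1" using Suc.IH[OF z(1) Suc.prems(2)] Suc.prems(3) by force
  then show ?case using Suc.prems(3)[OF _ z(2), of y1] by auto
qed auto

section \<open>The algorithm\<close>

text \<open>The rounds are unrolled, since each needs its own table of weights; only the first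
  \<open>N\<close> are guarded against pairs in \<open>S\<close>.\<close>

definition greedy_rounds :: "(nat \<Rightarrow> nat set) \<Rightarrow> nat \<Rightarrow> nat \<Rightarrow> nat \<Rightarrow> nat \<Rightarrow> com list" where
  "greedy_rounds J L l N t = concat (map (\<lambda>t. sweep (2 ^ (L * l)) False (t < N)
     (map (\<lambda>r a. t * l + r \<in> J a) [0..<l]) (round_weight J L l t)) [0..<t])"

lemma prog_greedy_rounds:
  assumes J: "bij_betw J {..<2 ^ (L * l)} (Pow {..<L * l})" and L: "L \<ge> 1" and l: "l \<ge> 1"
  shows "prog (greedy_rounds J L l N t) (\<lambda>I s s'. keep sweep_vars s s' \<and>
    (assignment_function (worth I) \<longrightarrow> t \<le> L \<longrightarrow> (\<forall>a<2 ^ (L * l). decode I s ''X'' a = {}) \<longrightarrow>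
     (\<exists>B. (\<forall>a<2 ^ (L * l). decode I s' ''X'' a = (\<Union>k\<in>J a. B k)) \<and> (\<forall>k\<ge>t * l. B k = {}) \<and>
       (\<forall>u<t. assignment_function.good_round (worth I) (1 / real L) l ({1..items I} \<times> {1..agents I})
          (if u < N then stored I s else {}) u B))))"
proof (induction t)
  case 0
  show ?case unfolding greedy_rounds_def
    by (simp, rule prog_weaken[OF prog_Nil]) (auto intro!: exI[of _ "\<lambda>_. {}"])
next
  case (Suc t)
  let ?U = "2 ^ (L * l) :: nat" and ?d = "1 / real L"
  let ?P = "sweep ?U False (t < N) (map (\<lambda>r a. t * l + r \<in> J a) [0..<l]) (round_weight J L l t)"
  have "greedy_rounds J L l N (Suc t) = greedy_rounds J L l N t @ ?P" by (simp add: greedy_rounds_def)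
  moreover have "prog (greedy_rounds J L l N t @ ?P) (\<lambda>I s s'. keep sweep_vars s s' \<and>
    (assignment_function (worth I) \<longrightarrow> Suc t \<le> L \<longrightarrow> (\<forall>a<?U. decode I s ''X'' a = {}) \<longrightarrow>
     (\<exists>B. (\<forall>a<?U. decode I s' ''X'' a = (\<Union>k\<in>J a. B k)) \<and> (\<forall>k\<ge>Suc t * l. B k = {}) \<and>
       (\<forall>u<Suc t. assignment_function.good_round (worth I) ?d l ({1..items I} \<times> {1..agents I})
          (if u < N then stored I s else {}) u B))))"
  proof (rule prog_weaken[OF prog_append[OF Suc prog_sweep]], elim exE conjE, intro conjI impI)
    fix I :: msw and s s1 s' s2 :: store
    assume k1: "keep sweep_vars s s1" and k2: "keep sweep_vars s1 s'"
    show "keep sweep_vars s s'" by (rule keep_trans[OF k1 k2]) auto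
    assume af: "assignment_function (worth I)" and tL: "Suc t \<le> L" and e: "\<forall>a<?U. decode I s ''X'' a = {}"
      and IH: "assignment_function (worth I) \<longrightarrow> t \<le> L \<longrightarrow> (\<forall>a<?U. decode I s ''X'' a = {}) \<longrightarrow>
       (\<exists>B. (\<forall>a<?U. decode I s1 ''X'' a = (\<Union>k\<in>J a. B k)) \<and> (\<forall>k\<ge>t * l. B k = {}) \<and>
       (\<forall>u<t. assignment_function.good_round (worth I) ?d l ({1..items I} \<times> {1..agents I})
          (if u < N then stored I s else {}) u B))"
      and S: "nmem s2 ''S'' = nmem s1 ''S''" and w: "\<forall>a<?U. nmem s2 ''w'' [a] = round_weight J L l t a"
      and ch: "chain (best_choice ?U False (t < N) (map (\<lambda>r a. t * l + r \<in> J a) [0..<l]) I s2) (agents I)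
        (decode I s1 ''X'') (decode I s' ''X'')"
    let ?E = "{1..items I} \<times> {1..agents I}"
    define F where "F = (if t < N then stored I s2 else {})"
    have "nmem s1 ''S'' = nmem s ''S''" using keepN[OF k1, of "''S''"] by (simp add: sweep_vars_def)
    then have F: "F = (if t < N then stored I s else {})" unfolding F_def stored_def S by simp
    have "t \<le> L" using tL by simp
    from mp[OF mp[OF mp[OF IH af] this] e] obtain B where B: "\<forall>a<?U. decode I s1 ''X'' a = (\<Union>k\<in>J a. B k)" "\<forall>k\<ge>t * l. B k = {}"
       "\<forall>u<t. assignment_function.good_round (worth I) ?d l ?E (if u < N then stored I s else {}) u B" by (elim exE conjE)
    have "Suc t * l \<le> L * l" using tL by (rule mult_le_mono1)
    then have tl: "t * l + l \<le> L * l" by simp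
    have "\<exists>B'. (\<forall>a<?U. decode I s' ''X'' a = (\<Union>k\<in>J a. B' k)) \<and>
      chain (assignment_function.greedy_step (worth I) ?d (t * l) l (items I) F) (agents I) B B'"
      by (rule chain_abstract[where R = "\<lambda>A B. \<forall>a<?U. A a = (\<Union>k\<in>J a. B k)", OF ch B(1)])
        (rule best_choice_greedy_step[OF af J L tl _ w F_def])
    then obtain B' where B': "\<forall>a<?U. decode I s' ''X'' a = (\<Union>k\<in>J a. B' k)"
      and ch': "chain (assignment_function.greedy_step (worth I) ?d (t * l) l (items I) F) (agents I) B B'" by (elim exE conjE)
    have emp: "B (t * l + r) = {}" if "r < l" for r using B(2) by simp
    \<comment> \<open>Only the blocks of round \<open>t\<close> change, so earlier rounds remain
      good and later blocks remain empty.\<close>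
    have old: "B' k = B k" if "k \<notin> {t * l..<t * l + l}" for k
      by (rule assignment_function.greedy_chain_basic(1)[OF af ch' emp that])
    have "assignment_function.good_round (worth I) ?d l ?E (if u < N then stored I s else {}) u B'" if u: "u < Suc t" for u
    proof (cases "u = t")
      case True
      have "assignment_function.good_round (worth I) ?d l ?E F t B'"
        by (rule assignment_function.greedy_chain_good_round[OF af ch' emp]) (use L l in \<open>auto simp: field_simps\<close>)
      then show ?thesis unfolding F True .
    next
      case False
      then have ut: "u < t" using u by simp
      have "Suc u * l \<le> t * l" using ut by (intro mult_le_mono1) simp
      then have "B k = B' k" if "k < Suc u * l" for k using old[of k] that by simp
      then show ?thesis using assignment_function.good_round_cong[OF af, of u l B B'] B(3) ut by blast
    qed
    then have "\<forall>u<Suc t. assignment_function.good_round (worth I) ?d l ?E (if u < N then stored I s else {}) u B'"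
      by (intro allI impI)
    moreover have "\<forall>k\<ge>Suc t * l. B' k = {}" using old B(2) by simp
    ultimately show "\<exists>B. (\<forall>a<?U. decode I s' ''X'' a = (\<Union>k\<in>J a. B k)) \<and> (\<forall>k\<ge>Suc t * l. B k = {}) \<and>
       (\<forall>u<Suc t. assignment_function.good_round (worth I) ?d l ?E (if u < N then stored I s else {}) u B)"
      using B' by (intro exI[of _ B'] conjI)
  qed
  ultimately show ?case by (simp only:)
qed

text \<open>Setting \<open>q\<close> to 1 only makes the agent valid for the trial, which inserts
  nothing; this is where at least one agent is required.\<close>

definition evaluate :: "nat \<Rightarrow> com list" where
  "evaluate U = [NAssign ''q'' [] (NConst 1)] @ assess U False none"

lemma prog_evaluate:
  "prog (evaluate U) (\<lambda>I s s'. keep (insert ''q'' scratch) s s' \<and>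
     (agents I \<ge> 1 \<longrightarrow> rmem s' ''val'' [] = weighted I U s (decode I s ''X'')))"
  unfolding evaluate_def
proof (rule prog_weaken[OF prog_append[OF prog_NAssign prog_assess]], elim exE conjE, intro conjI impI)
  fix I :: msw and s s1 s' :: store
  assume s1: "s1 = nwrite ''q'' (map (nval I s) []) (nval I s (NConst 1)) s"
    and k: "keep (scratch - {''best'', ''B''}) s1 s'"
  have k1: "keep {''q''} s s1" unfolding s1 by (rule keep_nwrite) simp_all
  show "keep (insert ''q'' scratch) s s'" by (rule keep_trans[OF k1 k]) auto
  assume n: "agents I \<ge> 1"
    and *: "nmem s1 ''q'' [] \<in> {1..agents I} \<longrightarrow> nmem s1 ''c'' [] \<in> {1..items I} \<or> (\<forall>a<U. \<not> False) \<longrightarrow>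
      (\<forall>a<U. decode I s' ''Y'' a = modify False none (nmem s1 ''c'' []) (nmem s1 ''q'' []) (decode I s1 ''X'') a) \<and>
      rmem s' ''val'' [] = weighted I U s1 (modify False none (nmem s1 ''c'' []) (nmem s1 ''q'' []) (decode I s1 ''X''))"
  have 1: "nmem s1 ''q'' [] \<in> {1..agents I}" using n by (simp add: s1)
  have 2: "nmem s1 ''c'' [] \<in> {1..items I} \<or> (\<forall>a<U. \<not> False)" by simp
  have "modify False none c q A = A" for c q A by (simp add: modify_def)
  then have "rmem s' ''val'' [] = weighted I U s1 (decode I s1 ''X'')" using conjunct2[OF mp[OF mp[OF * 1] 2]] by simp
  then show "rmem s' ''val'' [] = weighted I U s (decode I s ''X'')"
    using weighted_keep[OF k1] decode_keep[OF k1] by simp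
qed

text \<open>\<open>S\<close> has two roles: it records the local optimum as forbidden set for the
  early rounds, and it is the output unless the rounded set turns out better. Here \<open>J\<close>
  enumerates the index sets and is fixed with the program.\<close>

definition algorithm :: "(nat \<Rightarrow> nat set) \<Rightarrow> nat \<Rightarrow> nat \<Rightarrow> nat \<Rightarrow> nat \<Rightarrow> com list" where
  "algorithm J L l N p = (let U = 2 ^ (L * l) in
     local_phase U p @ evaluate U @ [RAssign ''zval'' [] (RVar ''val'' [])] @ save @ reset U @
     greedy_rounds J L l N L @ sweep U True False [all] (full_weight J L (L * l)) @
     load U ''w'' (\<lambda>a. of_bool (a = 0)) @ evaluate U @ [Cond (RLess (RVar ''zval'' []) (RVar ''val'' [])) save []])"

lemma prog_algorithm:
  assumes J: "bij_betw J {..<2 ^ (L * l)} (Pow {..<L * l})" and L: "L \<ge> 1" and l: "l \<ge> 1"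
  shows "prog (algorithm J L l N p) (\<lambda>I s s'. agents I \<ge> 1 \<longrightarrow> assignment_function (worth I) \<longrightarrow>
    (\<exists>Z B G S. chain (\<lambda>_. assignment_function.improving_step (worth I) (items I) (agents I) p) (agents I * (agents I * p)) {} Z \<and>
      (\<forall>k\<ge>L * l. B k = {}) \<and>
      (\<forall>u<L. assignment_function.good_round (worth I) (1 / real L) l ({1..items I} \<times> {1..agents I}) (if u < N then Z else {}) u B) \<and>
      chain (assignment_function.rounding_step (worth I) (1 / real L) (L * l) (items I)) (agents I) (\<lambda>S. \<Union>k\<in>S. B k) G \<and>
      stored I s' = (if worth I Z < worth I (G S) then G S else Z)))"
proof -
  define U where "U = (2 ^ (L * l) :: nat)"
  have U: "U \<ge> 1" by (simp add: U_def)
  note J' = J[folded U_def]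
  note steps = prog_append[OF prog_local_phase[OF U] prog_append[OF prog_evaluate prog_append[OF prog_RAssign
    prog_append[OF prog_save prog_append[OF prog_reset prog_append[OF prog_greedy_rounds[OF J L l, folded U_def]
    prog_append[OF prog_sweep prog_append[OF prog_load prog_append[OF prog_evaluate prog_Cond[OF prog_save prog_Nil]]]]]]]]]]
  show ?thesis unfolding algorithm_def Let_def U_def[symmetric]
  proof (rule prog_weaken[OF steps], elim exE conjE, intro impI)
    fix I :: msw and s s1 s2 s3 s4 s5 s6 s7 s8 s9 s' sw :: store
    assume n: "agents I \<ge> 1" and af: "assignment_function (worth I)"
      and w1: "\<forall>a<U. nmem s1 ''w'' [a] = of_bool (a = 0)"
      and ls: "agents I \<ge> 1 \<longrightarrow> assignment_function (worth I) \<longrightarrow>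
        chain (\<lambda>_. assignment_function.improving_step (worth I) (items I) (agents I) p) (agents I * (agents I * p)) {} (decode I s1 ''X'' 0)"
      and k2: "keep (insert ''q'' scratch) s1 s2" and v2: "agents I \<ge> 1 \<longrightarrow> rmem s2 ''val'' [] = weighted I U s1 (decode I s1 ''X'')"
      and s3: "s3 = rwrite ''zval'' (map (nval I s2) []) (rval I s2 (RVar ''val'' [])) s2"
      and k4: "keep {''i'', ''j'', ''S''} s3 s4" and S4: "stored I s4 = decode I s3 ''X'' 0"
      and k5: "keep {''a'', ''i'', ''j'', ''X''} s4 s5" and X5: "\<forall>a<U. decode I s5 ''X'' a = {}"
      and k6: "keep sweep_vars s5 s6"
      and cg: "assignment_function (worth I) \<longrightarrow> L \<le> L \<longrightarrow> (\<forall>a<U. decode I s5 ''X'' a = {}) \<longrightarrow>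
       (\<exists>B. (\<forall>a<U. decode I s6 ''X'' a = (\<Union>k\<in>J a. B k)) \<and> (\<forall>k\<ge>L * l. B k = {}) \<and>
       (\<forall>u<L. assignment_function.good_round (worth I) (1 / real L) l ({1..items I} \<times> {1..agents I})
          (if u < N then stored I s5 else {}) u B))"
      and k7: "keep sweep_vars s6 s7"
      and w7: "\<forall>a<U. nmem sw ''w'' [a] = full_weight J L (L * l) a"
      and ch7: "chain (best_choice U True False [all] I sw) (agents I) (decode I s6 ''X'') (decode I s7 ''X'')"
      and k8: "keep {''w''} s7 s8" and w8: "\<forall>a<U. nmem s8 ''w'' [a] = of_bool (a = 0)"
      and k9: "keep (insert ''q'' scratch) s8 s9" and v9: "agents I \<ge> 1 \<longrightarrow> rmem s9 ''val'' [] = weighted I U s8 (decode I s8 ''X'')"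
      and s': "if bval I s9 (RLess (RVar ''zval'' []) (RVar ''val'' [])) then keep {''i'', ''j'', ''S''} s9 s' \<and> stored I s' = decode I s9 ''X'' 0
        else s' = s9"
    define Z where "Z = decode I s1 ''X'' 0"
    have Zch: "chain (\<lambda>_. assignment_function.improving_step (worth I) (items I) (agents I) p) (agents I * (agents I * p)) {} Z"
      using mp[OF mp[OF ls n] af] unfolding Z_def .
    have val2: "rmem s2 ''val'' [] = worth I Z" using v2 n weighted_first[OF U w1] by (simp add: Z_def)
    have zval3: "rmem s3 ''zval'' [] = worth I Z" by (simp add: s3 val2)
    have k3: "keep {''zval''} s2 s3" unfolding s3 by (rule keep_rwrite) simp_all
    have "decode I s3 ''X'' = decode I s1 ''X''" using decode_keep[OF k2] decode_keep[OF k3] by simp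
    then have S4: "stored I s4 = Z" using S4 by (simp add: Z_def)
    have st: "stored I b = stored I a" if "keep M a b" "''S'' \<notin> M" for a b M
      unfolding stored_def keepN[OF that] ..
    have sv: "''S'' \<notin> sweep_vars" "''zval'' \<notin> sweep_vars" by (simp_all add: sweep_vars_def)
    have S5: "stored I s5 = Z" using st[OF k5] S4 by simp
    have S9: "stored I s9 = Z" using st[OF k6 sv(1)] st[OF k7 sv(1)] st[OF k8] st[OF k9] S5 by simp
    have zval9: "rmem s9 ''zval'' [] = worth I Z"
      using keepR[OF k4, of "''zval''"] keepR[OF k5, of "''zval''"] keepR[OF k6 sv(2)] keepR[OF k7 sv(2)] keepR[OF k8, of "''zval''"]
        keepR[OF k9, of "''zval''"] zval3 by simp
    obtain B where B: "\<forall>a<U. decode I s6 ''X'' a = (\<Union>k\<in>J a. B k)" "\<forall>k\<ge>L * l. B k = {}"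
       "\<forall>u<L. assignment_function.good_round (worth I) (1 / real L) l ({1..items I} \<times> {1..agents I}) (if u < N then stored I s5 else {}) u B"
      using mp[OF mp[OF mp[OF cg af] order_refl] X5] by (elim exE conjE)
    have "\<exists>G. (\<forall>a<U. decode I s7 ''X'' a = G (J a)) \<and>
      chain (assignment_function.rounding_step (worth I) (1 / real L) (L * l) (items I)) (agents I) (\<lambda>S. \<Union>k\<in>S. B k) G"
      by (rule chain_abstract[where R = "\<lambda>A G. \<forall>a<U. A a = G (J a)", OF ch7 B(1)])
        (rule best_choice_rounding_step[OF af J L, folded U_def, OF w7])
    then obtain G where G: "\<forall>a<U. decode I s7 ''X'' a = G (J a)"
      and Gch: "chain (assignment_function.rounding_step (worth I) (1 / real L) (L * l) (items I)) (agents I) (\<lambda>S. \<Union>k\<in>S. B k) G"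
      by (elim exE conjE)
    have X8: "decode I s8 ''X'' 0 = G (J 0)" "decode I s9 ''X'' 0 = G (J 0)"
      using decode_keep[OF k8, of "''X''"] decode_keep[OF k9, of "''X''"] G U by simp_all
    have "rmem s9 ''val'' [] = worth I (G (J 0))" using v9 n weighted_first[OF U w8] X8(1) by simp
    then have "bval I s9 (RLess (RVar ''zval'' []) (RVar ''val'' [])) \<longleftrightarrow> worth I Z < worth I (G (J 0))"
      using zval9 by simp
    then have "stored I s' = (if worth I Z < worth I (G (J 0)) then G (J 0) else Z)"
      using s' X8(2) S9 by (simp split: if_splits)
    \<comment> \<open>The program reads off outcome number 0, hence the witness \<open>J 0\<close>;
      by \<open>rounding\<close> any outcome would do.\<close>
    then show "\<exists>Z B G S. chain (\<lambda>_. assignment_function.improving_step (worth I) (items I) (agents I) p) (agents I * (agents I * p)) {} Z \<and>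
      (\<forall>k\<ge>L * l. B k = {}) \<and>
      (\<forall>u<L. assignment_function.good_round (worth I) (1 / real L) l ({1..items I} \<times> {1..agents I}) (if u < N then Z else {}) u B) \<and>
      chain (assignment_function.rounding_step (worth I) (1 / real L) (L * l) (items I)) (agents I) (\<lambda>S. \<Union>k\<in>S. B k) G \<and>
      stored I s' = (if worth I Z < worth I (G S) then G S else Z)"
      using Zch B(2) B(3)[unfolded S5] Gch
      by (intro exI[of _ Z] exI[of _ B] exI[of _ G] exI[of _ "J 0"] conjI)
  qed
qed

text \<open>Here the mathematical parts meet: \<open>L * d = 1\<close> satisfies the premise of the
  rounding, so the rounded set is worth at least the expectation \<open>V\<close>, and the better of
  it and \<open>Z\<close> attains the maximum in \<open>approximation_ratio\<close>.\<close>

lemma algorithm_ratio: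
  assumes af: "assignment_function (worth I)" and n: "agents I \<ge> 1"
    and p: "p \<ge> 2" "3 / 4 \<le> (1 - 1 / real (2 * p) ^ 3) ^ (2 * p ^ 3)"
      "let x = (1 - 1 / real (2 * p) ^ 3) ^ (2 * p ^ 3) in
         exp (- 1) \<le> (1 - 1 / real (2 * p))\<^sup>2 * x ^ 3 * (7 / 4 - x - (1 - x) * ((2 + 1 / real p) * exp (- 1)))"
    and l: "l = 2 * p" and L: "L = l ^ 3" and N: "N = 2 * p ^ 3"
    and Z: "chain (\<lambda>_. assignment_function.improving_step (worth I) (items I) (agents I) p) (agents I * (agents I * p)) {} Z"
    and B: "\<forall>k\<ge>L * l. B k = {}"
      "\<forall>u<L. assignment_function.good_round (worth I) (1 / real L) l ({1..items I} \<times> {1..agents I}) (if u < N then Z else {}) u B"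
    and G: "chain (assignment_function.rounding_step (worth I) (1 / real L) (L * l) (items I)) (agents I) (\<lambda>S. \<Union>k\<in>S. B k) G"
    and X: "X = (if worth I Z < worth I (G S) then G S else Z)"
  shows "X \<subseteq> {1..items I} \<times> {1..agents I}" "inj_on snd X" "exp (- 1) * max_welfare I \<le> worth I X"
proof -
  interpret assignment_function "worth I" by (rule af)
  let ?E = "{1..items I} \<times> {1..agents I}"
  define d where "d = 1 / real L"
  define x where "x = (1 - d) ^ N"
  have l1: "l \<ge> 1" and L1: "L \<ge> 1" using p l L by auto
  have dl: "d = 1 / real l ^ 3" by (simp add: d_def L)
  have d01: "0 \<le> d" "d \<le> 1" using L1 by (auto simp: d_def field_simps)
  have N4: "4 * N = l ^ 3" by (simp add: N l power_mult_distrib)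
  then have LN: "L = 4 * N" using L by simp
  have xp: "x = (1 - 1 / real (2 * p) ^ 3) ^ (2 * p ^ 3)" unfolding x_def N dl l ..
  have x: "3 / 4 \<le> x" using p(2) unfolding xp .
  have x1: "x \<le> 1" unfolding x_def using d01 by (intro power_le_one) auto
  have good: "good_round d l ?E (if u < N then Z else {}) u B" if "u < L" for u using B(2) that unfolding d_def by blast
  obtain Ot where Ot: "Ot \<subseteq> ?E" "inj_on snd Ot" "worth I Ot = max_welfare I" by (rule optimum_as_pairs)
  have finO: "finite Ot" using Ot(1) by (rule finite_subset) simp
  note ls = local_search[OF Z p(1) n Ot(1,2)]
  define V where "V = avg d (L * l) (\<lambda>S. worth I (\<Union>k\<in>S. B k))"
  have "exp (- 1) * worth I Ot \<le> max (worth I Z) V"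
  proof (rule approximation_ratio[where p = p and x = x and c = "(1 - 1 / real l)\<^sup>2"])
    show "1 \<le> p" using p by simp
    show "3 / 4 \<le> x" "x \<le> 1" by (rule x x1)+
    show "exp (- 1) \<le> (1 - 1 / real l)\<^sup>2 * x ^ 3 * (7 / 4 - x - (1 - x) * ((2 + 1 / real p) * exp (- 1)))"
      using p(3) unfolding Let_def xp[symmetric] l .
    show "0 \<le> (1 - 1 / real l)\<^sup>2" by simp
    show "worth I (Z \<union> Ot) + worth I (Z \<inter> Ot) \<le> (2 + 1 / real p) * worth I Z" by (rule ls(1))
    assume Q: "0 \<le> worth I Ot - (1 - x) * worth I (Z \<union> Ot)"
    show "(1 - 1 / real l)\<^sup>2 * x ^ 3 * ((1 - x) * (worth I Ot - worth I (Z \<inter> Ot) - worth I (Z \<union> Ot)) +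
        x * worth I (Z \<union> Ot) / 4 + 3 / 4 * (worth I Ot - (1 - x) * worth I (Z \<union> Ot))) \<le> V"
      unfolding V_def LN
    proof (rule continuous_greedy[OF l1 dl N4 _ _ finO Ot(1,2) x_def Q])
      show "good_round d l ?E Z t B" if "t < N" for t using good[of t] that LN by simp
      show "good_round d l ?E {} t B" if "N \<le> t" "t < 4 * N" for t using good[of t] that LN by simp
    qed
  qed
  moreover have rd: "V \<le> worth I (G S)" "inj_on snd (G S)" "G S \<subseteq> ?E"
  proof -
    have BE: "B k \<subseteq> ?E" for k
    proof (cases "k < L * l")
      case True
      then have "k div l < L" "k mod l < l" using l1 by (auto simp: less_mult_imp_div_less)
      then have "B (k div l * l + k mod l) \<subseteq> ?E - (if k div l < N then Z else {})"
        by (intro good_roundD(1)[OF good]) auto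
      then show ?thesis by (auto split: if_splits)
    qed (use B(1) in simp)
    have mono: "mono (\<lambda>S. \<Union>k\<in>S. B k)" by (rule monoI) blast
    have sub: "(\<Union>k\<in>S. B k) \<subseteq> ?E" for S using BE by blast
    have one: "(\<Sum>c=1..items I. avg d (L * l) (\<lambda>S. of_bool ((c, q) \<in> (\<Union>k\<in>S. B k)))) \<le> 1" if "q \<in> {1..agents I}" for q
      by (rule good_rounds_total[OF _ d01]) (use good L1 in \<open>auto simp: d_def\<close>)
    note r = rounding[OF G[folded d_def] d01 mono sub one]
    show "V \<le> worth I (G S)" unfolding V_def by (rule r(1))
    show "inj_on snd (G S)" by (rule r(2))
    show "G S \<subseteq> ?E" by (rule r(3))
  qed
  ultimately show "exp (- 1) * max_welfare I \<le> worth I X" unfolding X Ot(3)[symmetric] by auto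
  show "X \<subseteq> ?E" "inj_on snd X" using X ls(2,3) rd(2,3) by simp_all
qed

lemma allocation_stored:
  assumes "inj_on snd (stored I s)"
  shows "allocation I (cs, s) \<in> feasible I" "welfare I (allocation I (cs, s)) = worth I (stored I s)"
proof -
  have r: "allocation I (cs, s) i = recipients I (stored I s) i" if "i \<in> {1..items I}" for i
    using that by (auto simp: allocation_def recipients_def stored_def)
  have "recipients I (stored I s) i \<inter> recipients I (stored I s) i' = {}" if "i \<noteq> i'" for i i'
    using inj_onD[OF assms, of "(i, _)" "(i', _)"] that by (auto simp: recipients_def)
  then have "disjoint_family_on (allocation I (cs, s)) {1..items I}"
    unfolding disjoint_family_on_def by (intro ballI impI) (simp only: r)
  moreover have "allocation I (cs, s) \<in> {1..items I} \<rightarrow>\<^sub>E Pow {1..agents I}"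
    unfolding allocation_def by (rule restrict_PiE[THEN iffD2]) auto
  ultimately show "allocation I (cs, s) \<in> feasible I" unfolding feasible_def by blast
  show "welfare I (allocation I (cs, s)) = worth I (stored I s)"
    unfolding welfare_def worth_def by (intro sum.cong refl) (simp_all only: r)
qed

text \<open>The run is a point distribution, so expectation is evaluation. Steps beyond halting
  change nothing, which allows the polynomial to overestimate the running time.\<close>

lemma randomized_approximation_deterministic:
  assumes P: "prog P R"
    and R: "\<And>I s cs. I \<in> Is \<Longrightarrow> R I \<lparr>nmem = \<lambda>x is. 0, rmem = \<lambda>x is. 0\<rparr> s \<Longrightarrow>
      allocation I ([], s) \<in> feasible I \<and> 1 / \<alpha> * max_welfare I \<le> welfare I (allocation I ([], s))"
  shows "randomized_approximation Is \<alpha> P"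
proof -
  let ?s0 = "\<lparr>nmem = \<lambda>x is. 0, rmem = \<lambda>x is. 0\<rparr> :: store"
  obtain T where T: "polynomially_bounded T" "\<And>I s. \<exists>t s'. t \<le> T I \<and> reach I P t s s' \<and> R I s s'"
    using P unfolding prog_def by blast
  obtain b :: "nat poly" where b: "\<And>I. T I \<le> poly b (agents I + items I)"
    using T(1) unfolding polynomially_bounded_def by blast
  show ?thesis unfolding randomized_approximation_def
  proof (intro exI[of _ b] ballI)
    fix I assume I: "I \<in> Is"
    obtain t s' where t: "t \<le> T I" "reach I P t ?s0 s'" "R I ?s0 s'" using T(2) by blast
    define u where "u = poly b (agents I + items I)"
    have "t \<le> u" using t(1) b[of I] by (simp add: u_def)
    then have u: "u = t + (u - t)" by simp
    have "steps I t (P, ?s0) = return_pmf ([], s')" using t(2)[unfolded reach_def, rule_format, of "[]"] by simp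
    then have "run P I u = return_pmf ([], s')"
      unfolding run_def by (subst u) (simp add: steps_add bind_return_pmf steps_halted)
    then show "let D = run P I (poly b (agents I + items I)) in
          (\<forall>c\<in>set_pmf D. fst c = [] \<and> allocation I c \<in> feasible I) \<and>
          measure_pmf.expectation D (\<lambda>c. welfare I (allocation I c)) \<ge> 1 / \<alpha> * max_welfare I"
      using R[OF I t(3)] unfolding u_def[symmetric] Let_def by simp
  qed
qed

theorem theorem1:
  "\<exists>P. randomized_approximation
         {I. negative_concave I \<and> (\<forall>S\<in>feasible I. welfare I S \<ge> 0)} (exp 1) P"
proof -
  obtain p where p: "p \<ge> 2" "3 / 4 \<le> (1 - 1 / real (2 * p) ^ 3) ^ (2 * p ^ 3)"
    "let x = (1 - 1 / real (2 * p) ^ 3) ^ (2 * p ^ 3) in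
       exp (- 1) \<le> (1 - 1 / real (2 * p))\<^sup>2 * x ^ 3 * (7 / 4 - x - (1 - x) * ((2 + 1 / real p) * exp (- 1)))"
    by (rule ratio_parameters)
  define l L N where "l = 2 * p" and "L = l ^ 3" and "N = 2 * p ^ 3"
  have l: "l \<ge> 1" and L: "L \<ge> 1" using p(1) by (simp_all add: l_def L_def)
  have "card (Pow {..<L * l}) = 2 ^ (L * l)" by (simp add: card_Pow)
  moreover have "\<exists>J. bij_betw J {..<card (Pow {..<L * l})} (Pow {..<L * l})"
    using ex_bij_betw_nat_finite[of "Pow {..<L * l}"] unfolding lessThan_atLeast0 by simp
  ultimately obtain J :: "nat \<Rightarrow> nat set" where J: "bij_betw J {..<2 ^ (L * l)} (Pow {..<L * l})" by metis
  have "randomized_approximation {I. negative_concave I \<and> (\<forall>S\<in>feasible I. welfare I S \<ge> 0)} (exp 1) (algorithm J L l N p)"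
  proof (rule randomized_approximation_deterministic[OF prog_algorithm[OF J L l]])
    let ?s0 = "\<lparr>nmem = \<lambda>x is. 0, rmem = \<lambda>x is. 0\<rparr> :: store"
    fix I s
    assume "I \<in> {I. negative_concave I \<and> (\<forall>S\<in>feasible I. welfare I S \<ge> 0)}"
    then have af: "assignment_function (worth I)" using worth_assignment_function by blast
    assume R: "agents I \<ge> 1 \<longrightarrow> assignment_function (worth I) \<longrightarrow>
      (\<exists>Z B G S. chain (\<lambda>_. assignment_function.improving_step (worth I) (items I) (agents I) p) (agents I * (agents I * p)) {} Z \<and>
      (\<forall>k\<ge>L * l. B k = {}) \<and>
      (\<forall>u<L. assignment_function.good_round (worth I) (1 / real L) l ({1..items I} \<times> {1..agents I}) (if u < N then Z else {}) u B) \<and>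
      chain (assignment_function.rounding_step (worth I) (1 / real L) (L * l) (items I)) (agents I) (\<lambda>S. \<Union>k\<in>S. B k) G \<and>
      stored I s = (if worth I Z < worth I (G S) then G S else Z))"
    have main: "inj_on snd (stored I s) \<and> exp (- 1) * max_welfare I \<le> worth I (stored I s)"
    proof (cases "agents I \<ge> 1")
      case True
      obtain Z B G S where *: "chain (\<lambda>_. assignment_function.improving_step (worth I) (items I) (agents I) p) (agents I * (agents I * p)) {} Z"
        "\<forall>k\<ge>L * l. B k = {}"
        "\<forall>u<L. assignment_function.good_round (worth I) (1 / real L) l ({1..items I} \<times> {1..agents I}) (if u < N then Z else {}) u B"
        "chain (assignment_function.rounding_step (worth I) (1 / real L) (L * l) (items I)) (agents I) (\<lambda>S. \<Union>k\<in>S. B k) G"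
        "stored I s = (if worth I Z < worth I (G S) then G S else Z)"
        using mp[OF mp[OF R True] af] by (elim exE conjE)
      show ?thesis using algorithm_ratio(2,3)[OF af True p l_def L_def N_def *] by blast
    next
      case False
      \<comment> \<open>Without agents nothing is known about the run, but the decoded output and
        the optimum are both empty.\<close>
      then have "stored I s = {}" by (auto simp: stored_def)
      moreover obtain Ot where "Ot \<subseteq> {1..items I} \<times> {1..agents I}" "worth I Ot = max_welfare I" by (rule optimum_as_pairs)
      moreover have "worth I {} = 0" by (simp add: worth_def recipients_def)
      ultimately show ?thesis using False by auto
    qed
    then show "allocation I ([], s) \<in> feasible I \<and> 1 / exp 1 * max_welfare I \<le> welfare I (allocation I ([], s))"
      using allocation_stored[of I s "[]"] by (simp add: exp_minus inverse_eq_divide)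
  qed
  then show ?thesis ..
qed

end
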